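(* Let $\mathbf{k}$ and $\boldsymbol{\ell}$ be distinct infinite sequences of positive integers. Then \[ H_{\mathbf{k}}(z_1)\neq H_{\boldsymbol{\ell}}(z_2) \] for all $z_1,z_2\in\mathbb{C}$ with $|z_1|=|z_2|=1$ and $z_1,z_2\neq1$. Moreover, for a fixed infinite sequence of positive integers $\mathbf{k}$, the map $z\mapsto H_{\mathbf{k}}(z)$ is one-to-one on $S^1\setminus\{1\}$, where $S^1=\{z\in\mathbb{C}:|z|=1\}$.
   Context: For positive integers $k_1,\ldots,k_r$, let $H_{k_1,\ldots,k_r}(z)=\sum_{n_1\ge\cdots\ge n_r\ge1}\frac{z^{n_1-1}}{n_1^{k_1}\cdots n_r^{k_r}}$ for $|z|<1$; it extends holomorphically to $\mathbb{C}\setminus[1,+\infty)$ and the same symbol denotes the extension. For an infinite sequence $\mathbf{k}=(k_1,k_2,\ldots)$ of positive integers, $H_{\mathbf{k}}(z)=\lim_{r\to\infty}H_{k_1,\ldots,k_r}(z)$, which exists locally uniformly on $\{\mathrm{Re}\,z<1\}\supset S^1\setminus\{1\}$. *)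

theory Defs
  imports "HOL-Complex_Analysis.Complex_Analysis"
begin

definition decr_tuples :: "nat \<Rightarrow> nat list set" where
  "decr_tuples r = {ns. length ns = r \<and> sorted_wrt (\<ge>) ns \<and> (\<forall>n\<in>set ns. n \<ge> 1)}"

text \<open>The index \<open>k\<^sub>1, \<dots>, k\<^sub>r\<close> is a nonempty list, so that \<open>n\<^sub>1\<close> is the head of
  the summation tuple. The multiple series converges absolutely for \<open>norm z < 1\<close>; outside the
  open unit disc \<open>H_series\<close> is not meant to be used.\<close>

definition H_series :: "nat list \<Rightarrow> complex \<Rightarrow> complex" where
  "H_series ks z =
     (\<Sum>\<^sub>\<infinity>ns\<in>decr_tuples (length ks).
        z ^ (hd ns - 1) / (\<Prod>i<length ks. of_nat (ns ! i) ^ (ks ! i)))"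

definition slit_plane :: "complex set" where
  "slit_plane = UNIV - complex_of_real ` {1..}"

text \<open>The domain is connected and contains the unit disc, so by the identity theorem the chosen
  extension is unique on \<open>slit_plane\<close>; values on \<open>[1, \<infinity>)\<close> are unspecified.\<close>

definition H_fin :: "nat list \<Rightarrow> complex \<Rightarrow> complex" where
  "H_fin ks = (SOME f. f holomorphic_on slit_plane \<and> (\<forall>z\<in>ball 0 1. f z = H_series ks z))"

text \<open>Sequences are indexed from 0, that is, \<open>k\<^sub>1 = k 0\<close>. The empty index, obtained for
  \<open>r = 0\<close>, does not affect the limit.\<close>

definition H_inf :: "(nat \<Rightarrow> nat) \<Rightarrow> complex \<Rightarrow> complex" where
  "H_inf k z = lim (\<lambda>r. H_fin (map k [0..<r]) z)"

end

theory Submission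
  imports Defs
begin

text \<open>
  Put \<open>k\<^sub>t(z) = 1 / (1 - t z)\<close> for \<open>0 \<le> t \<le> 1\<close>. In terms of the operators
  \<open>A f (z) = \<integral>\<^sub>0\<^sup>1 f(u z) du\<close> and \<open>B f (z) = \<integral>\<^sub>0\<^sup>1 f(u z) / (1 - u z) du\<close>, the function
  \<open>H\<close> of a finite index is obtained by applying the word with blocks \<open>A\<^sup>k\<^sup>-\<^sup>1 B\<close> to the
  constant \<open>1 = k\<^sub>0\<close>. The key observation is that \<open>A k\<^sub>t\<close> and \<open>B k\<^sub>t\<close> are the averages of
  \<open>k\<^sub>s\<close> over \<open>[0, t]\<close> and \<open>[t, 1]\<close>, so that all functions in sight are averages of the
  \<open>k\<^sub>t\<close>. This makes them univalent on \<open>Re z < 1\<close>, with explicit lower bounds for their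
  difference quotients, which gives injectivity.

  For distinct indices one shows that the images of the discs \<open>norm z \<le> \<rho>\<close> are nested. Let
  \<open>G w s\<close> be the word \<open>w\<close> applied to \<open>k\<^sub>s\<close>. Since \<open>A k\<^sub>0 = k\<^sub>0\<close>, \<open>B k\<^sub>1 = k\<^sub>1\<close> and
  \<open>A k\<^sub>1 = B k\<^sub>0\<close>, the families \<open>s \<mapsto> G w s\<close> fit together to paths from smaller to larger
  words in the lexicographic order, and it suffices to see that the image grows with \<open>s\<close>. The
  infinitesimal form of this is \<open>Re (z (G w s)' / \<partial>\<^sub>s (G w s)) > 0\<close> on the disc. It is proved by
  induction on \<open>w\<close>: both operators turn into first order differential relations for this
  quotient, for the starlikeness quotient of \<open>\<partial>\<^sub>s (G w s)\<close> and for \<open>G w s / \<partial>\<^sub>s (G w s)\<close>, and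
  these are treated with the maximum principle in the style of Jack's lemma. On the boundary
  circle the nesting remains strict because a root of \<open>G w s = c\<close> on the unit circle leaves the
  closed disc as soon as \<open>s\<close> decreases.
\<close>

section \<open>The averaging operators\<close>

text \<open>Only the quotient \<open>deriv (G w s) / dG w s\<close> is wanted for the motion of
  roots; the other quotients are forced by the letter B. Differentiating
  \<open>(1 - z) * (P + z * P') = g\<close> leaves the term \<open>g / dg / (1 - z)\<close>, whose
  real part has to be nonnegative. The kernels alone do not give this: for \<open>Im z > 0\<close>
  they place \<open>g\<close> in the cone spanned by 1 and \<open>1 / (1 - z)\<close>, and
  \<open>dg\<close> in the cone spanned by 1 and the square of \<open>1 / (1 - z)\<close>, which
  suffices only once \<open>Im (g / dg) \<le> 0\<close>. That sign propagates along words only with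
  control of both the real and the imaginary part of the starlikeness quotient. The other obstacle
  is the passage to infinite indices, where strict nesting is lost in the limit. The univalence
  bounds are therefore explicit: they contain the mean of the averaging measure, which is at least
  \<open>(1 / 2) ^ k\<^sub>1\<close> for all truncations, because the outermost letter B is preceded
  by \<open>k\<^sub>1 - 1\<close> letters A.\<close>

definition ker :: "real \<Rightarrow> complex \<Rightarrow> complex" where
  "ker t z = 1 / (1 - of_real t * z)"

definition den :: "bool \<Rightarrow> real \<Rightarrow> complex \<Rightarrow> complex" where
  "den b u z = (if b then 1 - of_real (1 - u) * z else 1)"

definition mob :: "bool \<Rightarrow> real \<Rightarrow> complex \<Rightarrow> complex" where
  "mob b u z = of_real u * z / den b u z"

definition shift_par :: "bool \<Rightarrow> real \<Rightarrow> real \<Rightarrow> real" where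
  "shift_par b u t = (if b then 1 - u + u * t else u * t)"

text \<open>Letter \<open>A\<close> is \<open>False\<close> and letter \<open>B\<close> is \<open>True\<close>. For \<open>B\<close> the path of integration from
  \<open>0\<close> to \<open>z\<close> is the circular arc \<open>u \<mapsto> mob True u z\<close> instead of the segment, because on this arc
  the integrand becomes a kernel again whenever \<open>f\<close> is one. The exponent \<open>i\<close> makes \<open>i\<close>-th powers
  of kernels go to averages of \<open>i\<close>-th powers; only \<open>i \<le> 2\<close> and, for remainder terms,
  \<open>i = 3\<close> are used.\<close>

definition avg_op :: "bool \<Rightarrow> nat \<Rightarrow> (complex \<Rightarrow> complex) \<Rightarrow> complex \<Rightarrow> complex" where
  "avg_op b i f z = integral {0..1} (\<lambda>u. of_real u ^ (i - 1) * f (mob b u z) / den b u z ^ i)"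

text \<open>The slit plane is the common domain of all kernels with parameter in
  \<open>[0, 1]\<close>. Since \<open>den b u z\<close> and \<open>wt b z\<close> both have the form
  \<open>1 - t * z\<close> with such a \<open>t\<close>, this is the source of the nonvanishing of
  all denominators.\<close>

lemma slit_plane_iff: "z \<in> slit_plane \<longleftrightarrow> (\<forall>t\<in>{0..1}. 1 - of_real t * z \<noteq> 0)"
proof
  assume z: "z \<in> slit_plane"
  show "\<forall>t\<in>{0..1}. 1 - complex_of_real t * z \<noteq> 0"
  proof (intro ballI notI)
    fix t :: real assume t: "t \<in> {0..1}" "1 - complex_of_real t * z = 0"
    then have "t \<noteq> 0" by auto
    then have "z = complex_of_real (1 / t)" "1 / t \<ge> 1"
      using t by (auto simp: field_simps)
    then show False using z unfolding slit_plane_def by blast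
  qed
next
  assume h: "\<forall>t\<in>{0..1}. 1 - complex_of_real t * z \<noteq> 0"
  show "z \<in> slit_plane" unfolding slit_plane_def
  proof safe
    fix x :: real assume x: "x \<ge> 1" "z = complex_of_real x"
    then have "1 - complex_of_real (1 / x) * z = 0" by (simp add: field_simps)
    moreover have "1 / x \<in> {0..1}" using x by auto
    ultimately show False using h by blast
  qed auto
qed

lemma slit_plane_nz: "z \<in> slit_plane \<Longrightarrow> 0 \<le> t \<Longrightarrow> t \<le> 1 \<Longrightarrow> 1 - of_real t * z \<noteq> 0"
  by (simp add: slit_plane_iff)

lemma den_nz: "z \<in> slit_plane \<Longrightarrow> 0 \<le> u \<Longrightarrow> u \<le> 1 \<Longrightarrow> den b u z \<noteq> 0"
  unfolding den_def using slit_plane_nz[of z "1 - u"] by auto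

lemma shift_par_01: "0 \<le> u \<Longrightarrow> u \<le> 1 \<Longrightarrow> 0 \<le> t \<Longrightarrow> t \<le> 1 \<Longrightarrow> 0 \<le> shift_par b u t \<and> shift_par b u t \<le> 1"
  unfolding shift_par_def by (auto simp: mult_le_one intro: mult_left_le)

text \<open>The factor \<open>den b u z\<close> does not involve \<open>t\<close>, so pulling a
  kernel back along the arc only applies the affine map \<open>shift_par b u\<close> to its
  parameter. This map sends \<open>[0, 1]\<close> onto \<open>[0, u]\<close> for A and onto
  \<open>[1 - u, 1]\<close> for B.\<close>

lemma den_mob:
  assumes "z \<in> slit_plane" "0 \<le> u" "u \<le> 1"
  shows "den b u z * (1 - of_real t * mob b u z) = 1 - of_real (shift_par b u t) * z"
  using den_nz[OF assms, of b] unfolding mob_def shift_par_def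
  by (simp add: field_simps) (simp add: den_def algebra_simps)

lemma mob_slit:
  assumes "z \<in> slit_plane" "0 \<le> u" "u \<le> 1"
  shows "mob b u z \<in> slit_plane"
  unfolding slit_plane_iff
  using den_mob[OF assms, of b] den_nz[OF assms, of b] shift_par_01[OF assms(2,3)] slit_plane_nz[OF assms(1)]
  by (metis atLeastAtMost_iff mult_zero_right)

lemma ker_mob:
  assumes "z \<in> slit_plane" "0 \<le> u" "u \<le> 1"
  shows "ker t (mob b u z) = den b u z * ker (shift_par b u t) z"
  using den_nz[OF assms, of b] unfolding ker_def den_mob[OF assms, symmetric] by simp

lemma open_slit_plane: "open slit_plane"
proof -
  have "closed (complex_of_real ` {1..})"
    by (intro closed_injective_linear_image) (auto simp: linear_of_real inj_on_def)
  then show ?thesis unfolding slit_plane_def by (simp add: open_Diff)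
qed

lemma Re_less_slit: "Re z < 1 \<Longrightarrow> z \<in> slit_plane"
  unfolding slit_plane_def by auto

lemma starlike_slit: "z \<in> slit_plane \<Longrightarrow> closed_segment 0 z \<subseteq> slit_plane"
proof -
  assume z: "z \<in> slit_plane"
  have "mob False u z \<in> slit_plane" if "0 \<le> u" "u \<le> 1" for u using mob_slit[OF z that] .
  then show ?thesis by (auto simp: closed_segment_def mob_def den_def scaleR_conv_of_real)
qed

lemma zero_slit [simp]: "0 \<in> slit_plane" by (simp add: slit_plane_iff)

lemma continuous_integrand:
  assumes "continuous_on slit_plane f"
  shows "continuous_on (slit_plane \<times> {0..1})
     (\<lambda>(z, u). of_real u ^ (i - 1) * f (mob b u z) / den b u z ^ i)"
proof -
  have den: "continuous_on (slit_plane \<times> {0..1}) (\<lambda>x. den b (snd x) (fst x))"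
    unfolding den_def by (cases b; simp; intro continuous_intros)
  have mob: "continuous_on (slit_plane \<times> {0..1}) (\<lambda>x. mob b (snd x) (fst x))"
    unfolding mob_def by (intro continuous_intros den) (auto simp: den_nz)
  have "continuous_on (slit_plane \<times> {0..1}) (\<lambda>x. f (mob b (snd x) (fst x)))"
    by (rule continuous_on_compose2[OF assms mob]) (auto simp: mob_slit)
  then show ?thesis unfolding case_prod_unfold
    by (intro continuous_intros den) (auto simp: den_nz)
qed

lemma continuous_integrand1:
  assumes "continuous_on slit_plane f" "z \<in> slit_plane"
  shows "continuous_on {0..1} (\<lambda>u. of_real u ^ (i - 1) * f (mob b u z) / den b u z ^ i)"
proof -
  have "continuous_on {0..1} ((\<lambda>(z, u). of_real u ^ (i - 1) * f (mob b u z) / den b u z ^ i) \<circ> (\<lambda>u. (z, u)))"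
    using continuous_on_subset[OF continuous_integrand[OF assms(1)], of "Pair z ` {0..1}"] assms(2)
    by (intro continuous_on_compose continuous_on_Pair continuous_on_const continuous_on_id) auto
  then show ?thesis by (simp add: comp_def)
qed

lemma avg_op_has_integral:
  assumes "continuous_on slit_plane f" "z \<in> slit_plane"
  shows "((\<lambda>u. of_real u ^ (i - 1) * f (mob b u z) / den b u z ^ i) has_integral avg_op b i f z) {0..1}"
  unfolding avg_op_def
  by (intro integrable_integral integrable_continuous_interval continuous_integrand1 assms)

lemma continuous_opr:
  assumes "continuous_on slit_plane f"
  shows "continuous_on slit_plane (avg_op b i f)"
proof -
  have "continuous_on slit_plane (\<lambda>z. integral (cbox 0 1) (\<lambda>u. of_real u ^ (i - 1) * f (mob b u z) / den b u z ^ i))"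
    by (rule integral_continuous_on_param) (use continuous_integrand[OF assms] in simp)
  then show ?thesis by (simp add: avg_op_def[abs_def])
qed

section \<open>Primitives and the differential equation of the operators\<close>

definition wt :: "bool \<Rightarrow> complex \<Rightarrow> complex" where
  "wt b z = (if b then 1 - z else 1)"

lemma wt_nz: "z \<in> slit_plane \<Longrightarrow> wt b z \<noteq> 0"
  using slit_plane_nz[of z 1] by (auto simp: wt_def)

text \<open>Substituting \<open>w = mob b u z\<close> turns the operator into the path integral of
  \<open>w ^ (i - 1) * f w / wt b w\<close> from 0 to \<open>z\<close>, because
  \<open>wt b (mob b u z) = wt b z / den b u z\<close>. The slit plane is starlike about 0, so a
  primitive exists and the choice of arc is immaterial.\<close>

lemma avg_op_primitive:
  assumes f: "f holomorphic_on slit_plane" and i: "i \<ge> 1"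
  obtains \<Phi> where "\<And>z. z \<in> slit_plane \<Longrightarrow> (\<Phi> has_field_derivative (z ^ (i - 1) * f z / wt b z)) (at z)"
    "\<And>z. z \<in> slit_plane \<Longrightarrow> z ^ i * avg_op b i f z = \<Phi> z"
proof -
  have hol: "(\<lambda>z. z ^ (i - 1) * f z / wt b z) holomorphic_on slit_plane"
  proof -
    have "wt b holomorphic_on slit_plane"
      unfolding wt_def[abs_def] by (cases b; simp; intro holomorphic_intros)
    then show ?thesis by (intro holomorphic_intros f) (auto simp: wt_nz)
  qed
  have star: "starlike slit_plane" using starlike_slit zero_slit unfolding starlike_def by blast
  obtain \<Psi> where \<Psi>: "\<And>z. z \<in> slit_plane \<Longrightarrow> (\<Psi> has_field_derivative (z ^ (i - 1) * f z / wt b z)) (at z)"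
    using holomorphic_starlike_primitive[OF holomorphic_on_imp_continuous_on[OF hol] star open_slit_plane, of "{}"]
      holomorphic_on_imp_differentiable_at[OF hol open_slit_plane] by auto
  define \<Phi> where "\<Phi> z = \<Psi> z - \<Psi> 0" for z
  have 1: "(\<Phi> has_field_derivative (z ^ (i - 1) * f z / wt b z)) (at z)" if "z \<in> slit_plane" for z
    unfolding \<Phi>_def using \<Psi>[OF that] by (auto intro!: derivative_eq_intros)
  have 2: "z ^ i * avg_op b i f z = \<Phi> z" if z: "z \<in> slit_plane" for z
  proof -
    have "((\<lambda>u. \<Phi> (mob b u z)) has_vector_derivative
        z ^ i * (of_real u ^ (i - 1) * f (mob b u z) / den b u z ^ i)) (at u within {0..1})"
      if u: "u \<in> {0..1}" for u
    proof -
      have u': "0 \<le> u" "u \<le> 1" using u by auto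
      have nz: "den b u z \<noteq> 0" using den_nz[OF z u'] .
      have m: "((\<lambda>u. mob b u z) has_vector_derivative z * wt b z / den b u z ^ 2) (at u within {0..1})"
      proof -
        have "((\<lambda>x. x * z / (if b then 1 - (1 - x) * z else 1)) has_field_derivative z * wt b z / den b u z ^ 2) (at (of_real u))"
        proof (cases b)
          case True
          let ?q = "\<lambda>x. 1 - (1 - x) * z"
          have q: "?q (of_real u) \<noteq> 0" using nz True by (simp add: den_def)
          have "((\<lambda>x. x * z) has_field_derivative z) (at (of_real u))"
            by (auto intro!: derivative_eq_intros)
          moreover have "(?q has_field_derivative z) (at (of_real u))"
            by (auto intro!: derivative_eq_intros)
          ultimately have "((\<lambda>x. x * z / ?q x) has_field_derivative
              (z * ?q (of_real u) - of_real u * z * z) / (?q (of_real u) * ?q (of_real u))) (at (of_real u))"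
            using q by (rule DERIV_divide)
          moreover have "z * ?q (of_real u) - of_real u * z * z = z * (1 - z)" by (simp add: algebra_simps)
          ultimately show ?thesis using True by (simp add: den_def wt_def power2_eq_square)
        next
          case False
          then show ?thesis by (auto intro!: derivative_eq_intros simp: den_def wt_def)
        qed
        from has_vector_derivative_real_field[OF this, of "{0..1}"]
        have "((\<lambda>x. of_real x * z / (if b then 1 - of_real (1 - x) * z else 1)) has_vector_derivative z * wt b z / den b u z ^ 2) (at u within {0..1})"
          by (simp only: of_real_diff of_real_1)
        then show ?thesis unfolding mob_def den_def .
      qed
      have "((\<lambda>u. \<Phi> (mob b u z)) has_vector_derivative
         (z * wt b z / den b u z ^ 2) * (mob b u z ^ (i - 1) * f (mob b u z) / wt b (mob b u z))) (at u within {0..1})"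
        by (rule field_vector_diff_chain_within[OF m, unfolded comp_def])
           (rule has_field_derivative_at_within[OF 1[OF mob_slit[OF z u']]])
      moreover have "(z * wt b z / den b u z ^ 2) * (mob b u z ^ (i - 1) * f (mob b u z) / wt b (mob b u z)) =
         z ^ i * (of_real u ^ (i - 1) * f (mob b u z) / den b u z ^ i)"
      proof -
        have w: "wt b (mob b u z) = wt b z / den b u z"
          using den_mob[OF z u', of b 1] nz by (auto simp: wt_def shift_par_def den_def field_simps)
        obtain j where j: "i = Suc j" using i by (cases i) auto
        have alg: "z * W / q\<^sup>2 * (X * Y / Q * F / (W / q)) = z * Y * (X * F / (q * Q))"
          if "W \<noteq> 0" "q \<noteq> 0" for W q X Y Q F :: complex
          using that by (simp add: power2_eq_square)
        have "z * wt b z / (den b u z)\<^sup>2 * (of_real u ^ j * z ^ j / den b u z ^ j * f (mob b u z) / (wt b z / den b u z))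
            = z * z ^ j * (of_real u ^ j * f (mob b u z) / (den b u z * den b u z ^ j))"
          by (rule alg[OF wt_nz[OF z] nz])
        then show ?thesis unfolding w
          by (simp only: j mob_def[of b u z] power_divide power_mult_distrib diff_Suc_1 power_Suc)
      qed
      ultimately show ?thesis by simp
    qed
    then have I1: "((\<lambda>u. z ^ i * (of_real u ^ (i - 1) * f (mob b u z) / den b u z ^ i)) has_integral
        \<Phi> (mob b 1 z) - \<Phi> (mob b 0 z)) {0..1}"
      by (rule fundamental_theorem_of_calculus[OF zero_le_one])
    have I2: "((\<lambda>u. z ^ i * (of_real u ^ (i - 1) * f (mob b u z) / den b u z ^ i)) has_integral z ^ i * avg_op b i f z) {0..1}"
      by (rule has_integral_mult_right[OF avg_op_has_integral[OF holomorphic_on_imp_continuous_on[OF f] z]])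
    have "z ^ i * avg_op b i f z = \<Phi> (mob b 1 z) - \<Phi> (mob b 0 z)"
      by (rule has_integral_unique[OF I2 I1])
    then show ?thesis by (simp add: \<Phi>_def mob_def den_def)
  qed
  show ?thesis by (rule that[OF 1 2])
qed

lemma avg_op_zero:
  assumes "i \<ge> 1"
  shows "avg_op b i f 0 = f 0 / of_nat i"
proof -
  have "((\<lambda>u::real. u ^ (i - 1)) has_integral (1 ^ i / i - 0 ^ i / i)) {0..1}"
    by (rule fundamental_theorem_of_calculus)
       (use assms in \<open>auto intro!: derivative_eq_intros simp: has_real_derivative_iff_has_vector_derivative[symmetric] field_simps\<close>)
  then have "((\<lambda>u::real. u ^ (i - 1)) has_integral (1 / i)) {0..1}"
    using assms by (simp add: zero_power)
  from has_integral_linear[OF this bounded_linear_of_real]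
  have "((\<lambda>u. of_real (u ^ (i - 1))) has_integral (of_real (1 / i) :: complex)) {0..1}"
    by (simp only: o_def)
  then have "((\<lambda>u. of_real (u ^ (i - 1)) * f 0) has_integral (of_real (1 / i) * f 0)) {0..1}"
    by (rule has_integral_mult_left)
  then have "integral {0..1} (\<lambda>u. of_real (u ^ (i - 1)) * f 0) = of_real (1 / i) * f 0"
    by (rule integral_unique)
  moreover have "den b u 0 = 1" for u by (simp add: den_def)
  ultimately show ?thesis unfolding avg_op_def by (simp add: mob_def)
qed

text \<open>The primitive controls only \<open>z ^ i * avg_op b i f z\<close>, so holomorphy is
  obtained away from 0; the point 0 is a removable singularity because the integral is continuous
  there.\<close>

lemma avg_op_holo:
  assumes f: "f holomorphic_on slit_plane" and i: "i \<ge> 1"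
  shows "avg_op b i f holomorphic_on slit_plane"
proof -
  obtain \<Phi> where \<Phi>: "\<And>z. z \<in> slit_plane \<Longrightarrow> (\<Phi> has_field_derivative (z ^ (i - 1) * f z / wt b z)) (at z)"
    "\<And>z. z \<in> slit_plane \<Longrightarrow> z ^ i * avg_op b i f z = \<Phi> z" using avg_op_primitive[OF f i] by metis
  have \<Phi>_hol: "\<Phi> holomorphic_on slit_plane"
    unfolding holomorphic_on_open[OF open_slit_plane] using \<Phi>(1) by blast
  have "(\<lambda>z. \<Phi> z / z ^ i) holomorphic_on slit_plane - {0}"
    by (intro holomorphic_intros holomorphic_on_subset[OF \<Phi>_hol]) auto
  moreover have "\<Phi> z / z ^ i = avg_op b i f z" if "z \<in> slit_plane - {0}" for z
    using that \<Phi>(2)[of z, symmetric] by simp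
  ultimately have "avg_op b i f holomorphic_on slit_plane - {0}"
    using holomorphic_transform by blast
  then show ?thesis
    using no_isolated_singularity[OF continuous_opr[OF holomorphic_on_imp_continuous_on[OF f]] _ open_slit_plane, of b i "{0}"]
    by simp
qed

text \<open>The primitive relation, differentiated and divided by \<open>z ^ (i - 1)\<close>.
  Through this equation the letters enter both the estimates on the disc and the comparison of power
  series.\<close>

lemma avg_op_ode:
  assumes f: "f holomorphic_on slit_plane" and i: "i \<ge> 1" and z: "z \<in> slit_plane"
  shows "wt b z * (of_nat i * avg_op b i f z + z * deriv (avg_op b i f) z) = f z"
proof (cases "z = 0")
  case True
  then show ?thesis using i avg_op_zero[OF i, of b f] by (simp add: wt_def)
next
  case False
  obtain \<Phi> where \<Phi>: "\<And>z. z \<in> slit_plane \<Longrightarrow> (\<Phi> has_field_derivative (z ^ (i - 1) * f z / wt b z)) (at z)"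
    "\<And>z. z \<in> slit_plane \<Longrightarrow> z ^ i * avg_op b i f z = \<Phi> z" using avg_op_primitive[OF f i] by metis
  have "(avg_op b i f has_field_derivative deriv (avg_op b i f) z) (at z)"
    using holomorphic_derivI[OF avg_op_holo[OF f i] open_slit_plane z] .
  then have "((\<lambda>z. z ^ i * avg_op b i f z) has_field_derivative
      of_nat i * z ^ (i - 1) * avg_op b i f z + z ^ i * deriv (avg_op b i f) z) (at z)"
    by (auto intro!: derivative_eq_intros)
  moreover have "((\<lambda>z. z ^ i * avg_op b i f z) has_field_derivative (z ^ (i - 1) * f z / wt b z)) (at z)"
    by (rule DERIV_cong_ev[THEN iffD2, OF refl _ refl \<Phi>(1)[OF z]])
       (use \<Phi>(2) open_slit_plane z in \<open>auto simp: eventually_nhds\<close>)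
  ultimately have "of_nat i * z ^ (i - 1) * avg_op b i f z + z ^ i * deriv (avg_op b i f) z = z ^ (i - 1) * f z / wt b z"
    by (rule DERIV_unique)
  moreover obtain j where j: "i = Suc j" using i by (cases i) auto
  ultimately have "z ^ j * (of_nat i * avg_op b i f z + z * deriv (avg_op b i f) z) = z ^ j * (f z / wt b z)"
    by (simp add: algebra_simps)
  then have "of_nat i * avg_op b i f z + z * deriv (avg_op b i f) z = f z / wt b z"
    using False by (metis mult_cancel_left power_not_zero times_divide_eq_right)
  then show ?thesis using wt_nz[OF z, of b] by simp
qed

section \<open>Words and the functions \<open>G\<close>\<close>

lemma avg_op_cong:
  assumes "\<And>z. z \<in> slit_plane \<Longrightarrow> f z = g z" "z \<in> slit_plane"
  shows "avg_op b i f z = avg_op b i g z"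
  unfolding avg_op_def by (rule integral_cong) (simp add: assms mob_slit)

lemma avg_op_add:
  assumes "continuous_on slit_plane f" "continuous_on slit_plane g" "z \<in> slit_plane"
  shows "avg_op b i (\<lambda>z. f z + g z) z = avg_op b i f z + avg_op b i g z"
proof -
  have "((\<lambda>u. of_real u ^ (i - 1) * f (mob b u z) / den b u z ^ i + of_real u ^ (i - 1) * g (mob b u z) / den b u z ^ i)
    has_integral avg_op b i f z + avg_op b i g z) {0..1}"
    by (intro has_integral_add avg_op_has_integral assms)
  then show ?thesis unfolding avg_op_def[of b i "\<lambda>z. f z + g z"]
    by (intro integral_unique) (simp add: distrib_left add_divide_distrib)
qed

lemma avg_op_cmul: "avg_op b i (\<lambda>z. c * f z) z = c * avg_op b i f z"
proof -
  have "(\<lambda>u. of_real u ^ (i - 1) * (c * f (mob b u z)) / den b u z ^ i)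
    = (\<lambda>u. c * (of_real u ^ (i - 1) * f (mob b u z) / den b u z ^ i))" by (auto simp: algebra_simps)
  then show ?thesis unfolding avg_op_def by (simp only: integral_mult_right)
qed

text \<open>The arc point \<open>mob b u z\<close> carries exactly one factor
  \<open>u / den b u z\<close>, which raises the exponent by one. Hence a factor \<open>z\<close>
  passes through a word, and the parameter derivative \<open>z * ker s z ^ 2\<close> of a kernel
  becomes \<open>z\<close> times a word of exponent 2.\<close>

lemma avg_op_shift:
  assumes "i \<ge> 1"
  shows "avg_op b i (\<lambda>z. z * f z) z = z * avg_op b (Suc i) f z"
proof -
  obtain j where j: "i = Suc j" using assms by (cases i) auto
  have "(\<lambda>u. of_real u ^ (i - 1) * (mob b u z * f (mob b u z)) / den b u z ^ i)
    = (\<lambda>u. z * (of_real u ^ (Suc i - 1) * f (mob b u z) / den b u z ^ Suc i))"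
    unfolding j by (auto simp: mob_def[of b _ z] algebra_simps)
  then show ?thesis unfolding avg_op_def by (simp only: integral_mult_right)
qed

text \<open>The head of the list is the outermost operator, so words with a common prefix differ
  only in the function to which the prefix is applied.\<close>

definition word :: "nat \<Rightarrow> bool list \<Rightarrow> (complex \<Rightarrow> complex) \<Rightarrow> complex \<Rightarrow> complex" where
  "word i w f = foldr (\<lambda>b. avg_op b i) w f"

lemma word_Nil [simp]: "word i [] f = f"
  and word_Cons [simp]: "word i (b # w) f = avg_op b i (word i w f)"
  and word_append: "word i (v @ w) f = word i v (word i w f)"
  by (simp_all add: word_def)

lemma word_holo:
  assumes "f holomorphic_on slit_plane" "i \<ge> 1"
  shows "word i w f holomorphic_on slit_plane"
  by (induction w) (use assms avg_op_holo in auto)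

lemma word_cont: "f holomorphic_on slit_plane \<Longrightarrow> i \<ge> 1 \<Longrightarrow> continuous_on slit_plane (word i w f)"
  by (intro holomorphic_on_imp_continuous_on word_holo)

lemma word_cong:
  assumes "\<And>z. z \<in> slit_plane \<Longrightarrow> f z = g z" "z \<in> slit_plane"
  shows "word i w f z = word i w g z"
  using assms(2) by (induction w arbitrary: z) (auto simp: assms(1) intro: avg_op_cong)

lemma word_add:
  assumes "f holomorphic_on slit_plane" "g holomorphic_on slit_plane" "i \<ge> 1" "z \<in> slit_plane"
  shows "word i w (\<lambda>z. f z + g z) z = word i w f z + word i w g z"
  using assms(4)
proof (induction w arbitrary: z)
  case (Cons b w)
  have "word i (b # w) (\<lambda>z. f z + g z) z = avg_op b i (\<lambda>z. word i w f z + word i w g z) z"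
    unfolding word_Cons by (rule avg_op_cong) (use Cons in auto)
  also have "\<dots> = word i (b # w) f z + word i (b # w) g z"
    unfolding word_Cons by (intro avg_op_add word_cont assms Cons.prems)
  finally show ?case .
qed simp

lemma word_cmul:
  assumes "z \<in> slit_plane"
  shows "word i w (\<lambda>z. c * f z) z = c * word i w f z"
  using assms
proof (induction w arbitrary: z)
  case (Cons b w)
  have "word i (b # w) (\<lambda>z. c * f z) z = avg_op b i (\<lambda>z. c * word i w f z) z"
    unfolding word_Cons by (rule avg_op_cong) (use Cons in auto)
  then show ?case by (simp add: avg_op_cmul)
qed simp

lemma word_shift:
  assumes "z \<in> slit_plane" "i \<ge> 1"
  shows "word i w (\<lambda>z. z * f z) z = z * word (Suc i) w f z"
  using assms(1)
proof (induction w arbitrary: z)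
  case (Cons b w)
  have "word i (b # w) (\<lambda>z. z * f z) z = avg_op b i (\<lambda>z. z * word (Suc i) w f z) z"
    unfolding word_Cons by (rule avg_op_cong) (use Cons in auto)
  then show ?case unfolding word_Cons avg_op_shift[OF assms(2)] .
qed simp

lemma ker_holo: "0 \<le> s \<Longrightarrow> s \<le> 1 \<Longrightarrow> ker s holomorphic_on slit_plane"
  unfolding ker_def[abs_def] by (intro holomorphic_intros slit_plane_nz)

definition G :: "bool list \<Rightarrow> real \<Rightarrow> complex \<Rightarrow> complex" where
  "G w s = word 1 w (ker s)"

text \<open>\<open>z * dG w s z\<close> is the partial derivative of \<open>G w s z\<close> with respect to \<open>s\<close>.\<close>

definition dG :: "bool list \<Rightarrow> real \<Rightarrow> complex \<Rightarrow> complex" where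
  "dG w s = word 2 w (\<lambda>z. ker s z ^ 2)"

lemma G_holo: "0 \<le> s \<Longrightarrow> s \<le> 1 \<Longrightarrow> G w s holomorphic_on slit_plane"
  unfolding G_def by (intro word_holo ker_holo) auto

lemma dG_holo: "0 \<le> s \<Longrightarrow> s \<le> 1 \<Longrightarrow> dG w s holomorphic_on slit_plane"
  unfolding dG_def by (intro word_holo holomorphic_intros ker_holo) auto

lemma G_Nil: "G [] s = ker s" and G_Cons: "G (b # w) s = avg_op b 1 (G w s)"
  and dG_Nil: "dG [] s = (\<lambda>z. ker s z ^ 2)" and dG_Cons: "dG (b # w) s = avg_op b 2 (dG w s)"
  by (simp_all add: G_def dG_def)

lemma G_zero: "G w s 0 = 1"
  by (induction w) (auto simp: G_Nil G_Cons avg_op_zero ker_def)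

lemma avg_op_ker:
  assumes "z \<in> slit_plane"
  shows "avg_op b 1 (ker s) z = integral {0..1} (\<lambda>u. ker (shift_par b u s) z)"
  unfolding avg_op_def
  by (rule integral_cong) (use assms in \<open>auto simp: ker_mob den_nz\<close>)

lemma G_snoc: "z \<in> slit_plane \<Longrightarrow> G (w @ [False]) 0 z = G w 0 z"
  "z \<in> slit_plane \<Longrightarrow> G (w @ [True]) 1 z = G w 1 z"
  "z \<in> slit_plane \<Longrightarrow> G (w @ [True]) 0 z = G (w @ [False]) 1 z"
proof -
  have 1: "avg_op False 1 (ker 0) z = ker 0 z" "avg_op True 1 (ker 1) z = ker 1 z" if "z \<in> slit_plane" for z
    using that by (simp_all add: avg_op_ker shift_par_def del: One_nat_def)
  have 2: "avg_op True 1 (ker 0) z = avg_op False 1 (ker 1) z" if "z \<in> slit_plane" for z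
  proof -
    have "integral {0..1} (\<lambda>u. ker (1 - u) z) = integral {0..1} (\<lambda>u. ker u z)"
    proof (rule integral_unique)
      have "continuous_on {0..1} (\<lambda>u. ker u z)"
        unfolding ker_def by (intro continuous_intros) (use slit_plane_nz[OF that] in auto)
      then have "((\<lambda>u. ker u z) has_integral integral {0..1} (\<lambda>u. ker u z)) (cbox 0 1)"
        by (simp add: integrable_continuous_interval integrable_integral)
      from has_integral_affinity[OF this, of "-1" 1]
      show "((\<lambda>u. ker (1 - u) z) has_integral integral {0..1} (\<lambda>u. ker u z)) {0..1}"
        by (simp add: image_affinity_atLeastAtMost_diff image_diff_atLeastAtMost minus_diff_commute)
    qed
    then show ?thesis using that by (simp add: avg_op_ker shift_par_def del: One_nat_def)
  qed
  show "z \<in> slit_plane \<Longrightarrow> G (w @ [False]) 0 z = G w 0 z"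
    "z \<in> slit_plane \<Longrightarrow> G (w @ [True]) 1 z = G w 1 z"
    "z \<in> slit_plane \<Longrightarrow> G (w @ [True]) 0 z = G (w @ [False]) 1 z"
    unfolding G_def word_append by (rule word_cong; simp add: 1 2 del: One_nat_def)+
qed

section \<open>Bounds along words and the expansion in the parameter\<close>

definition kbound :: "complex \<Rightarrow> real \<Rightarrow> bool" where
  "kbound z m \<longleftrightarrow> (\<forall>t\<in>{0..1}. norm (ker t z) \<le> m)"

lemma kbound_mob:
  assumes "kbound z m" "z \<in> slit_plane" "0 \<le> u" "u \<le> 1"
  shows "kbound (mob b u z) (norm (den b u z) * m)"
  unfolding kbound_def
proof
  fix t :: real assume "t \<in> {0..1}"
  then have "norm (ker (shift_par b u t) z) \<le> m" using assms shift_par_01 unfolding kbound_def by simp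
  then show "norm (ker t (mob b u z)) \<le> norm (den b u z) * m"
    using assms by (simp add: ker_mob norm_mult mult_left_mono)
qed

lemma kbound_ge1: "kbound z m \<Longrightarrow> m \<ge> 1"
  unfolding kbound_def by (auto simp: ker_def dest: bspec[of _ _ 0])

lemma integral_u_pow:
  assumes "i \<ge> 1"
  shows "((\<lambda>u::real. c * u ^ (i - 1)) has_integral (c / i)) {0..1}"
proof -
  have "((\<lambda>u::real. c * u ^ (i - 1)) has_integral (c * 1 ^ i / i - c * 0 ^ i / i)) {0..1}"
    by (rule fundamental_theorem_of_calculus)
       (use assms in \<open>auto intro!: derivative_eq_intros simp: has_real_derivative_iff_has_vector_derivative[symmetric] field_simps\<close>)
  then show ?thesis using assms by (simp add: zero_power)
qed

text \<open>The shape \<open>norm z ^ j * m ^ (i + j)\<close> is homogeneous on purpose: along the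
  arc \<open>norm z\<close> is multiplied by \<open>u / q\<close> and \<open>m\<close> by
  \<open>q\<close>, where \<open>q = norm (den b u z)\<close>, and the remaining
  \<open>q ^ i\<close> cancels against the denominator. What is left is
  \<open>u ^ (i + j - 1)\<close>, whose integral gives one factor \<open>1 / (i + j)\<close> per
  letter.\<close>

lemma word_bound:
  assumes f: "f holomorphic_on slit_plane" "i \<ge> 1"
    and bd: "\<And>z m. z \<in> slit_plane \<Longrightarrow> kbound z m \<Longrightarrow> norm (f z) \<le> C * norm z ^ j * m ^ (i + j)"
    and z: "z \<in> slit_plane" "kbound z m"
  shows "norm (word i w f z) \<le> C * norm z ^ j * m ^ (i + j) / real (i + j) ^ length w"
  using z
proof (induction w arbitrary: z m)
  case Nil
  then show ?case using bd by simp
next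
  case (Cons b w)
  define A where "A = C * norm z ^ j * m ^ (i + j) / real (i + j) ^ length w"
  have ij: "i + j \<ge> 1" using f(2) by simp
  have "norm (avg_op b i (word i w f) z) \<le> integral {0..1} (\<lambda>u. A * u ^ (i + j - 1))"
    unfolding avg_op_def
  proof (rule integral_norm_bound_integral)
    show "(\<lambda>u. of_real u ^ (i - 1) * word i w f (mob b u z) / den b u z ^ i) integrable_on {0..1}"
      by (intro integrable_continuous_interval continuous_integrand1 word_cont f Cons.prems)
    show "(\<lambda>u. A * u ^ (i + j - 1)) integrable_on {0..1}"
      using integral_u_pow[OF ij] by blast
    fix u :: real assume u: "u \<in> {0..1}"
    define q where "q = norm (den b u z)"
    have q: "q > 0" using den_nz[of z u b] u Cons.prems by (simp add: q_def)
    have mq: "norm (mob b u z) = u * norm z / q" using u by (simp add: mob_def norm_divide norm_mult q_def)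
    have "norm (word i w f (mob b u z)) \<le> C * norm (mob b u z) ^ j * (q * m) ^ (i + j) / real (i + j) ^ length w"
      unfolding q_def by (intro Cons.IH mob_slit kbound_mob Cons.prems) (use u in auto)
    also have "\<dots> = A * u ^ j * q ^ i"
      unfolding mq A_def using q by (simp add: power_mult_distrib power_divide power_add)
    finally have "norm (word i w f (mob b u z)) / q ^ i \<le> A * u ^ j" using q by (simp add: field_simps)
    from mult_left_mono[OF this, of "u ^ (i - 1)"] u
    have "u ^ (i - 1) * (norm (word i w f (mob b u z)) / q ^ i) \<le> A * (u ^ (i - 1) * u ^ j)"
      by (simp add: mult_ac)
    moreover have "u ^ (i - 1) * u ^ j = u ^ (i + j - 1)" using f(2) by (simp flip: power_add)
    ultimately show "norm (of_real u ^ (i - 1) * word i w f (mob b u z) / den b u z ^ i) \<le> A * u ^ (i + j - 1)"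
      using u by (simp add: norm_mult norm_divide norm_power q_def)
  qed
  also have "\<dots> = C * norm z ^ j * m ^ (i + j) / real (i + j) ^ length (b # w)"
    using integral_unique[OF integral_u_pow[OF ij]] by (simp add: A_def)
  finally show ?case by simp
qed

text \<open>Second order Taylor expansion of the kernel in its parameter, carried through the word.
  The remainder is \<open>z ^ 2\<close> times a word of exponent 3 applied to
  \<open>ker s * ker s' ^ 2\<close>, and its bound does not depend on \<open>w\<close>.\<close>

lemma G_expand:
  assumes s: "0 \<le> s" "s \<le> 1" "0 \<le> s'" "s' \<le> 1" and z: "z \<in> slit_plane" "kbound z m"
  shows "norm (G w s z - G w s' z - of_real (s - s') * z * dG w s' z) \<le> (s - s')\<^sup>2 * norm z ^ 2 * m ^ 3"
proof -
  define R where "R z = ker s z * ker s' z ^ 2" for z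
  have R: "R holomorphic_on slit_plane" unfolding R_def[abs_def] by (intro holomorphic_intros ker_holo s)
  define c where "c = complex_of_real (s - s')"
  have eq: "ker s z = ker s' z + (c * (z * ker s' z ^ 2) + c^2 * (z * (z * R z)))" if "z \<in> slit_plane" for z
  proof -
    have "1 - of_real s * z \<noteq> 0" "1 - of_real s' * z \<noteq> 0" using slit_plane_nz that s by auto
    then show ?thesis unfolding R_def c_def ker_def
      by (simp add: divide_simps) (simp add: algebra_simps power2_eq_square)
  qed
  have "G w s z = word 1 w (\<lambda>z. ker s' z + (c * (z * ker s' z ^ 2) + c^2 * (z * (z * R z)))) z"
    unfolding G_def by (rule word_cong[OF eq z(1)])
  also have "\<dots> = G w s' z + (word 1 w (\<lambda>z. c * (z * ker s' z ^ 2)) z + word 1 w (\<lambda>z. c^2 * (z * (z * R z))) z)"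
  proof -
    note K = ker_holo[OF s(3,4)]
    have h1: "(\<lambda>z. c * (z * ker s' z ^ 2)) holomorphic_on slit_plane"
      and h2: "(\<lambda>z. c^2 * (z * (z * R z))) holomorphic_on slit_plane"
      by (intro holomorphic_intros K R)+
    show ?thesis
      unfolding G_def word_add[OF K holomorphic_on_add[OF h1 h2] order_refl z(1)]
        word_add[OF h1 h2 order_refl z(1)] ..
  qed
  also have "word 1 w (\<lambda>z. c * (z * ker s' z ^ 2)) z = c * (z * dG w s' z)"
    using z by (simp add: word_cmul word_shift dG_def numeral_2_eq_2)
  also have "word 1 w (\<lambda>z. c^2 * (z * (z * R z))) z = c^2 * (z * word 2 w (\<lambda>z. z * R z) z)"
    using z by (simp add: word_cmul word_shift numeral_2_eq_2)
  also have "word 2 w (\<lambda>z. z * R z) z = z * word 3 w R z"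
    using z by (simp add: word_shift)
  finally have "G w s z - G w s' z - of_real (s - s') * z * dG w s' z = c^2 * z^2 * word 3 w R z"
    by (simp add: c_def algebra_simps power2_eq_square)
  moreover have "norm (word 3 w R z) \<le> 1 * norm z ^ 0 * m ^ (3 + 0) / real (3 + 0) ^ length w"
  proof (rule word_bound[OF R _ _ z])
    fix z m assume "z \<in> slit_plane" "kbound z m"
    then have "norm (ker s z) \<le> m" "norm (ker s' z) \<le> m" using s unfolding kbound_def by auto
    then show "norm (R z) \<le> 1 * norm z ^ 0 * m ^ (3 + 0)"
      unfolding power_0 mult_1_right add_0_right R_def norm_mult norm_power power3_eq_cube power2_eq_square mult_1 mult.assoc
      by (intro mult_mono mult_nonneg_nonneg) (auto intro: order_trans[OF norm_ge_zero])
  qed simp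
  moreover have "1 * m ^ 3 / real 3 ^ length w \<le> m ^ 3"
    using kbound_ge1[OF z(2)] by (simp add: divide_le_eq mult_ge1_I)
  moreover have "norm (c^2 * z^2) = (s - s')\<^sup>2 * norm z ^ 2"
    by (simp add: c_def norm_mult norm_power power_abs flip: of_real_power del: of_real_diff)
  ultimately have "norm (G w s z - G w s' z - of_real (s - s') * z * dG w s' z)
      = (s - s')\<^sup>2 * norm z ^ 2 * norm (word 3 w R z)" "norm (word 3 w R z) \<le> m ^ 3"
    by (simp_all add: norm_mult)
  then show ?thesis by (simp add: mult_left_mono)
qed

section \<open>Averages of kernels and univalence\<close>

text \<open>A substitute for "\<open>f\<close> is the integral of \<open>ker t\<close> against a probability measure on
  \<open>[0, 1]\<close> with mean \<open>e\<close>": the linear inequalities in two values that such an \<open>f\<close> would inherit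
  from the kernels.\<close>

definition kernel_average :: "real \<Rightarrow> (complex \<Rightarrow> complex) \<Rightarrow> bool" where
  "kernel_average e f \<longleftrightarrow> (\<forall>z1\<in>slit_plane. \<forall>z2\<in>slit_plane. \<forall>c1 c2 \<beta> \<gamma>.
     (\<forall>t\<in>{0..1}. \<beta> + \<gamma> * t \<le> Re (c1 * ker t z1 + c2 * ker t z2)) \<longrightarrow>
     \<beta> + \<gamma> * e \<le> Re (c1 * f z1 + c2 * f z2))"

lemma kernel_average_ker: "0 \<le> s \<Longrightarrow> s \<le> 1 \<Longrightarrow> kernel_average s (ker s)"
  unfolding kernel_average_def by auto

text \<open>For each \<open>u\<close> the factor \<open>1 / den b u z\<close> is absorbed into
  \<open>c1\<close> and \<open>c2\<close>, and \<open>shift_par b u\<close> turns an affine lower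
  bound in \<open>t\<close> into another one. The new mean is the average of
  \<open>shift_par b u e\<close> over \<open>u\<close>.\<close>

lemma kernel_average_opr:
  assumes f: "continuous_on slit_plane f" and r: "kernel_average e f"
  shows "kernel_average (if b then (1 + e) / 2 else e / 2) (avg_op b 1 f)"
  unfolding kernel_average_def
proof (intro ballI allI impI)
  fix z1 z2 c1 c2 and \<beta> \<gamma> :: real
  assume z: "z1 \<in> slit_plane" "z2 \<in> slit_plane"
    and h: "\<forall>t\<in>{0..1}. \<beta> + \<gamma> * t \<le> Re (c1 * ker t z1 + c2 * ker t z2)"
  let ?I = "\<lambda>z u. of_real u ^ (1 - 1) * f (mob b u z) / den b u z ^ 1"
  have I: "((\<lambda>u. Re (c1 * ?I z1 u + c2 * ?I z2 u)) has_integral Re (c1 * avg_op b 1 f z1 + c2 * avg_op b 1 f z2)) {0..1}"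
    by (intro has_integral_Re has_integral_add has_integral_mult_right avg_op_has_integral f z)
  have J: "((\<lambda>u. \<beta> + \<gamma> * shift_par b u e) has_integral (\<beta> + \<gamma> * (if b then (1 + e) / 2 else e / 2))) {0..1}"
  proof -
    define F where "F u = \<beta> * u + \<gamma> * (if b then u - u\<^sup>2 / 2 + e * u\<^sup>2 / 2 else e * u\<^sup>2 / 2)" for u :: real
    have "((\<lambda>u. \<beta> + \<gamma> * shift_par b u e) has_integral (F 1 - F 0)) {0..1}"
    proof (rule fundamental_theorem_of_calculus)
      fix x :: real
      have "(F has_real_derivative \<beta> + \<gamma> * shift_par b x e) (at x within {0..1})"
        unfolding F_def shift_par_def by (cases b) (auto intro!: derivative_eq_intros simp: algebra_simps)
      then show "(F has_vector_derivative \<beta> + \<gamma> * shift_par b x e) (at x within {0..1})"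
        by (simp add: has_real_derivative_iff_has_vector_derivative)
    qed simp
    moreover have "F 1 - F 0 = \<beta> + \<gamma> * (if b then (1 + e) / 2 else e / 2)"
      by (auto simp: F_def field_simps)
    ultimately show ?thesis by simp
  qed
  show "\<beta> + \<gamma> * (if b then (1 + e) / 2 else e / 2) \<le> Re (c1 * avg_op b 1 f z1 + c2 * avg_op b 1 f z2)"
  proof (rule has_integral_le[OF J I])
    fix u :: real assume u: "u \<in> {0..1}"
    then have u': "0 \<le> u" "u \<le> 1" by auto
    define p q where "p = \<beta> + \<gamma> * (if b then 1 - u else 0)" and "q = \<gamma> * u"
    have lin: "\<beta> + \<gamma> * shift_par b u t = p + q * t" for t
      by (simp add: p_def q_def shift_par_def algebra_simps)
    have "p + q * t \<le> Re ((c1 / den b u z1) * ker t (mob b u z1) + (c2 / den b u z2) * ker t (mob b u z2))"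
      if t: "t \<in> {0..1}" for t
    proof -
      have "shift_par b u t \<in> {0..1}" using shift_par_01[OF u'] t by simp
      then have "\<beta> + \<gamma> * shift_par b u t \<le> Re (c1 * ker (shift_par b u t) z1 + c2 * ker (shift_par b u t) z2)" using h by blast
      then show ?thesis unfolding lin using den_nz[OF z(1) u', of b] den_nz[OF z(2) u', of b]
        by (simp add: ker_mob z u')
    qed
    then have "p + q * e \<le> Re ((c1 / den b u z1) * f (mob b u z1) + (c2 / den b u z2) * f (mob b u z2))"
      by (intro r[unfolded kernel_average_def, rule_format] mob_slit z u')
    then show "\<beta> + \<gamma> * shift_par b u e \<le> Re (c1 * ?I z1 u + c2 * ?I z2 u)"
      unfolding lin by simp
  qed
qed

fun mean :: "bool list \<Rightarrow> real \<Rightarrow> real" where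
  "mean [] s = s"
| "mean (b # w) s = (if b then (1 + mean w s) / 2 else mean w s / 2)"

lemma kernel_average_G: "0 \<le> s \<Longrightarrow> s \<le> 1 \<Longrightarrow> kernel_average (mean w s) (G w s)"
proof (induction w)
  case (Cons b w)
  then show ?case unfolding G_Cons mean.simps
    by (intro kernel_average_opr holomorphic_on_imp_continuous_on G_holo) auto
qed (simp add: G_Nil kernel_average_ker)

lemma mean_01: "0 \<le> s \<Longrightarrow> s \<le> 1 \<Longrightarrow> 0 \<le> mean w s \<and> mean w s \<le> 1"
  by (induction w) auto

text \<open>The letter B lifts any mean to at least \<open>1 / 2\<close>, and each letter in front
  of it at worst halves it. The bound ignores \<open>w\<close>, so it is common to all truncations
  of an infinite index.\<close>

lemma mean_pos: "0 \<le> s \<Longrightarrow> s \<le> 1 \<Longrightarrow> mean (v @ True # w) s \<ge> (1 / 2) ^ Suc (length v)"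
proof (induction v)
  case Nil
  then show ?case using mean_01[of s w] by simp
next
  case (Cons b v)
  then show ?case using mean_01[of s "v @ True # w"] by auto
qed

lemma mean_pos_s: "0 < s \<Longrightarrow> s \<le> 1 \<Longrightarrow> mean w s > 0"
  by (induction w) auto

text \<open>The same for positive measures of mass \<open>k\<close>, squared kernels, and a single value.\<close>

definition sq_kernel_average :: "real \<Rightarrow> (complex \<Rightarrow> complex) \<Rightarrow> bool" where
  "sq_kernel_average k f \<longleftrightarrow> (\<forall>z\<in>slit_plane. \<forall>c. \<forall>\<gamma>\<ge>0.
     (\<forall>t\<in>{0..1}. \<gamma> \<le> Re (c * ker t z ^ 2)) \<longrightarrow> k * \<gamma> \<le> Re (c * f z))"

text \<open>The mass is halved because the weight \<open>u\<close> belonging to exponent 2 has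
  integral \<open>1 / 2\<close> over \<open>[0, 1]\<close>.\<close>

lemma sq_kernel_average_opr:
  assumes f: "continuous_on slit_plane f" and r: "sq_kernel_average k f"
  shows "sq_kernel_average (k / 2) (avg_op b 2 f)"
  unfolding sq_kernel_average_def
proof (intro ballI allI impI)
  fix z c and \<gamma> :: real
  assume z: "z \<in> slit_plane" and "\<gamma> \<ge> 0"
    and h: "\<forall>t\<in>{0..1}. \<gamma> \<le> Re (c * ker t z ^ 2)"
  let ?I = "\<lambda>u. of_real u ^ (2 - 1) * f (mob b u z) / den b u z ^ 2"
  have I: "((\<lambda>u. Re (c * ?I u)) has_integral Re (c * avg_op b 2 f z)) {0..1}"
    by (intro has_integral_Re has_integral_add has_integral_mult_right avg_op_has_integral f z)
  have J: "((\<lambda>u::real. (k * \<gamma>) * u ^ (2 - 1)) has_integral (k * \<gamma>) / real 2) {0..1}"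
    by (rule integral_u_pow) simp
  have "(k * \<gamma>) / real 2 \<le> Re (c * avg_op b 2 f z)"
  proof (rule has_integral_le[OF J I])
    fix u :: real assume u: "u \<in> {0..1}"
    then have u': "0 \<le> u" "u \<le> 1" by auto
    have nz: "den b u z \<noteq> 0" by (rule den_nz[OF z u'])
    have "\<gamma> \<le> Re ((c / den b u z ^ 2) * ker t (mob b u z) ^ 2)"
      if t: "t \<in> {0..1}" for t
    proof -
      have "shift_par b u t \<in> {0..1}" using shift_par_01[OF u'] t by simp
      then have "\<gamma> \<le> Re (c * ker (shift_par b u t) z ^ 2)" using h by blast
      then show ?thesis using nz by (simp add: ker_mob z u' power_mult_distrib)
    qed
    then have "k * \<gamma> \<le> Re ((c / den b u z ^ 2) * f (mob b u z))"
      by (intro r[unfolded sq_kernel_average_def, rule_format] mob_slit[OF z u'] \<open>\<gamma> \<ge> 0\<close>)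
    from mult_left_mono[OF this u'(1)]
    show "(k * \<gamma>) * u ^ (2 - 1) \<le> Re (c * ?I u)"
    proof -
      have "Re (c * ?I u) = Re (of_real u * (c / den b u z ^ 2 * f (mob b u z)))"
        by (simp only: power_one_right diff_Suc_1 numeral_2_eq_2 times_divide_eq_left times_divide_eq_right power_Suc0_right ac_simps)
      also have "\<dots> = u * Re (c / den b u z ^ 2 * f (mob b u z))"
        by (simp only: times_complex.sel Re_complex_of_real Im_complex_of_real mult_zero_left diff_zero)
      finally show ?thesis
        using \<open>u * (k * \<gamma>) \<le> u * Re (c / (den b u z)\<^sup>2 * f (mob b u z))\<close>
        by (simp only: mult.commute[of u] power_Suc0_right diff_Suc_1 numeral_2_eq_2)
    qed
  qed
  then show "k / 2 * \<gamma> \<le> Re (c * avg_op b 2 f z)" by simp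
qed

lemma sq_kernel_average_dG: "0 \<le> s \<Longrightarrow> s \<le> 1 \<Longrightarrow> sq_kernel_average ((1 / 2) ^ length w) (dG w s)"
proof (induction w)
  case Nil
  then show ?case by (auto simp: sq_kernel_average_def dG_Nil)
next
  case (Cons b w)
  then have "sq_kernel_average ((1 / 2) ^ length w / 2) (avg_op b 2 (dG w s))"
    by (intro sq_kernel_average_opr holomorphic_on_imp_continuous_on dG_holo) auto
  then show ?case by (simp add: dG_Cons)
qed

section \<open>Sectors containing products of kernels, and explicit univalence\<close>

lemma csqrt_sector: "Re v > 0 \<Longrightarrow> \<bar>Im (csqrt v)\<bar> < Re (csqrt v)"
proof -
  assume v: "Re v > 0"
  have "Re ((csqrt v)\<^sup>2) > 0" using v by simp
  then have "(Im (csqrt v))\<^sup>2 < (Re (csqrt v))\<^sup>2" by (simp add: power2_eq_square)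
  then have "\<bar>Im (csqrt v)\<bar> < \<bar>Re (csqrt v)\<bar>" using abs_le_square_iff not_le by metis
  moreover have "Re (csqrt v) \<ge> 0" by (rule Re_csqrt)
  ultimately show ?thesis by simp
qed

text \<open>The values of \<open>ker t z * ker t w\<close> for \<open>0 \<le> t \<le> 1\<close> all lie in a sector of opening less
  than \<open>\<pi>\<close>, and multiplication by \<open>c\<close> rotates its bisector onto the positive real axis.\<close>

lemma ker_sector:
  assumes w: "Re w < 1"
  obtains \<kappa> where "\<kappa> > 0" "\<And>z. Re z < 1 \<Longrightarrow> norm z \<le> 2 \<Longrightarrow>
     \<exists>c. norm c = 1 \<and> (\<forall>t\<in>{0..1}. \<kappa> \<le> Re (c * (ker t z * ker t w)))"
proof -
  define q where "q = csqrt (1 - w)"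
  have q: "\<bar>Im q\<bar> < Re q" unfolding q_def by (rule csqrt_sector) (use w in simp)
  have q2: "q\<^sup>2 = 1 - w" unfolding q_def by simp
  have nq: "norm q > 0" using q by auto
  \<comment> \<open>Made uniform in \<open>z\<close>: for the root \<open>p\<close> of
    \<open>1 - z\<close> the sector gives \<open>norm p \<le> 2 * Re p\<close>, so only the room
    between \<open>q\<close> and the boundary of its sector enters the constant.\<close>
  define k where "k = (Re q - \<bar>Im q\<bar>) / (2 * norm q)"
  have k: "k > 0" unfolding k_def using q nq by simp
  define \<kappa> where "\<kappa> = k / (3 * (1 + norm w))"
  have "\<kappa> > 0" using k unfolding \<kappa>_def by (simp add: add_pos_nonneg)
  moreover have "\<exists>c. norm c = 1 \<and> (\<forall>t\<in>{0..1}. \<kappa> \<le> Re (c * (ker t z * ker t w)))"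
    if z: "Re z < 1" "norm z \<le> 2" for z
  proof -
    define p where "p = csqrt (1 - z)"
    have p: "\<bar>Im p\<bar> < Re p" unfolding p_def by (rule csqrt_sector) (use z in simp)
    have p2: "p\<^sup>2 = 1 - z" unfolding p_def by simp
    have np: "norm p > 0" using p by auto
    have "norm p \<le> 2 * Re p" using cmod_le[of p] p by simp
    have key: "k * norm (p * q) \<le> Re p * Re q - \<bar>Im p\<bar> * \<bar>Im q\<bar>"
    proof -
      have "k * norm (p * q) = (Re q - \<bar>Im q\<bar>) * (norm p / 2)"
        unfolding k_def norm_mult using nq by simp
      also have "\<dots> \<le> (Re q - \<bar>Im q\<bar>) * Re p"
        using \<open>norm p \<le> 2 * Re p\<close> q by (intro mult_left_mono) auto
      also have "\<dots> \<le> Re p * Re q - \<bar>Im p\<bar> * \<bar>Im q\<bar>"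
        using mult_right_mono[of "\<bar>Im p\<bar>" "Re p" "\<bar>Im q\<bar>"] p by (simp add: algebra_simps)
      finally show ?thesis .
    qed
    have absm: "\<bar>Im p * Im q\<bar> = \<bar>Im p\<bar> * \<bar>Im q\<bar>" by (rule abs_mult)
    have k1: "k * norm (p * q) \<le> Re (p * q)" and k2: "k * norm (p * q) \<le> Re (p * cnj q)"
      using key absm by auto
    \<comment> \<open>For \<open>y = (1 - t * z) * (1 - t * w)\<close> the quotient
      \<open>y / (p * q)\<close> is a nonnegative combination of \<open>1 / (p * q)\<close>,
      \<open>p / q + q / p\<close> and \<open>p * q\<close>. All three have positive real part,
      since the arguments of \<open>p\<close> and \<open>q\<close> are below \<open>pi / 4\<close>
      in absolute value.\<close>
    define c where "c = p * q / of_real (norm (p * q))"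
    have npq: "norm (p * q) > 0" using np nq by (simp add: norm_mult)
    have "norm c = 1" unfolding c_def norm_divide using npq by (simp del: norm_mult)
    moreover have "\<kappa> \<le> Re (c * (ker t z * ker t w))" if t: "t \<in> {0..1}" for t
    proof -
      define y where "y = (1 - of_real t * z) * (1 - of_real t * w)"
      have ynz: "y \<noteq> 0" unfolding y_def using slit_plane_nz[OF Re_less_slit] z w t by auto
      have yeq: "y = of_real ((1 - t)\<^sup>2) + of_real (t * (1 - t)) * (p\<^sup>2 + q\<^sup>2) + of_real (t\<^sup>2) * (p * q)\<^sup>2"
        unfolding y_def power_mult_distrib p2 q2 by (simp add: algebra_simps power2_eq_square)
      have A: "Re (cnj (p * q) * (p * q)\<^sup>2) = norm (p * q) ^ 2 * Re (p * q)"
      proof -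
        have "cnj x * x\<^sup>2 = of_real (norm x ^ 2) * x" for x
          unfolding complex_norm_square by (simp add: power2_eq_square)
        then have "cnj (p * q) * (p * q)\<^sup>2 = of_real (norm (p * q) ^ 2) * (p * q)" .
        then show ?thesis by (simp only: times_complex.sel Re_complex_of_real Im_complex_of_real mult_zero_left diff_zero)
      qed
      have B: "Re (cnj (p * q) * (p\<^sup>2 + q\<^sup>2)) = (norm p ^ 2 + norm q ^ 2) * Re (p * cnj q)"
      proof -
        have "cnj (p * q) * (p\<^sup>2 + q\<^sup>2) = of_real (norm p ^ 2) * (p * cnj q) + of_real (norm q ^ 2) * cnj (p * cnj q)"
          unfolding complex_norm_square by (simp add: power2_eq_square algebra_simps)
        then show ?thesis
          by (simp only: plus_complex.sel times_complex.sel Re_complex_of_real Im_complex_of_real complex_cnj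
              mult_zero_left diff_zero distrib_right complex_cnj_mult) simp
      qed
      have "Re (cnj (p * q) * y) = (1 - t)\<^sup>2 * Re (p * q) + t * (1 - t) * ((norm p ^ 2 + norm q ^ 2) * Re (p * cnj q))
          + t\<^sup>2 * (norm (p * q) ^ 2 * Re (p * q))"
      proof -
        have "cnj (p * q) * y = of_real ((1 - t)\<^sup>2) * cnj (p * q) + of_real (t * (1 - t)) * (cnj (p * q) * (p\<^sup>2 + q\<^sup>2))
            + of_real (t\<^sup>2) * (cnj (p * q) * (p * q)\<^sup>2)"
          unfolding yeq by (simp only: distrib_left ac_simps)
        then show ?thesis
          by (simp only: plus_complex.sel(1) times_complex.sel(1)[of "of_real _"] Re_complex_of_real Im_complex_of_real
              mult_zero_left diff_zero A B cnj.simps(1))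
      qed
      also have "\<dots> \<ge> (1 - t)\<^sup>2 * (k * norm (p * q)) + t * (1 - t) * ((norm p ^ 2 + norm q ^ 2) * (k * norm (p * q)))
          + t\<^sup>2 * (norm (p * q) ^ 2 * (k * norm (p * q)))"
        using t k1 k2 by (intro add_mono mult_left_mono) auto
      finally have "k * norm (p * q) * ((1 - t)\<^sup>2 + t * (1 - t) * (norm p ^ 2 + norm q ^ 2) + t\<^sup>2 * norm (p * q) ^ 2)
          \<le> Re (cnj (p * q) * y)" (is "?L \<le> _") by (simp add: algebra_simps)
      moreover have ny: "norm y \<le> (1 - t)\<^sup>2 + t * (1 - t) * (norm p ^ 2 + norm q ^ 2) + t\<^sup>2 * norm (p * q) ^ 2"
      proof -
        have "norm y \<le> norm (complex_of_real ((1 - t)\<^sup>2)) + norm (of_real (t * (1 - t)) * (p\<^sup>2 + q\<^sup>2)) + norm (of_real (t\<^sup>2) * (p * q)\<^sup>2)"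
          unfolding yeq by (intro norm_triangle_le add_mono order_refl norm_triangle_ineq)
        also have "\<dots> = (1 - t)\<^sup>2 + t * (1 - t) * norm (p\<^sup>2 + q\<^sup>2) + t\<^sup>2 * norm (p * q) ^ 2"
          using t unfolding norm_mult norm_of_real norm_power by (simp add: abs_mult)
        also have "norm (p\<^sup>2 + q\<^sup>2) \<le> norm p ^ 2 + norm q ^ 2"
          using norm_triangle_ineq[of "p\<^sup>2" "q\<^sup>2"] by (simp add: norm_power)
        finally show ?thesis using t by (simp add: mult_left_mono)
      qed
      moreover have "k * norm (p * q) * norm y \<le> ?L"
        by (intro mult_left_mono[OF ny]) (use k in simp)
      ultimately have "k * norm (p * q) * norm y \<le> Re (cnj (p * q) * y)" by linarith
      then have c1: "k * norm y \<le> Re (cnj c * y)"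
        unfolding c_def using npq by (simp add: field_simps Re_divide_of_real del: norm_mult complex_cnj_mult)
      have yb: "norm y \<le> 3 * (1 + norm w)"
      proof -
        have "norm (1 - of_real t * z) \<le> 1 + t * norm z" "norm (1 - of_real t * w) \<le> 1 + t * norm w"
          using t norm_triangle_ineq4[of 1 "of_real t * z"] norm_triangle_ineq4[of 1 "of_real t * w"]
          by (simp_all add: norm_mult)
        moreover have "t * norm z \<le> 2" "t * norm w \<le> norm w"
          using t z mult_mono[of t 1 "norm z" 2] mult_right_mono[of t 1 "norm w"] by auto
        ultimately show ?thesis unfolding y_def norm_mult by (intro mult_mono) auto
      qed
      have "ker t z * ker t w = cnj y / of_real (norm y ^ 2)"
        unfolding ker_def complex_norm_square using ynz
        by (simp add: y_def[symmetric] divide_simps)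
      then have "Re (c * (ker t z * ker t w)) = Re (cnj c * y) / norm y ^ 2"
        by (simp add: Re_divide_of_real mult.commute)
      also have "\<dots> \<ge> k * norm y / norm y ^ 2" using c1 by (simp add: divide_right_mono)
      finally have "k / norm y \<le> Re (c * (ker t z * ker t w))" using ynz by (simp add: power2_eq_square)
      moreover have "\<kappa> \<le> k / norm y" unfolding \<kappa>_def using yb ynz k
        by (intro divide_left_mono mult_pos_pos) (auto intro: add_pos_nonneg)
      ultimately show ?thesis by simp
    qed
    ultimately show ?thesis by blast
  qed
  ultimately show ?thesis by (rule that)
qed

text \<open>By \<open>ker t z - ker t w = t * (z - w) * (ker t z * ker t w)\<close>, division by
  \<open>z - w\<close> and a rotation leave a real part of at least \<open>\<kappa> * t\<close>, and
  averaging replaces \<open>t\<close> by the mean \<open>e\<close>. This is the purpose of the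
  linear term in \<open>kernel_average\<close>. The constant depends on \<open>w\<close>
  alone.\<close>

lemma univalent_bound:
  assumes w: "Re w < 1"
  obtains \<kappa> where "\<kappa> > 0" "\<And>z f e. kernel_average e f \<Longrightarrow> Re z < 1 \<Longrightarrow> norm z \<le> 2 \<Longrightarrow>
     \<kappa> * e * norm (z - w) \<le> norm (f z - f w)"
proof -
  obtain \<kappa> where \<kappa>: "\<kappa> > 0" "\<And>z. Re z < 1 \<Longrightarrow> norm z \<le> 2 \<Longrightarrow>
     \<exists>c. norm c = 1 \<and> (\<forall>t\<in>{0..1}. \<kappa> \<le> Re (c * (ker t z * ker t w)))"
    by (rule ker_sector[OF w]) blast
  have "\<kappa> * e * norm (z - w) \<le> norm (f z - f w)"
    if r: "kernel_average e f" and z: "Re z < 1" "norm z \<le> 2" for z f e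
  proof (cases "z = w")
    case False
    obtain c where c: "norm c = 1" "\<And>t. t \<in> {0..1} \<Longrightarrow> \<kappa> \<le> Re (c * (ker t z * ker t w))"
      using \<kappa>(2)[OF z] by blast
    define c' where "c' = c / (z - w)"
    have "0 + \<kappa> * t \<le> Re (c' * ker t z + (- c') * ker t w)" if t: "t \<in> {0..1}" for t
    proof -
      have nz: "1 - of_real t * z \<noteq> 0" "1 - of_real t * w \<noteq> 0"
        using slit_plane_nz[OF Re_less_slit] z w t by auto
      then have "ker t z - ker t w = of_real t * (z - w) * (ker t z * ker t w)"
        unfolding ker_def by (simp add: divide_simps) (simp add: algebra_simps)
      then have "c' * ker t z + (- c') * ker t w = c' * (of_real t * (z - w) * (ker t z * ker t w))"
        by (metis (no_types, lifting) add_uminus_conv_diff minus_mult_left right_diff_distrib)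
      also have "\<dots> = of_real t * (c * (ker t z * ker t w))"
        unfolding c'_def using False by simp
      finally have "Re (c' * ker t z + (- c') * ker t w) = t * Re (c * (ker t z * ker t w))"
        by (simp only: times_complex.sel Re_complex_of_real Im_complex_of_real mult_zero_left diff_zero)
      then show ?thesis using mult_left_mono[OF c(2)[OF t], of t] t by (simp add: mult.commute[of \<kappa>])
    qed
    then have "0 + \<kappa> * e \<le> Re (c' * f z + (- c') * f w)"
      by (intro r[unfolded kernel_average_def, rule_format] Re_less_slit z w)
    also have "\<dots> \<le> norm (c' * (f z - f w))"
      using complex_Re_le_cmod[of "c' * (f z - f w)"] by (simp add: algebra_simps)
    also have "\<dots> = norm (f z - f w) / norm (z - w)"
      by (simp add: norm_mult c'_def norm_divide c)
    finally show ?thesis using False by (simp add: field_simps)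
  qed simp
  then show ?thesis by (rule that[OF \<kappa>(1)])
qed

section \<open>Differential relations on the unit disc\<close>

text \<open>The first order part of Jack's lemma. For \<open>t \<ge> 0\<close> and
  \<open>Re \<eta> \<le> 0\<close> the curve \<open>z0 * exp (t * \<eta>)\<close> stays in the disc
  \<open>norm z \<le> norm z0\<close>, so \<open>Re h\<close> has nonnegative derivative along it;
  \<open>\<eta> = \<i>\<close>, \<open>- \<i>\<close> and \<open>- 1\<close> force
  \<open>z0 * h'\<close> to be real and nonpositive.\<close>

lemma radial_minimum:
  assumes h: "(h has_field_derivative h') (at z0)"
    and e: "\<epsilon> > 0" "\<And>z. z \<in> ball z0 \<epsilon> \<Longrightarrow> norm z \<le> norm z0 \<Longrightarrow> Re (h z0) \<le> Re (h z)"
  obtains m where "m \<ge> 0" "z0 * h' = - complex_of_real m"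
proof -
  have dir: "Re (\<eta> * (z0 * h')) \<ge> 0" if \<eta>: "Re \<eta> \<le> 0" for \<eta>
  proof (rule ccontr)
    assume neg: "\<not> 0 \<le> Re (\<eta> * (z0 * h'))"
    define p where "p t = z0 * exp (of_real t * \<eta>)" for t :: real
    have p: "(p has_vector_derivative z0 * \<eta>) (at 0)"
    proof -
      have "((\<lambda>t. z0 * exp (t * \<eta>)) has_field_derivative z0 * \<eta>) (at (of_real 0))"
        by (auto intro!: derivative_eq_intros)
      from has_vector_derivative_real_field[OF this, of UNIV] show ?thesis by (simp add: p_def[abs_def])
    qed
    have "((h \<circ> p) has_vector_derivative z0 * \<eta> * h') (at 0)"
      by (rule field_vector_diff_chain_at[OF p]) (simp add: p_def h)
    then have "((\<lambda>t. Re (h (p t))) has_real_derivative Re (z0 * \<eta> * h')) (at 0)"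
      unfolding comp_def has_real_derivative_iff_has_vector_derivative
      by (rule bounded_linear.has_vector_derivative[OF bounded_linear_Re])
    moreover have "Re (z0 * \<eta> * h') < 0" using neg by (simp add: mult_ac)
    ultimately obtain \<delta> where \<delta>: "\<delta> > 0" "\<And>t. 0 < t \<Longrightarrow> t < \<delta> \<Longrightarrow> Re (h (p (0 + t))) < Re (h (p 0))"
      using DERIV_neg_dec_right by blast
    have "isCont p 0" using p has_vector_derivative_continuous by blast
    then obtain \<delta>' where \<delta>': "\<delta>' > 0" "\<And>t. dist t 0 < \<delta>' \<Longrightarrow> dist (p t) (p 0) < \<epsilon>"
      using e(1) unfolding continuous_at_eps_delta by blast
    define t where "t = min \<delta> \<delta>' / 2"
    have t: "0 < t" "t < \<delta>" "t < \<delta>'" using \<delta>(1) \<delta>'(1) by (auto simp: t_def)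
    have p0: "p 0 = z0" by (simp add: p_def)
    have "p t \<in> ball z0 \<epsilon>" using \<delta>'(2)[of t] t p0 by (simp add: dist_commute)
    moreover have "norm (p t) \<le> norm z0"
      unfolding p_def norm_mult norm_exp_eq_Re using t \<eta> by (simp add: mult_left_le mult_nonneg_nonpos)
    ultimately have "Re (h z0) \<le> Re (h (p t))" by (rule e(2))
    then show False using \<delta>(2)[OF t(1,2)] p0 by simp
  qed
  have "Re (\<i> * (z0 * h')) \<ge> 0" "Re (- \<i> * (z0 * h')) \<ge> 0" "Re (- 1 * (z0 * h')) \<ge> 0"
    by (rule dir; simp)+
  then have "Im (z0 * h') = 0" "Re (z0 * h') \<le> 0" by auto
  then have "z0 * h' = - complex_of_real (- Re (z0 * h'))" by (simp add: complex_eq_iff)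
  then show ?thesis using that \<open>Re (z0 * h') \<le> 0\<close> by (metis neg_0_le_iff_le)
qed

text \<open>One more than the usual starlikeness quotient of \<open>z * d\<close>, so a real part
  above 1 means that \<open>z * d\<close> is starlike. The shift makes the numerator the expression
  that the differential equation of exponent 2 determines.\<close>

definition star_quot :: "(complex \<Rightarrow> complex) \<Rightarrow> complex \<Rightarrow> complex" where
  "star_quot d z = (2 * d z + z * deriv d z) / d z"

text \<open>This is \<open>- z * wt' / wt\<close>, the term by which the letter B departs from A in
  the relations between logarithmic derivatives.\<close>

definition extra :: "bool \<Rightarrow> complex \<Rightarrow> complex" where
  "extra b z = (if b then z / (1 - z) else 0)"

lemma Re_inverse_ball: "norm z < 1 \<Longrightarrow> Re (1 / (1 - z)) > 1 / 2"
proof -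
  assume z: "norm z < 1"
  then have nz: "1 - z \<noteq> 0" by auto
  have "(1 - Re z)\<^sup>2 + (Im z)\<^sup>2 < 2 * (1 - Re z)"
    using z by (simp add: cmod_def real_sqrt_lt_1_iff power2_eq_square algebra_simps)
  moreover have "(1 - Re z)\<^sup>2 + (Im z)\<^sup>2 > 0"
    using nz by (simp add: sum_power2_gt_zero_iff complex_eq_iff)
  ultimately show ?thesis by (simp add: Re_divide power2_eq_square field_simps)
qed

lemma Re_inverse_outside:
  assumes "norm x \<ge> 1" "x \<noteq> 1"
  shows "Re (x / (1 - x)) \<le> - 1 / 2"
proof -
  have "(1 - Re x)\<^sup>2 + (Im x)\<^sup>2 > 0"
    using assms by (simp add: sum_power2_gt_zero_iff complex_eq_iff)
  moreover have "(Re x)\<^sup>2 + (Im x)\<^sup>2 \<ge> 1"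
    using assms(1) by (simp add: cmod_def)
  ultimately show ?thesis by (simp add: Re_divide power2_eq_square field_simps)
qed

lemma Re_extra: "norm z < 1 \<Longrightarrow> Re (extra b z) > - 1 / 2"
proof -
  assume z: "norm z < 1"
  then have "z \<noteq> 1" by auto
  then have "z / (1 - z) = 1 / (1 - z) - 1" by (simp add: field_simps)
  then show ?thesis using Re_inverse_ball[OF z] by (auto simp: extra_def)
qed

lemma Im_extra: "norm z < 1 \<Longrightarrow> Im z > 0 \<Longrightarrow> Im (extra b z) \<ge> 0"
proof -
  assume z: "norm z < 1" "Im z > 0"
  then have "z \<noteq> 1" by auto
  then have "z / (1 - z) = 1 / (1 - z) - 1" by (simp add: field_simps)
  then show ?thesis using z by (auto simp: extra_def Im_divide)
qed

lemma ball_wt_nz: "z \<in> ball 0 1 \<Longrightarrow> wt b z \<noteq> 0"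
  by (auto simp: wt_def)

text \<open>The numerator of \<open>star_quot d\<close> equals \<open>dg / wt b\<close>, so its
  logarithmic derivative splits into that of \<open>dg\<close> and that of the weight. The point 0
  is set aside because the derivative is written with a division by \<open>z\<close>.\<close>

lemma logderiv_relation:
  assumes d: "d holomorphic_on ball 0 1" and dg: "dg holomorphic_on ball 0 1"
    and nz: "\<And>z. z \<in> ball 0 1 \<Longrightarrow> dg z \<noteq> 0"
    and ode: "\<And>z. z \<in> ball 0 1 \<Longrightarrow> wt b z * (2 * d z + z * deriv d z) = dg z"
    and z: "z \<in> ball 0 1"
  shows "((\<lambda>z. 2 * d z + z * deriv d z) has_field_derivative
      (2 * d z + z * deriv d z) * ((star_quot dg z - 2 + extra b z) / z)) (at z) \<or> z = 0"
    and "(\<lambda>z. 2 * d z + z * deriv d z) holomorphic_on ball 0 1"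
proof -
  show E: "(\<lambda>z. 2 * d z + z * deriv d z) holomorphic_on ball 0 1"
    by (intro holomorphic_intros holomorphic_deriv d) auto
  define E where "E = (\<lambda>z. 2 * d z + z * deriv d z)"
  have E': "(E has_field_derivative deriv E z) (at z)"
    using holomorphic_derivI[OF E _ z] by (simp add: E_def)
  have w: "(wt b has_field_derivative (if b then - 1 else 0)) (at z)"
    unfolding wt_def by (cases b) (auto intro!: derivative_eq_intros)
  have "((\<lambda>z. wt b z * E z) has_field_derivative (if b then - 1 else 0) * E z + deriv E z * wt b z) (at z)"
    by (rule DERIV_mult[OF w E'])
  moreover have "((\<lambda>z. wt b z * E z) has_field_derivative deriv dg z) (at z)"
    by (rule DERIV_cong_ev[THEN iffD2, OF refl _ refl holomorphic_derivI[OF dg _ z]])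
      (use ode z in \<open>auto simp: eventually_nhds E_def intro!: exI[of _ "ball 0 1"]\<close>)
  ultimately have eq: "deriv dg z = (if b then - 1 else 0) * E z + deriv E z * wt b z"
    using DERIV_unique by blast
  have dgz: "dg z = wt b z * E z" using ode[OF z] by (simp add: E_def)
  have wnz: "wt b z \<noteq> 0" by (rule ball_wt_nz[OF z])
  have Enz: "E z \<noteq> 0" using nz[OF z] dgz by auto
  have "E z * (star_quot dg z - 2 + extra b z) = z * deriv E z"
  proof -
    have "star_quot dg z - 2 = z * deriv dg z / dg z" unfolding star_quot_def using nz[OF z] by (simp add: field_simps)
    also have "\<dots> = z * (if b then - 1 else 0) / wt b z + z * deriv E z / E z"
      unfolding eq dgz using wnz Enz by (simp add: field_simps)
    finally have "star_quot dg z - 2 + extra b z = z * deriv E z / E z"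
      using wnz by (auto simp: extra_def wt_def)
    then show ?thesis using Enz by simp
  qed
  then have "z \<noteq> 0 \<Longrightarrow> E z * ((star_quot dg z - 2 + extra b z) / z) = deriv E z" by simp
  then show "((\<lambda>z. 2 * d z + z * deriv d z) has_field_derivative
      (2 * d z + z * deriv d z) * ((star_quot dg z - 2 + extra b z) / z)) (at z) \<or> z = 0"
    using E' unfolding E_def by metis
qed

text \<open>Since \<open>star_quot d = 2 / (1 - \<omega>)\<close> with \<open>\<omega> 0 = 0\<close>, at a first point where \<open>norm \<omega> = 1\<close> Jack's
  lemma gives \<open>z \<omega>' = (1 + m) \<omega>\<close> with \<open>m \<ge> 0\<close>. This lowers the real part by \<open>1/2\<close>, which exactly
  absorbs the loss \<open>Re (z / (1 - z)) > -1/2\<close> caused by the letter \<open>B\<close>.\<close>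

lemma starlike_step:
  assumes d: "d holomorphic_on ball 0 1" and dg: "dg holomorphic_on ball 0 1"
    and nz: "\<And>z. z \<in> ball 0 1 \<Longrightarrow> dg z \<noteq> 0"
    and ode: "\<And>z. z \<in> ball 0 1 \<Longrightarrow> wt b z * (2 * d z + z * deriv d z) = dg z"
    and star_quot: "\<And>z. z \<in> ball 0 1 \<Longrightarrow> Re (star_quot dg z) > 1"
    and z: "z \<in> ball 0 1" "d z \<noteq> 0"
  shows "Re (star_quot d z) > 1"
proof -
  define E where "E = (\<lambda>z. 2 * d z + z * deriv d z)"
  have Enz: "E z \<noteq> 0" if "z \<in> ball 0 1" for z
    using ode[OF that] nz[OF that] by (auto simp: E_def)
  have E: "E holomorphic_on ball 0 1"
    unfolding E_def by (rule logderiv_relation(2)[OF d dg nz ode z(1)])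
  \<comment> \<open>With \<open>\<omega> = z * \<phi> z\<close> one has
    \<open>1 - \<omega> = 2 * d z / E z\<close>. Dividing by \<open>E\<close>, which has no zeros,
    keeps \<open>\<omega>\<close> holomorphic before anything is known about the zeros of
    \<open>d\<close>.\<close>
  define \<phi> where "\<phi> = (\<lambda>z. deriv d z / E z)"
  have \<phi>: "\<phi> holomorphic_on ball 0 1"
    unfolding \<phi>_def using Enz by (intro holomorphic_intros holomorphic_deriv d E) auto
  have "norm (z * \<phi> z) < 1"
  proof (rule ccontr)
    assume "\<not> norm (z * \<phi> z) < 1"
    then have big: "norm z * norm (\<phi> z) \<ge> 1" by (simp add: norm_mult)
    define \<rho> where "\<rho> = norm z"
    have \<rho>: "0 < \<rho>" "\<rho> < 1" using big z unfolding \<rho>_def by auto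
    have sub: "cball 0 \<rho> \<subseteq> ball (0 :: complex) 1" using \<rho> by auto
    have cont: "continuous_on (cball 0 \<rho>) \<phi>"
      using holomorphic_on_imp_continuous_on[OF \<phi>] continuous_on_subset sub by blast
    have "sphere (0 :: complex) \<rho> \<noteq> {}" using \<rho> by auto
    then obtain z0 where z0: "z0 \<in> sphere 0 \<rho>" "\<And>y :: complex. y \<in> sphere 0 \<rho> \<Longrightarrow> norm (\<phi> y) \<le> norm (\<phi> z0)"
      using continuous_attains_sup[of "sphere 0 \<rho>" "\<lambda>y. norm (\<phi> y)"] cont
      by (force intro!: continuous_intros elim: continuous_on_subset)
    have max: "norm (\<phi> y) \<le> norm (\<phi> z0)" if "y \<in> cball 0 \<rho>" for y :: complex
    proof (rule maximum_modulus_frontier[of \<phi> "cball 0 \<rho>"])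
      show "\<phi> holomorphic_on interior (cball 0 \<rho>)"
        using \<phi> sub by (auto elim!: holomorphic_on_subset)
      show "continuous_on (closure (cball 0 \<rho>)) \<phi>" using cont by simp
      show "\<And>z. z \<in> frontier (cball 0 \<rho>) \<Longrightarrow> norm (\<phi> z) \<le> norm (\<phi> z0)" using z0 \<rho> by simp
    qed (use that in auto)
    have nz0: "norm z0 = \<rho>" using z0 by simp
    then have z0b: "z0 \<in> ball 0 1" and z0nz: "z0 \<noteq> 0" using \<rho> by auto
    have big0: "norm (z0 * \<phi> z0) \<ge> 1"
    proof -
      have "\<rho> * norm (\<phi> z) \<le> \<rho> * norm (\<phi> z0)" using max[of z] \<rho> by (simp add: \<rho>_def)
      then show ?thesis using big nz0 by (simp add: norm_mult \<rho>_def)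
    qed
    have \<phi>': "(\<phi> has_field_derivative deriv \<phi> z0) (at z0)"
      by (rule holomorphic_derivI[OF \<phi> _ z0b]) simp
    \<comment> \<open>The factor \<open>- cnj (\<phi> z0)\<close> turns maximal modulus of
      \<open>\<phi>\<close> at \<open>z0\<close> into minimal real part.\<close>
    have "((\<lambda>y. - cnj (\<phi> z0) * \<phi> y) has_field_derivative - cnj (\<phi> z0) * deriv \<phi> z0) (at z0)"
      by (rule DERIV_cmult[OF \<phi>'])
    then obtain m where m: "m \<ge> 0" "z0 * (- cnj (\<phi> z0) * deriv \<phi> z0) = - complex_of_real m"
    proof (rule radial_minimum[OF _ zero_less_one])
      fix y :: complex assume "norm y \<le> norm z0"
      then have "norm (\<phi> y) \<le> norm (\<phi> z0)" using max nz0 by simp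
      then have "norm (cnj (\<phi> z0) * \<phi> y) \<le> norm (\<phi> z0) * norm (\<phi> z0)"
        by (simp add: norm_mult mult_left_mono)
      then have "Re (cnj (\<phi> z0) * \<phi> y) \<le> norm (\<phi> z0) * norm (\<phi> z0)"
        using complex_Re_le_cmod order_trans by blast
      moreover have "Re (cnj (\<phi> z0) * \<phi> z0) = norm (\<phi> z0) * norm (\<phi> z0)"
        unfolding mult.commute[of "cnj _"] complex_norm_square[symmetric] by (simp add: power2_eq_square)
      ultimately show "Re (- cnj (\<phi> z0) * \<phi> z0) \<le> Re (- cnj (\<phi> z0) * \<phi> y)" by simp
    qed blast
    have \<phi>nz: "\<phi> z0 \<noteq> 0" using big0 by auto
    define m' where "m' = m / norm (\<phi> z0) ^ 2"
    have m': "m' \<ge> 0" "z0 * deriv \<phi> z0 = of_real m' * \<phi> z0"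
    proof -
      show "m' \<ge> 0" using m by (simp add: m'_def)
      have "cnj (\<phi> z0) * (z0 * deriv \<phi> z0) = of_real m" using m(2) by (simp add: algebra_simps)
      then have "cnj (\<phi> z0) * (z0 * deriv \<phi> z0) = cnj (\<phi> z0) * (of_real m' * \<phi> z0)"
      proof -
        have "cnj (\<phi> z0) * (of_real m' * \<phi> z0) = of_real (m' * norm (\<phi> z0) ^ 2)"
          by (simp only: of_real_mult complex_norm_square ac_simps)
        also have "m' * norm (\<phi> z0) ^ 2 = m" using \<phi>nz by (simp add: m'_def)
        finally show ?thesis using \<open>cnj (\<phi> z0) * (z0 * deriv \<phi> z0) = of_real m\<close> by simp
      qed
      then show "z0 * deriv \<phi> z0 = of_real m' * \<phi> z0" using \<phi>nz by simp
    qed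
    define \<omega> where "\<omega> = z0 * \<phi> z0"
    define e where "e = (star_quot dg z0 - 2 + extra b z0) / z0"
    have E': "(E has_field_derivative E z0 * e) (at z0)"
      using logderiv_relation(1)[OF d dg nz ode z0b] z0nz unfolding E_def e_def by blast
    have d': "(d has_field_derivative deriv d z0) (at z0)"
      by (rule holomorphic_derivI[OF d _ z0b]) simp
    \<comment> \<open>The identity \<open>E * (1 - z * \<phi>) = 2 * d\<close> is differentiated at
      \<open>z0\<close>. In the resulting factor \<open>3 + m'\<close>, the part
      \<open>1 + m'\<close> comes from the derivative of \<open>z * \<phi>\<close> and the part 2
      from \<open>2 * deriv d = 2 * \<phi> * E\<close>.\<close>
    have "((\<lambda>z. E z * (1 - z * \<phi> z)) has_field_derivative
        E z0 * e * (1 - z0 * \<phi> z0) - (\<phi> z0 + z0 * deriv \<phi> z0) * E z0) (at z0)"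
      using E' \<phi>' by (auto intro!: derivative_eq_intros simp: algebra_simps)
    moreover have "((\<lambda>z. E z * (1 - z * \<phi> z)) has_field_derivative 2 * deriv d z0) (at z0)"
    proof (rule DERIV_cong_ev[THEN iffD2, OF refl _ refl DERIV_cmult[OF d']])
      have "E z * (1 - z * \<phi> z) = 2 * d z" if "z \<in> ball 0 1" for z
      proof -
        have "E z * (1 - z * \<phi> z) = E z - z * deriv d z"
          using Enz[OF that] unfolding \<phi>_def by (simp add: right_diff_distrib)
        then show ?thesis by (simp add: E_def)
      qed
      then show "\<forall>\<^sub>F x in nhds z0. E x * (1 - x * \<phi> x) = 2 * d x"
        using z0b eventually_nhds open_ball by blast
    qed
    ultimately have "E z0 * e * (1 - z0 * \<phi> z0) - (\<phi> z0 + z0 * deriv \<phi> z0) * E z0 = 2 * deriv d z0"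
      by (rule DERIV_unique)
    then have "E z0 * (e * (1 - z0 * \<phi> z0) - (\<phi> z0 + of_real m' * \<phi> z0)) = E z0 * (2 * \<phi> z0)"
      unfolding m'(2) using Enz[OF z0b] by (simp add: \<phi>_def algebra_simps)
    then have "e * (1 - z0 * \<phi> z0) - (\<phi> z0 + of_real m' * \<phi> z0) = 2 * \<phi> z0"
      using Enz[OF z0b] mult_left_cancel by blast
    then have "e * (1 - \<omega>) - (1 + of_real m') * \<phi> z0 = 2 * \<phi> z0"
      by (simp add: \<omega>_def algebra_simps)
    then have "e * (1 - \<omega>) = of_real (3 + m') * \<phi> z0" by (simp add: algebra_simps)
    then have e1: "z0 * e * (1 - \<omega>) = of_real (3 + m') * \<omega>"
      unfolding mult.assoc[of z0] by (simp only: \<omega>_def mult.left_commute[of z0])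
    have "\<omega> \<noteq> 1"
    proof
      assume "\<omega> = 1"
      then have "complex_of_real (3 + m') = 0" using e1 by simp
      then show False using m'(1) by (simp only: of_real_eq_0_iff)
    qed
    then have "z0 * e = of_real (3 + m') * (\<omega> / (1 - \<omega>))" using e1 by (simp add: field_simps)
    then have "Re (z0 * e) = (3 + m') * Re (\<omega> / (1 - \<omega>))"
      by (simp only: times_complex.sel(1) Re_complex_of_real Im_complex_of_real mult_zero_left diff_zero)
    also have "\<dots> \<le> (3 + m') * (- 1 / 2)"
      using m'(1) Re_inverse_outside[OF big0[folded \<omega>_def] \<open>\<omega> \<noteq> 1\<close>] by (intro mult_left_mono) auto
    also have "\<dots> \<le> - 3 / 2" using m'(1) by simp
    finally have "Re (z0 * e) \<le> - 3 / 2" .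
    moreover have "z0 * e = star_quot dg z0 - 2 + extra b z0" using z0nz by (simp add: e_def)
    ultimately show False using star_quot[OF z0b] Re_extra[of z0 b] z0b by simp
  qed
  then have half: "Re (1 / (1 - z * \<phi> z)) > 1 / 2" by (rule Re_inverse_ball)
  have "Re (2 * x) = 2 * Re x" for x by simp
  then have "Re (2 * (1 / (1 - z * \<phi> z))) > 1" using half by (simp only:)
  moreover have "star_quot d z = 2 * (1 / (1 - z * \<phi> z))"
  proof -
    have "1 - z * \<phi> z = (E z - z * deriv d z) / E z" unfolding \<phi>_def using Enz[OF z(1)]
      by (simp add: diff_divide_distrib)
    also have "E z - z * deriv d z = 2 * d z" by (simp add: E_def)
    finally have "1 - z * \<phi> z = 2 * d z / E z" .
    then have "2 * (1 / (1 - z * \<phi> z)) = E z / d z" using Enz[OF z(1)] z(2) by simp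
    then show ?thesis by (simp add: star_quot_def E_def)
  qed
  ultimately show ?thesis by (simp only:)
qed


text \<open>An equation of Briot-Bouquet type. The numerator is \<open>star_quot d * d\<close>, so
  its quotient \<open>z * E' / E\<close> is the sum of the corresponding quotients of
  \<open>star_quot d\<close> and of \<open>d\<close>, and the latter is
  \<open>star_quot d - 2\<close>.\<close>

lemma star_quot_relation:
  assumes d: "d holomorphic_on ball 0 1" and dg: "dg holomorphic_on ball 0 1"
    and nz: "\<And>z. z \<in> ball 0 1 \<Longrightarrow> dg z \<noteq> 0" and dnz: "\<And>z. z \<in> ball 0 1 \<Longrightarrow> d z \<noteq> 0"
    and ode: "\<And>z. z \<in> ball 0 1 \<Longrightarrow> wt b z * (2 * d z + z * deriv d z) = dg z"
  shows "star_quot d holomorphic_on ball 0 1"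
    and "z \<in> ball 0 1 \<Longrightarrow> star_quot d z \<noteq> 0"
    and "z \<in> ball 0 1 \<Longrightarrow> star_quot d z + z * deriv (star_quot d) z / star_quot d z = star_quot dg z + extra b z"
proof -
  define E where "E = (\<lambda>z. 2 * d z + z * deriv d z)"
  show sgh: "star_quot d holomorphic_on ball 0 1"
    unfolding star_quot_def[abs_def] using dnz by (intro holomorphic_intros holomorphic_deriv d) auto
  have Enz: "E z \<noteq> 0" if "z \<in> ball 0 1" for z
    using ode[OF that] nz[OF that] by (auto simp: E_def)
  have sgE: "star_quot d z = E z / d z" for z by (simp add: star_quot_def E_def)
  show sgnz: "z \<in> ball 0 1 \<Longrightarrow> star_quot d z \<noteq> 0" for z using Enz dnz by (simp add: sgE)
  assume z: "z \<in> ball 0 1"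
  show "star_quot d z + z * deriv (star_quot d) z / star_quot d z = star_quot dg z + extra b z"
  proof (cases "z = 0")
    case True
    have "star_quot d 0 = 2" "star_quot dg 0 = 2" using dnz[of 0] nz[of 0] by (simp_all add: star_quot_def)
    then show ?thesis using True by (simp add: extra_def)
  next
    case False
    define e where "e = (star_quot dg z - 2 + extra b z) / z"
    have E': "(E has_field_derivative E z * e) (at z)"
      using logderiv_relation(1)[OF d dg nz ode z] False unfolding E_def e_def by blast
    have d': "(d has_field_derivative deriv d z) (at z)"
      by (rule holomorphic_derivI[OF d _ z]) simp
    have s': "(star_quot d has_field_derivative deriv (star_quot d) z) (at z)"
      by (rule holomorphic_derivI[OF sgh _ z]) simp
    have "((\<lambda>z. star_quot d z * d z) has_field_derivative deriv (star_quot d) z * d z + deriv d z * star_quot d z) (at z)"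
      by (rule DERIV_mult[OF s' d'])
    moreover have "((\<lambda>z. star_quot d z * d z) has_field_derivative E z * e) (at z)"
    proof (rule DERIV_cong_ev[THEN iffD2, OF refl _ refl E'])
      have "star_quot d x * d x = E x" if "x \<in> ball 0 1" for x using dnz[OF that] by (simp add: sgE)
      then show "\<forall>\<^sub>F x in nhds z. star_quot d x * d x = E x" using z eventually_nhds open_ball by blast
    qed
    ultimately have "deriv (star_quot d) z * d z + deriv d z * star_quot d z = E z * e" by (rule DERIV_unique)
    then have "z * deriv (star_quot d) z * d z + z * deriv d z * star_quot d z = E z * (z * e)"
      by (metis (no_types, opaque_lifting) distrib_left mult.assoc mult.left_commute)
    then have "z * deriv (star_quot d) z * d z + z * deriv d z * star_quot d z = star_quot d z * d z * (star_quot dg z - 2 + extra b z)"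
      using False dnz[OF z] by (simp add: e_def sgE)
    moreover have "z * deriv d z = (star_quot d z - 2) * d z" using dnz[OF z] by (simp add: star_quot_def field_simps)
    ultimately have "(z * deriv (star_quot d) z + (star_quot d z - 2) * star_quot d z) * d z = (star_quot d z * (star_quot dg z - 2 + extra b z)) * d z"
      by (simp add: algebra_simps)
    then have "z * deriv (star_quot d) z + (star_quot d z - 2) * star_quot d z = star_quot d z * (star_quot dg z - 2 + extra b z)"
      using dnz[OF z] by simp
    then show ?thesis using sgnz[OF z] by (simp add: field_simps)
  qed
qed

text \<open>As \<open>Im h\<close> vanishes on the diameter, a negative minimum over the closed half
  disc of radius \<open>norm z1\<close> is attained off it. Every point near \<open>z0\<close> with
  norm at most \<open>norm z0\<close> then belongs to the half disc, so
  \<open>radial_minimum\<close> applies to \<open>- \<i> * h\<close>.\<close>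

lemma half_disc_minimum:
  assumes h: "h holomorphic_on ball 0 1"
    and real: "\<And>z. z \<in> ball 0 1 \<Longrightarrow> Im z = 0 \<Longrightarrow> Im (h z) = 0"
    and z1: "z1 \<in> ball 0 1" "Im z1 > 0" "Im (h z1) < 0"
  obtains z0 m where "z0 \<in> ball 0 1" "Im z0 > 0" "Im (h z0) < 0" "m \<ge> 0" "z0 * deriv h z0 = - \<i> * complex_of_real m"
proof -
  define K where "K = cball 0 (norm z1) \<inter> {z. Im z \<ge> 0}"
  have K: "compact K" unfolding K_def by (intro compact_Int_closed closed_halfspace_Im_ge) auto
  have sub: "K \<subseteq> ball 0 1" using z1 by (auto simp: K_def)
  have "z1 \<in> K" using z1 by (simp add: K_def)
  have "continuous_on K (\<lambda>z. Im (h z))"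
    by (intro continuous_intros continuous_on_subset[OF holomorphic_on_imp_continuous_on[OF h] sub])
  then obtain z0 where z0: "z0 \<in> K" "\<And>y. y \<in> K \<Longrightarrow> Im (h z0) \<le> Im (h y)"
    using continuous_attains_inf[OF K, of "\<lambda>z. Im (h z)"] \<open>z1 \<in> K\<close> by blast
  have neg: "Im (h z0) < 0" using z0(2)[OF \<open>z1 \<in> K\<close>] z1(3) by simp
  have z0b: "z0 \<in> ball 0 1" using sub z0 by blast
  have "Im z0 \<noteq> 0" using real[OF z0b] neg by auto
  then have im: "Im z0 > 0" using z0(1) by (simp add: K_def)
  have h': "(h has_field_derivative deriv h z0) (at z0)" by (rule holomorphic_derivI[OF h _ z0b]) simp
  obtain m where m: "m \<ge> 0" "z0 * (- \<i> * deriv h z0) = - complex_of_real m"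
  proof (rule radial_minimum[OF DERIV_cmult[OF h', of "- \<i>"] im])
    fix z assume z: "z \<in> ball z0 (Im z0)" "norm z \<le> norm z0"
    have "\<bar>Im (z0 - z)\<bar> < Im z0" using z(1) abs_Im_le_cmod[of "z0 - z"] by (simp add: dist_norm)
    then have "z \<in> K" using z(2) z0(1) by (auto simp: K_def)
    then show "Re (- \<i> * h z0) \<le> Re (- \<i> * h z)" using z0(2) by simp
  qed blast
  have "z0 * deriv h z0 = \<i> * (z0 * (- \<i> * deriv h z0))" by (simp add: algebra_simps)
  also have "\<dots> = - \<i> * of_real m" unfolding m(2) by simp
  finally show ?thesis using that z0b im neg m(1) by blast
qed

text \<open>Write \<open>\<sigma> = star_quot d\<close>. At a negative minimum of
  \<open>Im \<sigma>\<close> the term \<open>z * \<sigma>' / \<sigma>\<close> equals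
  \<open>- \<i> * m / \<sigma>\<close>, whose imaginary part is nonpositive because
  \<open>Re \<sigma> > 0\<close>. So the left side of the relation for \<open>\<sigma>\<close> has
  negative imaginary part, while the right side has not.\<close>

lemma Im_star_quot_step:
  assumes d: "d holomorphic_on ball 0 1" and dg: "dg holomorphic_on ball 0 1"
    and nz: "\<And>z. z \<in> ball 0 1 \<Longrightarrow> dg z \<noteq> 0" and dnz: "\<And>z. z \<in> ball 0 1 \<Longrightarrow> d z \<noteq> 0"
    and ode: "\<And>z. z \<in> ball 0 1 \<Longrightarrow> wt b z * (2 * d z + z * deriv d z) = dg z"
    and star_quot: "\<And>z. z \<in> ball 0 1 \<Longrightarrow> Re (star_quot d z) > 1"
    and real: "\<And>z. z \<in> ball 0 1 \<Longrightarrow> Im z = 0 \<Longrightarrow> Im (star_quot d z) = 0"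
    and img: "\<And>z. z \<in> ball 0 1 \<Longrightarrow> Im z > 0 \<Longrightarrow> Im (star_quot dg z) \<ge> 0"
    and z: "z \<in> ball 0 1" "Im z > 0"
  shows "Im (star_quot d z) \<ge> 0"
proof (rule ccontr)
  assume "\<not> Im (star_quot d z) \<ge> 0"
  then have neg: "Im (star_quot d z) < 0" by simp
  note sgh = star_quot_relation(1)[OF d dg nz dnz ode]
  have rel: "star_quot d z + z * deriv (star_quot d) z / star_quot d z = star_quot dg z + extra b z" if "z \<in> ball 0 1" for z
    by (rule star_quot_relation(3)[OF d dg nz dnz ode that])
  obtain z0 m where z0: "z0 \<in> ball 0 1" "Im z0 > 0" "Im (star_quot d z0) < 0" "m \<ge> 0"
      "z0 * deriv (star_quot d) z0 = - \<i> * complex_of_real m"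
    using half_disc_minimum[OF sgh real z neg] by blast
  have "Im (star_quot d z0 + z0 * deriv (star_quot d) z0 / star_quot d z0) = Im (star_quot d z0) - m * Re (star_quot d z0) / norm (star_quot d z0) ^ 2"
    unfolding z0(5) by (simp add: Im_divide cmod_power2)
  also have "\<dots> < 0"
    using z0(3,4) star_quot[OF z0(1)] by (intro diff_less_0_iff_less[THEN iffD2]) (auto intro: less_le_trans)
  finally have "Im (star_quot dg z0 + extra b z0) < 0" using rel[OF z0(1)] by simp
  then show False using img[OF z0(1,2)] Im_extra[of z0 b] z0(1,2) by simp
qed

lemma upper_sector:
  assumes v: "Im v > 0" and "Im x \<ge> 0" "Im (x * cnj v) \<le> 0"
  obtains p q where "p \<ge> 0" "q \<ge> 0" "x = of_real p + of_real q * v"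
proof -
  define q where "q = Im x / Im v"
  define p where "p = Re x - q * Re v"
  have "q \<ge> 0" using assms by (simp add: q_def)
  moreover have "p = - Im (x * cnj v) / Im v" using v by (simp add: p_def q_def field_simps)
  then have "p \<ge> 0" using assms by (simp add: divide_nonpos_pos)
  moreover have "x = of_real p + of_real q * v" using v by (simp add: complex_eq_iff p_def q_def)
  ultimately show ?thesis using that by blast
qed

text \<open>Let \<open>\<theta>\<close> be the argument of \<open>v\<close>, which is below
  \<open>pi / 2\<close>. A nonzero \<open>P / D\<close> has argument between
  \<open>- 2 * \<theta>\<close> and \<open>\<theta>\<close>. Positive imaginary part leaves only
  arguments in \<open>(0, \<theta>]\<close>; otherwise multiplication by \<open>v\<close> moves
  \<open>[- 2 * \<theta>, 0]\<close> to \<open>[- \<theta>, \<theta>]\<close>. The proof verifies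
  this in coordinates.\<close>

lemma sector_quotient:
  assumes v: "Re v > 0" "Im v > 0"
    and P: "p1 \<ge> 0" "p2 \<ge> 0" "P = of_real p1 + of_real p2 * v"
    and D: "d1 \<ge> 0" "d2 \<ge> 0" "D = of_real d1 + of_real d2 * v\<^sup>2"
  shows "Im (P * cnj D) > 0 \<Longrightarrow> Re (P * cnj D) > 0"
    and "Im (P * cnj D) \<le> 0 \<Longrightarrow> Re (v * (P * cnj D)) \<ge> 0"
proof -
  define a b N where "a = Re v" and "b = Im v" and "N = a\<^sup>2 + b\<^sup>2"
  have pos: "a > 0" "b > 0" "N > 0" using v unfolding a_def b_def N_def by (auto simp: add_pos_pos)
  have veq: "v = Complex a b" by (simp add: a_def b_def)
  have Re1: "Re (P * cnj D) = p1 * d1 + p2 * d1 * a + p1 * d2 * (a\<^sup>2 - b\<^sup>2) + p2 * d2 * N * a"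
    and Im1: "Im (P * cnj D) = b * (p2 * d1 - 2 * a * (p1 * d2) - p2 * d2 * N)"
    and Re2: "Re (v * (P * cnj D)) = p1 * d1 * a + p2 * d1 * (a\<^sup>2 - b\<^sup>2) + p1 * d2 * N * a + p2 * d2 * N\<^sup>2"
    unfolding P(3) D(3) veq N_def by (simp_all add: power2_eq_square algebra_simps)
  {
    assume "Im (P * cnj D) > 0"
    then have 1: "p2 * d1 > 2 * a * (p1 * d2) + p2 * d2 * N"
      unfolding Im1 using pos by (simp add: zero_less_mult_iff)
    have nn: "0 \<le> 2 * a * (p1 * d2)" "0 \<le> p2 * d2 * N" using P D pos by simp_all
    have "p2 * (d1 - d2 * N) > 0" using 1 nn by (simp add: algebra_simps)
    then have p2: "p2 > 0" and d1: "d1 > d2 * N" using P(2) by (auto simp: zero_less_mult_iff)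
    have "d1 > 0" using d1 D(2) pos by (smt (verit) mult_nonneg_nonneg)
    have "p1 * (d2 * N) \<le> p1 * d1" using d1 P(1) by (intro mult_left_mono) auto
    moreover have "p1 * (d2 * N) + p1 * d2 * (a\<^sup>2 - b\<^sup>2) = p1 * d2 * (2 * a\<^sup>2)" by (simp add: N_def algebra_simps)
    moreover have "p1 * d2 * (2 * a\<^sup>2) \<ge> 0" using P D by simp
    moreover have "p2 * d1 * a > 0" using p2 \<open>d1 > 0\<close> pos by simp
    moreover have "p2 * d2 * N * a \<ge> 0" using P D pos by simp
    ultimately show "Re (P * cnj D) > 0" unfolding Re1 by linarith
  }
  {
    assume "Im (P * cnj D) \<le> 0"
    then have 1: "p2 * d1 \<le> 2 * a * (p1 * d2) + p2 * d2 * N"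
      unfolding Im1 using pos by (simp add: mult_le_0_iff)
    show "Re (v * (P * cnj D)) \<ge> 0"
    proof (cases "b\<^sup>2 \<le> a\<^sup>2")
      case True
      then show ?thesis unfolding Re2 using P D pos by (intro add_nonneg_nonneg mult_nonneg_nonneg) auto
    next
      case False
      define c where "c = b\<^sup>2 - a\<^sup>2"
      have c: "c > 0" "c \<le> N" using False by (auto simp: c_def N_def)
      have main: "p2 * d1 * c \<le> p1 * d1 * a + p1 * d2 * N * a + p2 * d2 * N\<^sup>2"
      proof (cases "d1 \<le> d2 * N")
        case True
        have "p2 * d1 * c \<le> p2 * (d2 * N) * N"
          using True c P D pos by (intro mult_mono) auto
        moreover have "p1 * d1 * a \<ge> 0" "p1 * d2 * N * a \<ge> 0" using P D pos by auto
        ultimately show ?thesis by (simp add: power2_eq_square)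
      next
        case False
        have "p2 * d1 * c \<le> (2 * a * (p1 * d2) + p2 * d2 * N) * c"
          using 1 c by (intro mult_right_mono) auto
        also have "\<dots> \<le> (2 * a * (p1 * d2) + p2 * d2 * N) * N"
          using c P D pos by (intro mult_left_mono) auto
        also have "\<dots> = p1 * (d2 * N) * a + p1 * d2 * N * a + p2 * d2 * N\<^sup>2"
          by (simp add: power2_eq_square algebra_simps)
        also have "p1 * (d2 * N) * a \<le> p1 * d1 * a"
          using False P pos by (intro mult_right_mono mult_left_mono) auto
        finally show ?thesis by simp
      qed
      have "a\<^sup>2 - b\<^sup>2 = - c" by (simp add: c_def)
      then show ?thesis unfolding Re2 using main by simp
    qed
  }
qed

text \<open>With \<open>\<eta> = P / d\<close> and \<open>\<sigma> = star_quot d\<close>, the two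
  equations give \<open>g / dg = ((\<sigma> - 1) * \<eta> + \<i> * m) / \<sigma>\<close> at a
  positive maximum of \<open>Im \<eta>\<close> over a half disc. Its imaginary part is positive once
  \<open>Re \<sigma> > 1\<close>, \<open>Im \<sigma> \<ge> 0\<close> and
  \<open>Re \<eta> > 0\<close>; the last condition is what the cones supply wherever
  \<open>Im \<eta> > 0\<close>.\<close>

lemma Im_quotient_step:
  assumes d: "d holomorphic_on ball 0 1" and dg: "dg holomorphic_on ball 0 1"
    and P: "P holomorphic_on ball 0 1"
    and nz: "\<And>z. z \<in> ball 0 1 \<Longrightarrow> dg z \<noteq> 0" and dnz: "\<And>z. z \<in> ball 0 1 \<Longrightarrow> d z \<noteq> 0"
    and ode: "\<And>z. z \<in> ball 0 1 \<Longrightarrow> wt b z * (2 * d z + z * deriv d z) = dg z"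
    and odeP: "\<And>z. z \<in> ball 0 1 \<Longrightarrow> wt b z * (P z + z * deriv P z) = g z"
    and star_quot: "\<And>z. z \<in> ball 0 1 \<Longrightarrow> Re (star_quot d z) > 1"
    and sgi: "\<And>z. z \<in> ball 0 1 \<Longrightarrow> Im z > 0 \<Longrightarrow> Im (star_quot d z) \<ge> 0"
    and real: "\<And>z. z \<in> ball 0 1 \<Longrightarrow> Im z = 0 \<Longrightarrow> Im (P z / d z) = 0"
    and Re: "\<And>z. z \<in> ball 0 1 \<Longrightarrow> Im z > 0 \<Longrightarrow> Im (P z / d z) > 0 \<Longrightarrow> Re (P z / d z) > 0"
    and img: "\<And>z. z \<in> ball 0 1 \<Longrightarrow> Im z > 0 \<Longrightarrow> Im (g z / dg z) \<le> 0"
    and z: "z \<in> ball 0 1" "Im z > 0"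
  shows "Im (P z / d z) \<le> 0"
proof (rule ccontr)
  assume "\<not> Im (P z / d z) \<le> 0"
  then have neg: "Im (- (P z / d z)) < 0" by simp
  define h where "h = (\<lambda>z. - (P z / d z))"
  have h: "h holomorphic_on ball 0 1" unfolding h_def using dnz by (intro holomorphic_intros d P)
  obtain z0 m where z0: "z0 \<in> ball 0 1" "Im z0 > 0" "Im (h z0) < 0" "m \<ge> 0"
      "z0 * deriv h z0 = - \<i> * complex_of_real m"
    using half_disc_minimum[OF h _ z] real neg unfolding h_def by auto
  have h': "(h has_field_derivative deriv h z0) (at z0)" by (rule holomorphic_derivI[OF h _ z0(1)]) simp
  have d': "(d has_field_derivative deriv d z0) (at z0)" by (rule holomorphic_derivI[OF d _ z0(1)]) simp
  have P': "(P has_field_derivative deriv P z0) (at z0)" by (rule holomorphic_derivI[OF P _ z0(1)]) simp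
  have "((\<lambda>z. h z * d z) has_field_derivative deriv h z0 * d z0 + deriv d z0 * h z0) (at z0)"
    by (rule DERIV_mult[OF h' d'])
  moreover have "((\<lambda>z. h z * d z) has_field_derivative - deriv P z0) (at z0)"
  proof (rule DERIV_cong_ev[THEN iffD2, OF refl _ refl DERIV_minus[OF P']])
    have "h x * d x = - P x" if "x \<in> ball 0 1" for x using dnz[OF that] by (simp add: h_def)
    then show "\<forall>\<^sub>F x in nhds z0. h x * d x = - P x" using z0(1) eventually_nhds open_ball by blast
  qed
  ultimately have dP: "deriv h z0 * d z0 + deriv d z0 * h z0 = - deriv P z0" by (rule DERIV_unique)
  define \<eta> \<sigma> where "\<eta> = P z0 / d z0" and "\<sigma> = star_quot d z0"
  have dz: "d z0 \<noteq> 0" and wz: "wt b z0 \<noteq> 0" using dnz ball_wt_nz z0(1) by auto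
  have zd: "z0 * deriv d z0 = (\<sigma> - 2) * d z0" using dz by (simp add: \<sigma>_def star_quot_def field_simps)
  have zp: "z0 * deriv P z0 = - (z0 * deriv h z0 * d z0 + z0 * deriv d z0 * h z0)"
    using arg_cong[OF dP, of "\<lambda>x. - z0 * x"] by (simp add: algebra_simps)
  have hz: "h z0 = - \<eta>" by (simp add: h_def \<eta>_def)
  have zP: "z0 * deriv P z0 = (\<i> * of_real m + (\<sigma> - 2) * \<eta>) * d z0"
    unfolding zp z0(5) zd hz by (simp add: algebra_simps)
  have "g z0 / dg z0 = (P z0 + z0 * deriv P z0) / (2 * d z0 + z0 * deriv d z0)"
    unfolding ode[OF z0(1), symmetric] odeP[OF z0(1), symmetric] using wz by simp
  also have "P z0 + z0 * deriv P z0 = ((\<sigma> - 1) * \<eta> + \<i> * of_real m) * d z0"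
  proof -
    have "P z0 = \<eta> * d z0" using dz by (simp add: \<eta>_def)
    then show ?thesis unfolding zP by (simp add: algebra_simps)
  qed
  also have "2 * d z0 + z0 * deriv d z0 = \<sigma> * d z0" using dz by (simp add: \<sigma>_def star_quot_def)
  finally have eq: "g z0 / dg z0 = ((\<sigma> - 1) * \<eta> + \<i> * of_real m) / \<sigma>" using dz by simp
  have \<sigma>: "Re \<sigma> > 1" "Im \<sigma> \<ge> 0" using star_quot sgi z0 by (auto simp: \<sigma>_def)
  have \<eta>: "Im \<eta> > 0" "Re \<eta> > 0" using z0 Re unfolding h_def \<eta>_def by auto
  have "((\<sigma> - 1) * \<eta> + \<i> * of_real m) * cnj \<sigma> = (of_real ((Re \<sigma>)\<^sup>2 + (Im \<sigma>)\<^sup>2 - Re \<sigma>) + \<i> * of_real (Im \<sigma>)) * \<eta> + \<i> * of_real m * cnj \<sigma>"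
    by (simp add: complex_eq_iff power2_eq_square algebra_simps)
  then have "Im (((\<sigma> - 1) * \<eta> + \<i> * of_real m) * cnj \<sigma>) = ((Re \<sigma>)\<^sup>2 + (Im \<sigma>)\<^sup>2 - Re \<sigma>) * Im \<eta> + Im \<sigma> * Re \<eta> + m * Re \<sigma>"
    by simp
  also have "\<dots> > 0"
  proof -
    have "(Re \<sigma>)\<^sup>2 > Re \<sigma>" using \<sigma>(1) by (simp add: power2_eq_square)
    then have "(Re \<sigma>)\<^sup>2 + (Im \<sigma>)\<^sup>2 - Re \<sigma> > 0" by (smt (verit) zero_le_power2)
    then show ?thesis using \<eta> \<sigma> z0(4) by (intro add_pos_nonneg mult_pos_pos mult_nonneg_nonneg) auto
  qed
  finally have pos: "0 < Im (((\<sigma> - 1) * \<eta> + \<i> * of_real m) * cnj \<sigma>)" .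
  have "Im ((((\<sigma> - 1) * \<eta> + \<i> * of_real m)) / \<sigma>) > 0"
  proof -
    have "\<sigma> \<noteq> 0" using \<sigma> by auto
    then have "norm \<sigma> ^ 2 > 0" by simp
    with pos have "0 < Im (((\<sigma> - 1) * \<eta> + \<i> * of_real m) * cnj \<sigma>) / norm \<sigma> ^ 2"
      by (rule divide_pos_pos)
    then show ?thesis
      by (subst complex_div_cnj) (simp only: Im_divide_of_real of_real_power[symmetric])
  qed
  then show False using img[OF z0(1,2)] unfolding eq by simp
qed

text \<open>Differentiating the equation for \<open>P\<close> at a minimum of \<open>Re h\<close>,
  where \<open>h = P' / d\<close>, gives \<open>h - m / \<sigma> = g' / dg\<close>, with the
  additional summand \<open>g / dg / (1 - z)\<close> for the letter B. Since
  \<open>Re (m / \<sigma>) \<ge> 0\<close>, the lower bound \<open>s\<close> passes from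
  \<open>g' / dg\<close> to \<open>h\<close>.\<close>

lemma Re_ratio_step:
  assumes d: "d holomorphic_on ball 0 1" and dg: "dg holomorphic_on ball 0 1"
    and P: "P holomorphic_on ball 0 1" and g: "g holomorphic_on ball 0 1"
    and nz: "\<And>z. z \<in> ball 0 1 \<Longrightarrow> dg z \<noteq> 0" and dnz: "\<And>z. z \<in> ball 0 1 \<Longrightarrow> d z \<noteq> 0"
    and ode: "\<And>z. z \<in> ball 0 1 \<Longrightarrow> wt b z * (2 * d z + z * deriv d z) = dg z"
    and odeP: "\<And>z. z \<in> ball 0 1 \<Longrightarrow> wt b z * (P z + z * deriv P z) = g z"
    and star_quot: "\<And>z. z \<in> ball 0 1 \<Longrightarrow> Re (star_quot d z) > 1"
    and k: "\<And>z. z \<in> ball 0 1 \<Longrightarrow> b \<Longrightarrow> Re (g z / dg z / (1 - z)) \<ge> 0"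
    and r: "\<And>z. z \<in> ball 0 1 \<Longrightarrow> Re (deriv g z / dg z) \<ge> s"
    and z: "z \<in> ball 0 1"
  shows "Re (deriv P z / d z) \<ge> s"
proof (rule ccontr)
  assume neg: "\<not> Re (deriv P z / d z) \<ge> s"
  define h where "h = (\<lambda>z. deriv P z / d z)"
  have dP: "deriv P holomorphic_on ball 0 1" by (intro holomorphic_deriv P) auto
  have h: "h holomorphic_on ball 0 1" unfolding h_def using dnz by (intro holomorphic_intros d dP)
  have sub: "cball 0 (norm z) \<subseteq> ball 0 1" using z by auto
  have "continuous_on (cball 0 (norm z)) (\<lambda>z. Re (h z))"
    by (intro continuous_intros continuous_on_subset[OF holomorphic_on_imp_continuous_on[OF h] sub])
  then obtain z0 where z0: "z0 \<in> cball 0 (norm z)" "\<And>y. y \<in> cball 0 (norm z) \<Longrightarrow> Re (h z0) \<le> Re (h y)"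
    using continuous_attains_inf[of "cball 0 (norm z)" "\<lambda>z. Re (h z)"] by auto
  have z0b: "z0 \<in> ball 0 1" using sub z0 by blast
  have small: "Re (h z0) < s" using z0(2)[of z] neg by (simp add: h_def)
  have h': "(h has_field_derivative deriv h z0) (at z0)" by (rule holomorphic_derivI[OF h _ z0b]) simp
  have d': "(d has_field_derivative deriv d z0) (at z0)" by (rule holomorphic_derivI[OF d _ z0b]) simp
  have P': "(P has_field_derivative deriv P z0) (at z0)" by (rule holomorphic_derivI[OF P _ z0b]) simp
  have dP': "(deriv P has_field_derivative deriv (deriv P) z0) (at z0)" by (rule holomorphic_derivI[OF dP _ z0b]) simp
  have g': "(g has_field_derivative deriv g z0) (at z0)" by (rule holomorphic_derivI[OF g _ z0b]) simp
  obtain m where m: "m \<ge> 0" "z0 * deriv h z0 = - complex_of_real m"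
    by (rule radial_minimum[OF h' zero_less_one]) (use z0 in auto)
  have "((\<lambda>z. h z * d z) has_field_derivative deriv h z0 * d z0 + deriv d z0 * h z0) (at z0)"
    by (rule DERIV_mult[OF h' d'])
  moreover have "((\<lambda>z. h z * d z) has_field_derivative deriv (deriv P) z0) (at z0)"
  proof (rule DERIV_cong_ev[THEN iffD2, OF refl _ refl dP'])
    have "h x * d x = deriv P x" if "x \<in> ball 0 1" for x using dnz[OF that] by (simp add: h_def)
    then show "\<forall>\<^sub>F x in nhds z0. h x * d x = deriv P x" using z0b eventually_nhds open_ball by blast
  qed
  ultimately have ddP: "deriv (deriv P) z0 = deriv h z0 * d z0 + deriv d z0 * h z0" using DERIV_unique by blast
  have w: "(wt b has_field_derivative (if b then - 1 else 0)) (at z0)"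
    unfolding wt_def by (cases b) (auto intro!: derivative_eq_intros)
  have "((\<lambda>z. wt b z * (P z + z * deriv P z)) has_field_derivative
      (if b then - 1 else 0) * (P z0 + z0 * deriv P z0) + (2 * deriv P z0 + z0 * deriv (deriv P) z0) * wt b z0) (at z0)"
    by (rule DERIV_mult[OF w]) (use P' dP' in \<open>auto intro!: derivative_eq_intros\<close>)
  moreover have "((\<lambda>z. wt b z * (P z + z * deriv P z)) has_field_derivative deriv g z0) (at z0)"
    by (rule DERIV_cong_ev[THEN iffD2, OF refl _ refl g'])
      (use odeP z0b in \<open>auto simp: eventually_nhds intro!: exI[of _ "ball 0 1"]\<close>)
  ultimately have dgz: "deriv g z0 = (if b then - 1 else 0) * (P z0 + z0 * deriv P z0)
      + (2 * deriv P z0 + z0 * deriv (deriv P) z0) * wt b z0" using DERIV_unique by blast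
  define \<sigma> where "\<sigma> = star_quot d z0"
  have dz: "d z0 \<noteq> 0" and wz: "wt b z0 \<noteq> 0" using dnz ball_wt_nz z0b by auto
  have \<sigma>d: "z0 * deriv d z0 = (\<sigma> - 2) * d z0" using dz by (simp add: \<sigma>_def star_quot_def field_simps)
  have \<sigma>: "Re \<sigma> > 1" using star_quot z0b by (auto simp: \<sigma>_def)
  then have \<sigma>nz: "\<sigma> \<noteq> 0" by auto
  have dgd: "dg z0 = wt b z0 * (\<sigma> * d z0)"
    unfolding ode[OF z0b, symmetric] \<sigma>d by (simp add: algebra_simps)
  have "2 * deriv P z0 + z0 * deriv (deriv P) z0 = 2 * (h z0 * d z0) + (z0 * deriv h z0 * d z0 + z0 * deriv d z0 * h z0)"
    unfolding ddP using dz by (simp add: h_def algebra_simps)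
  also have "\<dots> = (\<sigma> * h z0 - of_real m) * d z0" unfolding \<sigma>d m(2) by (simp add: algebra_simps)
  finally have ddP': "2 * deriv P z0 + z0 * deriv (deriv P) z0 = (\<sigma> * h z0 - of_real m) * d z0" .
  have "deriv g z0 = (\<sigma> * h z0 - of_real m) * d z0 * wt b z0 + (if b then - (g z0 / (1 - z0)) else 0)"
  proof -
    have "(if b then - 1 else 0) * (P z0 + z0 * deriv P z0) = (if b then - (g z0 / (1 - z0)) else 0)"
      using odeP[OF z0b, symmetric] wz by (auto simp: wt_def)
    then show ?thesis unfolding dgz ddP' by (simp only: add.commute)
  qed
  then have "deriv g z0 / dg z0 = (\<sigma> * h z0 - of_real m) * d z0 * wt b z0 / dg z0 + (if b then - (g z0 / dg z0 / (1 - z0)) else 0)"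
    by (simp add: add_divide_distrib)
  moreover have "(\<sigma> * h z0 - of_real m) * d z0 * wt b z0 / dg z0 = h z0 - of_real m / \<sigma>"
    unfolding dgd using dz wz \<sigma>nz by (simp add: field_simps)
  ultimately have eq: "h z0 - of_real m / \<sigma> = deriv g z0 / dg z0 + (if b then g z0 / dg z0 / (1 - z0) else 0)" by simp
  have "Re (of_real m / \<sigma>) \<ge> 0" using m(1) \<sigma> by (simp add: Re_divide)
  moreover have "Re (h z0 - of_real m / \<sigma>) \<ge> s" unfolding eq using r[OF z0b] k[OF z0b] by auto
  ultimately show False using small by simp
qed

section \<open>Positivity of the ratio of the two derivatives\<close>

lemma avg_op_cnj:
  assumes "\<And>z. z \<in> slit_plane \<Longrightarrow> f (cnj z) = cnj (f z)" "z \<in> slit_plane"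
  shows "avg_op b i f (cnj z) = cnj (avg_op b i f z)"
proof -
  have m: "mob b u (cnj z) = cnj (mob b u z)" "den b u (cnj z) = cnj (den b u z)" for u
    by (simp_all add: mob_def den_def)
  have "integral {0..1} (\<lambda>u. of_real u ^ (i - 1) * f (mob b u (cnj z)) / den b u (cnj z) ^ i)
     = integral {0..1} (\<lambda>u. cnj (of_real u ^ (i - 1) * f (mob b u z) / den b u z ^ i))"
    by (rule integral_cong) (simp add: m assms mob_slit)
  then show ?thesis unfolding avg_op_def by (simp add: integral_cnj)
qed

lemma ker_cnj: "ker s (cnj z) = cnj (ker s z)" by (simp add: ker_def)

lemma G_cnj: "z \<in> slit_plane \<Longrightarrow> G w s (cnj z) = cnj (G w s z)"
  by (induction w arbitrary: z) (auto simp: G_Nil G_Cons ker_cnj intro!: avg_op_cnj)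

lemma dG_cnj: "z \<in> slit_plane \<Longrightarrow> dG w s (cnj z) = cnj (dG w s z)"
  by (induction w arbitrary: z) (auto simp: dG_Nil dG_Cons ker_cnj intro!: avg_op_cnj)

lemma G_real: "z \<in> slit_plane \<Longrightarrow> Im z = 0 \<Longrightarrow> Im (G w s z) = 0"
  using G_cnj[of z w s] by (metis Reals_cnj_iff complex_is_Real_iff)

lemma dG_real: "z \<in> slit_plane \<Longrightarrow> Im z = 0 \<Longrightarrow> Im (dG w s z) = 0"
  using dG_cnj[of z w s] by (metis Reals_cnj_iff complex_is_Real_iff)

text \<open>The sector lemma with both points equal: after a rotation all squared kernels at
  \<open>z\<close> have real part at least \<open>\<kappa> > 0\<close>, and so has their average up
  to the mass. The region includes the unit circle without the point 1.\<close>

lemma dG_nz: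
  assumes "0 \<le> s" "s \<le> 1" "Re z < 1" "norm z \<le> 2"
  shows "dG w s z \<noteq> 0"
proof
  assume 0: "dG w s z = 0"
  obtain \<kappa> where \<kappa>: "\<kappa> > 0" "\<And>y. Re y < 1 \<Longrightarrow> norm y \<le> 2 \<Longrightarrow>
     \<exists>c. norm c = 1 \<and> (\<forall>t\<in>{0..1}. \<kappa> \<le> Re (c * (ker t y * ker t z)))"
    by (rule ker_sector[OF assms(3)]) blast
  obtain c where "\<forall>t\<in>{0..1}. \<kappa> \<le> Re (c * (ker t z)\<^sup>2)"
    using \<kappa>(2)[OF assms(3,4)] by (auto simp: power2_eq_square)
  then have "(1 / 2) ^ length w * \<kappa> \<le> Re (c * dG w s z)"
    using sq_kernel_average_dG[OF assms(1,2), of w, unfolded sq_kernel_average_def, rule_format] Re_less_slit[OF assms(3)] \<kappa>(1)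
    by simp
  moreover have "(1 / 2) ^ length w * \<kappa> > 0" using \<kappa>(1) by simp
  ultimately show False using 0 by simp
qed

lemma ball_Re_less: "z \<in> ball 0 1 \<Longrightarrow> Re z < 1"
  using complex_Re_le_cmod[of z] by simp

lemma ball_slit: "ball 0 1 \<subseteq> slit_plane"
  using ball_Re_less Re_less_slit by blast

text \<open>For \<open>Im z > 0\<close> the argument of \<open>ker t z\<close> increases from 0 at
  \<open>t = 0\<close> to that of \<open>1 / (1 - z)\<close> at \<open>t = 1\<close>. So the kernels
  and their squares lie in the respective cones, which are convex and hence contain the
  averages.\<close>

lemma G_dG_sectors:
  assumes s: "0 \<le> s" "s \<le> 1" and z: "Re z < 1" "Im z > 0"
  shows "\<exists>p q. p \<ge> 0 \<and> q \<ge> 0 \<and> G w s z = of_real p + of_real q * (1 / (1 - z))"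
    and "\<exists>p q. p \<ge> 0 \<and> q \<ge> 0 \<and> dG w s z = of_real p + of_real q * (1 / (1 - z))\<^sup>2"
    and "Re (1 / (1 - z)) > 0" "Im (1 / (1 - z)) > 0"
proof -
  define v where "v = 1 / (1 - z)"
  have zs: "z \<in> slit_plane" by (rule Re_less_slit[OF z(1)])
  have nz: "1 - z \<noteq> 0" using z by auto
  have np: "norm (1 - z) ^ 2 > 0" using nz by simp
  have v: "Re v > 0" "Im v > 0"
    unfolding v_def using z np by (auto simp: Re_divide Im_divide cmod_power2)
  show "Re (1 / (1 - z)) > 0" "Im (1 / (1 - z)) > 0" using v by (simp_all add: v_def)
  have k: "Im (ker t z) \<ge> 0" "Re (ker t z) \<ge> 0" "Im (ker t z * cnj v) \<le> 0" "Re (ker t z * cnj v) \<ge> 0"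
    if t: "t \<in> {0..1}" for t
  proof -
    have nt: "1 - of_real t * z \<noteq> 0" using slit_plane_nz[OF zs] t by auto
    have tz: "t * Re z < 1" using t z mult_left_mono[of "Re z" 1 t]
      by (cases "Re z \<le> 0") (auto simp: mult_nonneg_nonpos intro: le_less_trans[of _ 0] le_less_trans[OF mult_left_le_one_le])
    show "Im (ker t z) \<ge> 0" "Re (ker t z) \<ge> 0"
      unfolding ker_def using t z tz by (auto simp: Re_divide Im_divide)
    have "cnj (1 - of_real t * z) \<noteq> 0" "cnj (1 - z) \<noteq> 0" using nt nz complex_cnj_zero_iff by blast+
    then have nt': "1 - of_real t * cnj z \<noteq> 0" "1 - cnj z \<noteq> 0"
      by (simp_all only: complex_cnj_diff complex_cnj_mult complex_cnj_one complex_cnj_complex_of_real not_False_eq_True)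
    have "ker t z * cnj v = (1 - of_real t * cnj z) * (1 - z) / of_real (norm (1 - of_real t * z) ^ 2 * norm (1 - z) ^ 2)"
      unfolding ker_def v_def of_real_mult complex_norm_square using nt nz nt'
      by (simp add: divide_simps)
    moreover have "Im ((1 - of_real t * cnj z) * (1 - z)) = - ((1 - t) * Im z)" by (simp add: algebra_simps)
    moreover have "Re ((1 - of_real t * cnj z) * (1 - z)) = (1 - Re z) * (1 - t * Re z) + t * (Im z)\<^sup>2"
      by (simp add: algebra_simps power2_eq_square)
    moreover have "(1 - Re z) * (1 - t * Re z) + t * (Im z)\<^sup>2 \<ge> 0" "(1 - t) * Im z \<ge> 0" using t z tz by auto
    ultimately show "Im (ker t z * cnj v) \<le> 0" "Re (ker t z * cnj v) \<ge> 0"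
      by (simp_all add: Re_divide_of_real Im_divide_of_real divide_nonpos_nonneg del: of_real_mult of_real_power times_complex.sel)
  qed
  have r: "\<beta> + \<gamma> * mean w s \<le> Re (c1 * G w s z + c2 * G w s z)"
    if "\<forall>t\<in>{0..1}. \<beta> + \<gamma> * t \<le> Re (c1 * ker t z + c2 * ker t z)" for c1 c2 and \<beta> \<gamma> :: real
    by (rule kernel_average_G[OF s, unfolded kernel_average_def, rule_format, OF zs zs]) (use that in blast)
  have "Im (G w s z) \<ge> 0" using r[of 0 0 "- \<i>" 0] k by simp
  moreover have "Im (G w s z * cnj v) \<le> 0"
    using r[of 0 0 "\<i> * cnj v" 0] k by (simp add: algebra_simps)
  ultimately show "\<exists>p q. p \<ge> 0 \<and> q \<ge> 0 \<and> G w s z = of_real p + of_real q * (1 / (1 - z))"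
    using upper_sector[OF v(2)] unfolding v_def by metis
  have r2: "0 \<le> Re (c * dG w s z)" if "\<forall>t\<in>{0..1}. 0 \<le> Re (c * ker t z ^ 2)" for c
    using sq_kernel_average_dG[OF s, of w, unfolded sq_kernel_average_def, rule_format, OF zs, of 0 c] that by simp
  have "Im (dG w s z) \<ge> 0" using r2[of "- \<i>"] k by (simp add: power2_eq_square)
  moreover have "Im (dG w s z * cnj (v\<^sup>2)) \<le> 0"
  proof -
    have "0 \<le> Re (\<i> * cnj (v\<^sup>2) * ker t z ^ 2)" if t: "t \<in> {0..1}" for t
    proof -
      have "\<i> * cnj (v\<^sup>2) * ker t z ^ 2 = \<i> * (ker t z * cnj v) ^ 2" by (simp add: power_mult_distrib mult_ac)
      then have "Re (\<i> * cnj (v\<^sup>2) * ker t z ^ 2) = - 2 * (Re (ker t z * cnj v) * Im (ker t z * cnj v))"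
        by (simp add: power2_eq_square del: times_complex.sel) (simp add: algebra_simps)
      then show ?thesis using mult_nonneg_nonpos[OF k(4)[OF t] k(3)[OF t]] by linarith
    qed
    then have "0 \<le> Re (\<i> * cnj (v\<^sup>2) * dG w s z)" by (intro r2) blast
    also have "\<i> * cnj (v\<^sup>2) * dG w s z = \<i> * (dG w s z * cnj (v\<^sup>2))" by (simp only: ac_simps)
    finally show ?thesis by (simp del: complex_cnj_power times_complex.sel)
  qed
  moreover have "Im (v\<^sup>2) > 0" using v by (simp add: power2_eq_square)
  ultimately show "\<exists>p q. p \<ge> 0 \<and> q \<ge> 0 \<and> dG w s z = of_real p + of_real q * (1 / (1 - z))\<^sup>2"
    using upper_sector[of "v\<^sup>2" "dG w s z"] unfolding v_def by metis
qed

lemma quotient_facts: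
  assumes s: "0 \<le> s" "s \<le> 1" and z: "z \<in> ball 0 1" "Im z > 0"
  shows "Im (G w s z / dG w s z) > 0 \<Longrightarrow> Re (G w s z / dG w s z) > 0"
    and "Im (G w s z / dG w s z) \<le> 0 \<Longrightarrow> Re (G w s z / dG w s z / (1 - z)) \<ge> 0"
proof -
  have z1: "Re z < 1" "norm z \<le> 2" using z ball_Re_less by auto
  note S = G_dG_sectors[OF s z1(1) z(2)]
  obtain p1 p2 where P: "p1 \<ge> 0" "p2 \<ge> 0" "G w s z = of_real p1 + of_real p2 * (1 / (1 - z))" using S(1)[of w] by blast
  obtain d1 d2 where D: "d1 \<ge> 0" "d2 \<ge> 0" "dG w s z = of_real d1 + of_real d2 * (1 / (1 - z))\<^sup>2" using S(2)[of w] by blast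
  have nz: "dG w s z \<noteq> 0" by (rule dG_nz[OF s z1])
  define N where "N = norm (dG w s z) ^ 2"
  have N: "N > 0" using nz by (simp add: N_def)
  have q: "G w s z / dG w s z = G w s z * cnj (dG w s z) / of_real N"
    unfolding N_def complex_norm_square using nz by simp
  have q1: "Im (G w s z / dG w s z) = Im (G w s z * cnj (dG w s z)) / N"
    "Re (G w s z / dG w s z) = Re (G w s z * cnj (dG w s z)) / N" unfolding q
    by (simp_all only: Im_divide_of_real Re_divide_of_real)
  have "G w s z / dG w s z / (1 - z) = (1 / (1 - z)) * (G w s z * cnj (dG w s z)) / of_real N"
    unfolding q by simp
  then have q2: "Re (G w s z / dG w s z / (1 - z)) = Re ((1 / (1 - z)) * (G w s z * cnj (dG w s z))) / N"
    by (simp only: Re_divide_of_real)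
  note Q = sector_quotient[OF S(3,4) P D]
  show "Im (G w s z / dG w s z) > 0 \<Longrightarrow> Re (G w s z / dG w s z) > 0"
    using Q(1) N unfolding q1 by (simp only: zero_less_divide_iff) auto
  show "Im (G w s z / dG w s z) \<le> 0 \<Longrightarrow> Re (G w s z / dG w s z / (1 - z)) \<ge> 0"
    using Q(2) N unfolding q1 q2 by (simp only: divide_le_0_iff zero_le_divide_iff) auto
qed

text \<open>The cones settle the upper half of the disc, reflection gives the lower half, and on the
  diameter all quantities are real and nonnegative.\<close>

lemma quotient_nonneg:
  assumes s: "0 \<le> s" "s \<le> 1" and z: "z \<in> ball 0 1"
    and h: "\<And>z. z \<in> ball 0 1 \<Longrightarrow> Im z > 0 \<Longrightarrow> Im (G w s z / dG w s z) \<le> 0"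
  shows "Re (G w s z / dG w s z / (1 - z)) \<ge> 0"
proof -
  have zs: "z \<in> slit_plane" using z ball_slit by blast
  consider "Im z > 0" | "Im z < 0" | "Im z = 0" by linarith
  then show ?thesis
  proof cases
    case 1
    then show ?thesis using quotient_facts(2)[OF s z] h[OF z] by blast
  next
    case 2
    have "cnj z \<in> ball 0 1" "Im (cnj z) > 0" using z 2 by auto
    then have "Re (G w s (cnj z) / dG w s (cnj z) / (1 - cnj z)) \<ge> 0"
      using quotient_facts(2)[OF s, of "cnj z"] h[of "cnj z"] by blast
    moreover have "G w s (cnj z) / dG w s (cnj z) / (1 - cnj z) = cnj (G w s z / dG w s z / (1 - z))"
      using zs by (simp add: G_cnj dG_cnj)
    ultimately show ?thesis by (simp only: cnj.simps(1))
  next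
    case 3
    define x where "x = Re z"
    have zx: "z = of_real x" using 3 by (simp add: x_def complex_eq_iff)
    have x: "x < 1" using ball_Re_less[OF z] by (simp add: x_def)
    have kx: "ker t z = of_real (1 / (1 - t * x))" "1 / (1 - t * x) \<ge> 0" if t: "t \<in> {0..1}" for t
    proof -
      have "t * x \<le> 1" using t x mult_left_mono[of x 1 t] by auto
      then show "1 / (1 - t * x) \<ge> 0" by simp
    qed (simp add: ker_def zx)
    have "0 + 0 * mean w s \<le> Re (1 * G w s z + 0 * G w s z)"
      by (rule kernel_average_G[OF s, unfolded kernel_average_def, rule_format, OF zs zs]) (use kx in simp)
    then have G0: "Re (G w s z) \<ge> 0" by simp
    have "(1 / 2) ^ length w * 0 \<le> Re (1 * dG w s z)"
      by (rule sq_kernel_average_dG[OF s, of w, unfolded sq_kernel_average_def, rule_format, OF zs]) (use kx in \<open>simp_all flip: of_real_power\<close>)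
    then have dG0: "Re (dG w s z) \<ge> 0" by simp
    obtain p q where pq: "G w s z = of_real p" "dG w s z = of_real q"
      using G_real[OF zs 3] dG_real[OF zs 3] by (metis complex_is_Real_iff Reals_cases)
    have "G w s z / dG w s z / (1 - z) = of_real (p / q / (1 - x))"
      unfolding pq by (simp add: zx)
    moreover have "p \<ge> 0" "q \<ge> 0" using G0 dG0 by (simp_all add: pq)
    ultimately show ?thesis using x by (simp only: Re_complex_of_real) simp
  qed
qed

lemma deriv_ker:
  assumes "z \<in> slit_plane" "0 \<le> s" "s \<le> 1"
  shows "(ker s has_field_derivative of_real s * ker s z ^ 2) (at z)"
  unfolding ker_def[abs_def] using slit_plane_nz[OF assms]
  by (auto intro!: derivative_eq_intros simp: power2_eq_square)

text \<open>The statements are proved together because each step draws on the others: the ratio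
  needs the sign of \<open>Im (G / dG)\<close> for the shorter word, and that sign is inherited with
  the help of both parts of \<open>star_quot\<close> for the longer one. For the empty word the
  quotients are \<open>2 / (1 - s * z)\<close>, \<open>s\<close> and \<open>1 - s * z\<close>, so
  the bound \<open>s\<close> starts as an equality.\<close>

lemma disc_estimates:
  assumes s: "0 \<le> s" "s \<le> 1"
  shows "(\<forall>z\<in>ball 0 1. Re (star_quot (dG w s) z) > 1 \<and> s \<le> Re (deriv (G w s) z / dG w s z)
     \<and> (Im z > 0 \<longrightarrow> Im (star_quot (dG w s) z) \<ge> 0 \<and> Im (G w s z / dG w s z) \<le> 0))"
proof (induction w)
  case Nil
  show ?case
  proof (intro ballI conjI impI)
    fix z :: complex assume z: "z \<in> ball 0 1"
    have zs: "z \<in> slit_plane" using z ball_slit by blast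
    have nz: "1 - of_real s * z \<noteq> 0" using slit_plane_nz[OF zs s] .
    have knz: "ker s z \<noteq> 0" using nz by (simp add: ker_def)
    note k' = deriv_ker[OF zs s]
    have "((\<lambda>z. ker s z ^ 2) has_field_derivative 2 * (of_real s * ker s z ^ 2) * ker s z) (at z)"
      using k' by (auto intro!: derivative_eq_intros simp: power2_eq_square)
    then have "deriv (\<lambda>z. ker s z ^ 2) z = 2 * (of_real s * ker s z ^ 2) * ker s z" by (rule DERIV_imp_deriv)
    then have "star_quot (dG [] s) z = 2 + 2 * (of_real s * z) * ker s z"
      unfolding star_quot_def dG_Nil using knz by (simp add: field_simps power2_eq_square)
    also have "\<dots> = 2 * (1 / (1 - of_real s * z))"
      using nz by (simp add: ker_def field_simps)
    finally have star_quot: "star_quot (dG [] s) z = 2 * (1 / (1 - of_real s * z))" .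
    have "norm (of_real s * z) < 1" using s z mult_left_le_one_le[of "norm z" s] by (simp add: norm_mult)
    then have half: "Re (1 / (1 - of_real s * z)) > 1 / 2" by (rule Re_inverse_ball)
    have "Re (2 * x) = 2 * Re x" for x by simp
    then show "Re (star_quot (dG [] s) z) > 1" unfolding star_quot using half by (simp only:)
    show "s \<le> Re (deriv (G [] s) z / dG [] s z)"
      unfolding G_Nil dG_Nil DERIV_imp_deriv[OF k'] using knz by simp
    assume im: "Im z > 0"
    show "Im (star_quot (dG [] s) z) \<ge> 0" unfolding star_quot using im s by (simp add: Im_divide)
    have "G [] s z / dG [] s z = 1 - of_real s * z"
      unfolding G_Nil dG_Nil using nz by (simp add: ker_def power2_eq_square)
    then show "Im (G [] s z / dG [] s z) \<le> 0" using im s by simp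
  qed
next
  case (Cons b w)
  let ?P = "G (b # w) s" and ?g = "G w s" and ?d = "dG (b # w) s" and ?dg = "dG w s"
  note hol = holomorphic_on_subset[OF _ ball_slit]
  have d: "?d holomorphic_on ball 0 1" and dg: "?dg holomorphic_on ball 0 1"
    and P: "?P holomorphic_on ball 0 1" and g: "?g holomorphic_on ball 0 1"
    by (intro hol G_holo dG_holo s)+
  have nz: "dG w' s z \<noteq> 0" if "z \<in> ball 0 1" for z w'
    using dG_nz[OF s ball_Re_less[OF that]] that by simp
  have ode: "wt b z * (2 * ?d z + z * deriv ?d z) = ?dg z" if "z \<in> ball 0 1" for z
    using avg_op_ode[OF dG_holo[OF s], of 2 z b w] that ball_slit by (auto simp: dG_Cons)
  have odeP: "wt b z * (?P z + z * deriv ?P z) = ?g z" if "z \<in> ball 0 1" for z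
    using avg_op_ode[OF G_holo[OF s], of 1 z b w] that ball_slit by (auto simp: G_Cons)
  have sgd: "Re (star_quot ?d z) > 1" if "z \<in> ball 0 1" for z
    by (rule starlike_step[OF d dg nz ode _ that nz[OF that]]) (use Cons.IH in auto)
  have Im0: "Im (x / y) = 0" if "Im x = 0" "Im y = 0" for x y using that by (simp add: Im_divide)
  have Im0': "Im (x * y) = 0" if "Im x = 0" "Im y = 0" for x y using that by simp
  have real1: "Im (star_quot ?d z) = 0" if z: "z \<in> ball 0 1" "Im z = 0" for z
  proof -
    have zs: "z \<in> slit_plane" using z ball_slit by blast
    have "2 * ?d z + z * deriv ?d z = ?dg z / wt b z" using ode[OF z(1)] ball_wt_nz[OF z(1), of b] by (simp add: field_simps)
    then have "star_quot ?d z = ?dg z / wt b z / ?d z" by (simp add: star_quot_def)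
    moreover have "Im (wt b z) = 0" using z by (simp add: wt_def)
    ultimately show ?thesis using dG_real[OF zs z(2)] by (simp only: Im0)
  qed
  have sgi: "Im (star_quot ?d z) \<ge> 0" if "z \<in> ball 0 1" "Im z > 0" for z
    by (rule Im_star_quot_step[OF d dg nz nz ode sgd real1 _ that]) (use Cons.IH in auto)
  have real2: "Im (?P z / ?d z) = 0" if z: "z \<in> ball 0 1" "Im z = 0" for z
    using G_real dG_real z ball_slit by (intro Im0) blast+
  have quo: "Im (?P z / ?d z) \<le> 0" if "z \<in> ball 0 1" "Im z > 0" for z
    by (rule Im_quotient_step[OF d dg P nz nz ode odeP sgd sgi real2 quotient_facts(1)[OF s] _ that])
      (use Cons.IH in auto)
  have "s \<le> Re (deriv ?P z / ?d z)" if "z \<in> ball 0 1" for z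
  proof (rule Re_ratio_step[OF d dg P g nz nz ode odeP sgd _ _ that])
    show "Re (?g z / ?dg z / (1 - z)) \<ge> 0" if "z \<in> ball 0 1" for z
      by (rule quotient_nonneg[OF s that]) (use Cons.IH in auto)
  qed (use Cons.IH in auto)
  then show ?case using sgd sgi quo by blast
qed

lemma Re_less_1: "norm z \<le> 1 \<Longrightarrow> z \<noteq> 1 \<Longrightarrow> Re z < 1"
proof (rule ccontr)
  assume z: "norm z \<le> 1" "z \<noteq> 1" "\<not> Re z < 1"
  then have "Re z = 1" using complex_Re_le_cmod[of z] by simp
  moreover then have "norm z = 1" using complex_Re_le_cmod[of z] z by simp
  ultimately have "(Im z)\<^sup>2 = 0" using cmod_power2[of z] by simp
  then show False using \<open>Re z = 1\<close> z(2) by (simp add: complex_eq_iff)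
qed

text \<open>The quotient is continuous at boundary points other than 1, so the bound passes radially
  to the circle. Mere positivity would not survive this limit, whereas the bound \<open>s\<close>
  does.\<close>

lemma ratio_bound:
  assumes s: "0 \<le> s" "s \<le> 1" and z: "norm z \<le> 1" "z \<noteq> 1"
  shows "s \<le> Re (deriv (G w s) z / dG w s z)"
proof -
  have Re: "Re z < 1" by (rule Re_less_1[OF z])
  let ?r = "\<lambda>z. deriv (G w s) z / dG w s z"
  have zs: "z \<in> slit_plane" by (rule Re_less_slit[OF Re])
  have "isCont (deriv (G w s)) z" "isCont (dG w s) z"
    using holomorphic_deriv[OF G_holo[OF s] open_slit_plane] dG_holo[OF s] zs open_slit_plane
      holomorphic_on_imp_continuous_on continuous_on_eq_continuous_at by blast+
  then have "isCont ?r z" using dG_nz[OF s Re] z by (intro continuous_intros) auto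
  then have "((\<lambda>x. ?r (of_real x * z)) \<longlongrightarrow> ?r (of_real 1 * z)) (at_left 1)"
    by (intro isCont_tendsto_compose[of _ ?r] tendsto_intros) simp
  then have lim: "((\<lambda>x. Re (?r (of_real x * z))) \<longlongrightarrow> Re (?r z)) (at_left 1)"
    using tendsto_Re by fastforce
  have "\<forall>\<^sub>F x in at_left (1::real). 0 < x" 
    by (rule eventually_at_leftI[of 0]) auto
  moreover have "\<forall>\<^sub>F x in at_left (1::real). x < 1" by (rule eventually_at_leftI[of 0]) auto
  ultimately have "\<forall>\<^sub>F x in at_left 1. s \<le> Re (?r (of_real x * z))"
  proof eventually_elim
    case (elim x)
    have "norm (of_real x * z) \<le> x * 1" unfolding norm_mult using elim z by (intro mult_mono) auto
    then have "of_real x * z \<in> ball 0 1" using elim by simp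
    then show ?case using disc_estimates[OF s, of w] by blast
  qed
  then show ?thesis by (rule tendsto_lowerbound[OF lim]) simp
qed

section \<open>Motion of the roots\<close>

lemma kbound_compact:
  assumes "compact K" "K \<subseteq> slit_plane"
  obtains m where "\<And>z. z \<in> K \<Longrightarrow> kbound z m"
proof -
  have "continuous_on ({0..1} \<times> K) (\<lambda>x. ker (fst x) (snd x))"
    unfolding ker_def
  proof (intro continuous_intros ballI)
    fix x :: "real \<times> complex" assume "x \<in> {0..1} \<times> K"
    then have "snd x \<in> slit_plane" "0 \<le> fst x" "fst x \<le> 1" using assms(2) by auto
    then show "1 - of_real (fst x) * snd x \<noteq> 0" by (rule slit_plane_nz)
  qed
  then have "compact ((\<lambda>x. ker (fst x) (snd x)) ` ({0..1} \<times> K))"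
    by (intro compact_continuous_image compact_Times assms) auto
  from compact_imp_bounded[OF this]
  obtain m where m: "\<forall>x \<in> {0..1} \<times> K. norm (ker (fst x) (snd x)) \<le> m"
    unfolding bounded_iff by auto
  have "kbound z m" if "z \<in> K" for z
    unfolding kbound_def using bspec[OF m, of "(_, z)"] that by simp
  then show ?thesis by (rule that)
qed

text \<open>If \<open>G w s z = G w s0 z0\<close> then to first order \<open>z - z0 = - (s - s0) z0 / r\<close> with
  \<open>r = deriv (G w s0) z0 / dG w s0 z0\<close>, and \<open>Re r > 0\<close> decides whether \<open>norm z\<close> grows.\<close>

lemma root_moves:
  assumes s0: "0 < s0" "s0 \<le> 1" and z0: "norm z0 \<le> 1" "z0 \<noteq> 1" "z0 \<noteq> 0" and \<delta>: "\<delta> > 0"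
  obtains \<epsilon> where "\<epsilon> > 0" "\<And>s. 0 \<le> s \<Longrightarrow> s \<le> 1 \<Longrightarrow> s \<noteq> s0 \<Longrightarrow> \<bar>s - s0\<bar> < \<epsilon> \<Longrightarrow>
     \<exists>z\<in>ball z0 \<delta>. Re z < 1 \<and> G w s z = G w s0 z0 \<and>
       (s0 < s \<longrightarrow> norm z < norm z0) \<and> (s < s0 \<longrightarrow> norm z0 < norm z)"
proof -
  have s0': "0 \<le> s0" "s0 \<le> 1" using s0 by auto
  have Re0: "Re z0 < 1" by (rule Re_less_1[OF z0(1,2)])
  define F where "F = G w s0"
  define P D where "P = deriv F z0" and "D = dG w s0 z0"
  have Dnz: "D \<noteq> 0" unfolding D_def using dG_nz[OF s0' Re0] z0 by simp
  define r where "r = P / D"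
  have r: "Re r > 0" using ratio_bound[OF s0' z0(1,2), of w] s0 by (simp add: r_def P_def D_def F_def)
  then have rnz: "r \<noteq> 0" by auto
  then have Pnz: "P \<noteq> 0" by (auto simp: r_def)
  define \<kappa> where "\<kappa> = Re (1 / r)"
  have \<kappa>: "\<kappa> > 0" using r rnz unfolding \<kappa>_def by (simp add: Re_divide sum_power2_gt_zero_iff complex_eq_iff)
  \<comment> \<open>When the parameter changes by \<open>h\<close>, to first order
    \<open>norm z\<close> is multiplied by \<open>1 - h * \<kappa>\<close>. The root is sought
    within \<open>\<bar>h\<bar> * \<xi>\<close> of the linear prediction \<open>z0 - h * q\<close>;
    an error of a quarter of the predicted change of norm cannot reverse its sign.\<close>
  define \<xi> where "\<xi> = min 1 (norm z0 * \<kappa> / 4)"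
  have \<xi>: "\<xi> > 0" "\<xi> \<le> 1" "\<xi> \<le> norm z0 * \<kappa> / 4" using \<kappa> z0 by (auto simp: \<xi>_def)
  define q where "q = z0 / r"
  have qP: "P * q = z0 * D" using rnz Dnz by (simp add: q_def r_def)
  define B where "B = norm q + 1"
  have B: "B > 0" by (simp add: B_def add_nonneg_pos)
  define e where "e = norm P * \<xi> / (8 * B)"
  have e: "e > 0" using Pnz \<xi> B by (simp add: e_def)
  have zs: "z0 \<in> slit_plane" by (rule Re_less_slit[OF Re0])
  have Fd: "(F has_derivative (*) P) (at z0)"
    unfolding P_def F_def using holomorphic_derivI[OF G_holo[OF s0'] open_slit_plane zs]
    by (simp add: has_field_derivative_def)
  obtain \<delta>1 where \<delta>1: "\<delta>1 > 0" "\<And>y. norm (y - z0) < \<delta>1 \<Longrightarrow> norm (F y - F z0 - P * (y - z0)) \<le> e * norm (y - z0)"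
    using Fd e unfolding has_derivative_at_alt by blast
  have "isCont (\<lambda>y. y * dG w s0 y) z0"
    using dG_holo[OF s0'] zs open_slit_plane
      holomorphic_on_imp_continuous_on continuous_on_eq_continuous_at by (intro continuous_intros) blast+
  then obtain \<delta>2 where \<delta>2: "\<delta>2 > 0" "\<And>y. dist y z0 < \<delta>2 \<Longrightarrow> dist (y * dG w s0 y) (z0 * D) < norm P * \<xi> / 8"
    unfolding continuous_at_eps_delta D_def using Pnz \<xi> by (metis divide_pos_pos mult_pos_pos zero_less_norm_iff zero_less_numeral)
  have "open ({z. Re z < 1} \<inter> ball z0 \<delta>)" "z0 \<in> {z. Re z < 1} \<inter> ball z0 \<delta>"
    using Re0 \<delta> by (auto intro: open_halfspace_Re_lt)
  then obtain \<delta>3 where \<delta>3: "\<delta>3 > 0" "cball z0 \<delta>3 \<subseteq> {z. Re z < 1} \<inter> ball z0 \<delta>"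
    using open_contains_cball by blast
  then have K: "cball z0 \<delta>3 \<subseteq> slit_plane" using Re_less_slit by blast
  obtain m where m: "\<And>z. z \<in> cball z0 \<delta>3 \<Longrightarrow> kbound z m" using kbound_compact[OF compact_cball K] by blast
  have m1: "m \<ge> 1" using m[of z0] kbound_ge1 \<delta>3(1) by simp
  define L where "L = (norm z0 + \<delta>3)\<^sup>2 * m ^ 3"
  have L: "L > 0" unfolding L_def using m1 \<delta>3(1) by (intro mult_pos_pos zero_less_power) (auto intro: add_nonneg_pos)
  \<comment> \<open>In this order the bounds ensure that \<open>F\<close> is close to its
    linearisation, that \<open>z * dG w s0 z\<close> is nearly constant, that the search disc stays
    in the domain, that the remainder of \<open>G_expand\<close> is small, and that the quadratic
    term of \<open>norm (1 - h / r) ^ 2\<close> is dominated by the linear one.\<close>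
  define \<epsilon> where "\<epsilon> = Min {\<delta>1 / (2 * B), \<delta>2 / (2 * B), \<delta>3 / (2 * B), norm P * \<xi> / (8 * L), \<kappa> * norm r ^ 2}"
  have \<epsilon>0: "\<epsilon> > 0" unfolding \<epsilon>_def using \<delta>1(1) \<delta>2(1) \<delta>3(1) B Pnz \<xi> L \<kappa> rnz by simp
  have \<epsilon>le: "\<epsilon> \<le> \<delta>1 / (2 * B)" "\<epsilon> \<le> \<delta>2 / (2 * B)" "\<epsilon> \<le> \<delta>3 / (2 * B)" "\<epsilon> \<le> norm P * \<xi> / (8 * L)" "\<epsilon> \<le> \<kappa> * norm r ^ 2"
    unfolding \<epsilon>_def by (intro Min_le; simp)+
  have "\<exists>z\<in>ball z0 \<delta>. Re z < 1 \<and> G w s z = G w s0 z0 \<and>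
       (s0 < s \<longrightarrow> norm z < norm z0) \<and> (s < s0 \<longrightarrow> norm z0 < norm z)"
    if s: "0 \<le> s" "s \<le> 1" "s \<noteq> s0" "\<bar>s - s0\<bar> < \<epsilon>" for s
  proof -
    define h where "h = s - s0"
    have h: "h \<noteq> 0" "\<bar>h\<bar> < \<epsilon>" using s by (auto simp: h_def)
    have hB: "\<bar>h\<bar> * B < \<delta>1" "\<bar>h\<bar> * B < \<delta>2" "\<bar>h\<bar> * B < \<delta>3"
    proof -
      have "\<bar>h\<bar> * (2 * B) < \<delta>1" "\<bar>h\<bar> * (2 * B) < \<delta>2" "\<bar>h\<bar> * (2 * B) < \<delta>3"
        using h(2) \<epsilon>le(1-3) B by (auto simp: pos_le_divide_eq intro: less_le_trans[OF mult_strict_right_mono])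
      moreover have "\<bar>h\<bar> * B \<ge> 0" using B by simp
      ultimately show "\<bar>h\<bar> * B < \<delta>1" "\<bar>h\<bar> * B < \<delta>2" "\<bar>h\<bar> * B < \<delta>3" by linarith+
    qed
    define zc where "zc = z0 - of_real h * q"
    define H where "H z = G w s z - F z0" for z
    have near: "norm (z - z0) \<le> \<bar>h\<bar> * B" if "norm (zc - z) \<le> \<bar>h\<bar> * \<xi>" for z
    proof -
      have "z - z0 = (z - zc) - of_real h * q" by (simp add: zc_def)
      then have "norm (z - z0) \<le> norm (zc - z) + \<bar>h\<bar> * norm q"
        using norm_triangle_ineq4[of "z - zc" "of_real h * q"] by (simp only: norm_mult norm_of_real norm_minus_commute)
      also have "\<dots> \<le> \<bar>h\<bar> * 1 + \<bar>h\<bar> * norm q" using that \<xi>(2) mult_left_mono[of \<xi> 1 "\<bar>h\<bar>"] by linarith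
      finally show ?thesis by (simp add: B_def algebra_simps)
    qed
    have in3: "z \<in> cball z0 \<delta>3" if "norm (zc - z) \<le> \<bar>h\<bar> * \<xi>" for z
      using near[OF that] hB(3) by (simp add: dist_norm norm_minus_commute)
    \<comment> \<open>Three errors of at most \<open>\<bar>h\<bar> * (norm P * \<xi> / 8)\<close>
      each: the remainder in the parameter, the linearisation in \<open>z\<close>, and the variation
      of \<open>z * dG w s0 z\<close>. Their sum is less than half the modulus of the linear part on
      the circle about \<open>zc\<close>, as the minimum modulus argument below requires.\<close>
    have est: "norm (H z - of_real h * P * ((z - zc) / of_real h)) \<le> \<bar>h\<bar> * (3 * (norm P * \<xi> / 8))"
      if z: "norm (zc - z) \<le> \<bar>h\<bar> * \<xi>" for z
    proof -
      have zsl: "z \<in> slit_plane" and kb: "kbound z m" using in3[OF z] K m by blast+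
      have "norm z \<le> norm z0 + \<delta>3" using in3[OF z] norm_triangle_sub[of z z0] by (simp add: dist_norm norm_minus_commute)
      then have "norm z ^ 2 * m ^ 3 \<le> L" unfolding L_def using m1 by (intro mult_right_mono power_mono) auto
      then have "(s - s0)\<^sup>2 * (norm z ^ 2 * m ^ 3) \<le> (s - s0)\<^sup>2 * L" by (intro mult_left_mono) auto
      with G_expand[OF s(1,2) s0' zsl kb, of w]
      have b1: "norm (G w s z - F z - of_real h * z * dG w s0 z) \<le> h\<^sup>2 * L" by (simp add: F_def h_def mult.assoc)
      have "\<bar>h\<bar> * L \<le> norm P * \<xi> / 8"
      proof -
        have "\<bar>h\<bar> \<le> norm P * \<xi> / (8 * L)" using h(2) \<epsilon>le(4) by linarith
        then have "\<bar>h\<bar> * (8 * L) \<le> norm P * \<xi>" using L by (simp add: pos_le_divide_eq)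
        then show ?thesis by (simp add: mult.left_commute[of _ 8])
      qed
      then have b2: "h\<^sup>2 * L \<le> \<bar>h\<bar> * (norm P * \<xi> / 8)"
        using mult_left_mono[of "\<bar>h\<bar> * L" "norm P * \<xi> / 8" "\<bar>h\<bar>"] by (simp add: power2_eq_square abs_mult_self mult.assoc[symmetric])
      have n: "norm (z - z0) < \<delta>1" "dist z z0 < \<delta>2" using near[OF z] hB by (auto simp: dist_norm)
      have "norm (F z - F z0 - P * (z - z0)) \<le> e * norm (z - z0)" by (rule \<delta>1(2)[OF n(1)])
      also have "\<dots> \<le> e * (\<bar>h\<bar> * B)" using near[OF z] e by (intro mult_left_mono) auto
      also have "\<dots> = \<bar>h\<bar> * (norm P * \<xi> / 8)" using B by (simp add: e_def)
      finally have b3: "norm (F z - F z0 - P * (z - z0)) \<le> \<bar>h\<bar> * (norm P * \<xi> / 8)" .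
      have "norm (of_real h * (z * dG w s0 z - z0 * D)) = \<bar>h\<bar> * norm (z * dG w s0 z - z0 * D)" by (simp add: norm_mult)
      also have "\<dots> \<le> \<bar>h\<bar> * (norm P * \<xi> / 8)"
        using \<delta>2(2)[OF n(2)] by (intro mult_left_mono) (auto simp: dist_norm)
      finally have b4: "norm (of_real h * (z * dG w s0 z - z0 * D)) \<le> \<bar>h\<bar> * (norm P * \<xi> / 8)" .
      have "H z - of_real h * P * ((z - zc) / of_real h) =
          (G w s z - F z - of_real h * z * dG w s0 z) + ((F z - F z0 - P * (z - z0)) + of_real h * (z * dG w s0 z - z0 * D))"
      proof -
        have "of_real h * P * ((z - zc) / of_real h) = P * (z - z0) + of_real h * (P * q)"
        proof -
          have "of_real h * P * ((z - zc) / of_real h) = P * (z - zc)" using h(1) by simp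
          then show ?thesis by (simp add: zc_def algebra_simps)
        qed
        then show ?thesis unfolding qP H_def by (simp add: algebra_simps)
      qed
      moreover have "\<bar>h\<bar> * (norm P * \<xi> / 8) + (\<bar>h\<bar> * (norm P * \<xi> / 8) + \<bar>h\<bar> * (norm P * \<xi> / 8)) = \<bar>h\<bar> * (3 * (norm P * \<xi> / 8))"
        by simp
      ultimately show ?thesis
        using norm_triangle_mono[OF order_trans[OF b1 b2] norm_triangle_mono[OF b3 b4]] by (simp only:)
    qed
    obtain z where z: "z \<in> ball zc (\<bar>h\<bar> * \<xi>)" "H z = 0"
    proof (rule holomorphic_contract_to_zero[of zc "\<bar>h\<bar> * \<xi>" H])
      have sub: "cball zc (\<bar>h\<bar> * \<xi>) \<subseteq> slit_plane" using in3 K by (auto simp: dist_norm)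
      have Hh: "H holomorphic_on slit_plane" unfolding H_def by (intro holomorphic_intros G_holo s)
      show "continuous_on (cball zc (\<bar>h\<bar> * \<xi>)) H"
        using holomorphic_on_imp_continuous_on[OF Hh] sub continuous_on_subset by blast
      show "H holomorphic_on ball zc (\<bar>h\<bar> * \<xi>)" using Hh sub ball_subset_cball holomorphic_on_subset by blast
      show "0 < \<bar>h\<bar> * \<xi>" using h \<xi> by simp
      fix z assume z: "norm (zc - z) = \<bar>h\<bar> * \<xi>"
      have A: "norm (H zc) \<le> \<bar>h\<bar> * (3 * (norm P * \<xi> / 8))" using est[of zc] \<xi> by simp
      have "norm (of_real h * P * ((z - zc) / of_real h)) = norm P * (\<bar>h\<bar> * \<xi>)"
        using h z by (simp add: norm_mult norm_divide norm_minus_commute)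
      then have "norm P * (\<bar>h\<bar> * \<xi>) \<le> norm (H z) + \<bar>h\<bar> * (3 * (norm P * \<xi> / 8))"
        using est[of z] z norm_triangle_sub[of "of_real h * P * ((z - zc) / of_real h)" "H z"]
        by (simp add: norm_minus_commute)
      moreover have "\<bar>h\<bar> * (norm P * \<xi>) > 0" using h Pnz \<xi> by simp
      ultimately show "norm (H zc) < norm (H z)" using A by (simp add: algebra_simps)
    qed blast
    have dz: "norm (z - zc) < \<bar>h\<bar> * \<xi>" using z(1) by (simp add: dist_norm norm_minus_commute)
    have "z \<in> cball z0 \<delta>3" by (rule in3) (use z(1) in \<open>simp add: dist_norm\<close>)
    then have zin: "z \<in> ball z0 \<delta>" "Re z < 1" using \<delta>3(2) by auto
    have zc: "zc = z0 * (1 - of_real h / r)" by (simp add: zc_def q_def algebra_simps)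
    have hxi: "\<bar>h\<bar> * \<xi> \<le> norm z0 * (\<bar>h\<bar> * \<kappa> / 4)" using mult_left_mono[OF \<xi>(3), of "\<bar>h\<bar>"] by (simp add: mult_ac)
    have Rh: "Re (of_real h / r) = h * \<kappa>"
    proof -
      have "of_real h / r = of_real h * (1 / r)" by simp
      then show ?thesis unfolding \<kappa>_def by (simp only: times_complex.sel(1) Re_complex_of_real Im_complex_of_real mult_zero_left diff_zero)
    qed
    have up: "norm z < norm z0" if "s0 < s"
    proof -
      have hp: "h > 0" using that by (simp add: h_def)
      define x where "x = norm (1 - of_real h / r)"
      have "x\<^sup>2 = (Re (1 - of_real h / r))\<^sup>2 + (Im (1 - of_real h / r))\<^sup>2" unfolding x_def by (rule cmod_power2)
      also have "\<dots> = 1 - 2 * Re (of_real h / r) + ((Re (of_real h / r))\<^sup>2 + (Im (of_real h / r))\<^sup>2)"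
        by (simp only: minus_complex.sel one_complex.sel) (simp add: power2_eq_square algebra_simps)
      also have "\<dots> = 1 - 2 * (h * \<kappa>) + h\<^sup>2 / norm r ^ 2"
        unfolding cmod_power2[symmetric] by (simp add: Rh norm_divide power_divide)
      finally have x2: "x\<^sup>2 = 1 - 2 * (h * \<kappa>) + h\<^sup>2 / norm r ^ 2" .
      have "h < \<kappa> * norm r ^ 2" using h(2) hp \<epsilon>le(5) by simp
      then have "h / norm r ^ 2 < \<kappa>" using rnz by (simp add: divide_less_eq)
      then have "h * (h / norm r ^ 2) < h * \<kappa>" using hp by (intro mult_strict_left_mono)
      moreover have "h * (h / norm r ^ 2) = h\<^sup>2 / norm r ^ 2" by (simp add: power2_eq_square)
      ultimately have "x\<^sup>2 < 1 - h * \<kappa>" unfolding x2 by linarith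
      moreover have "2 * x \<le> 1 + x\<^sup>2" using zero_le_power2[of "x - 1"] by (simp add: power2_eq_square algebra_simps)
      ultimately have xl: "x < 1 - h * \<kappa> / 2" by simp
      have "norm z \<le> norm (z - zc) + norm zc" using norm_triangle_ineq[of "z - zc" zc] by simp
      also have "\<dots> < norm z0 * (h * \<kappa> / 4) + norm z0 * x"
      proof -
        have "norm zc = norm z0 * x" unfolding zc norm_mult x_def ..
        moreover have "norm (z - zc) < norm z0 * (h * \<kappa> / 4)"
          using less_le_trans[OF dz hxi] unfolding abs_of_pos[OF hp] .
        ultimately show ?thesis by linarith
      qed
      also have "\<dots> \<le> norm z0 * (h * \<kappa> / 4) + norm z0 * (1 - h * \<kappa> / 2)"
        using xl by (intro add_left_mono mult_left_mono) auto
      also have "\<dots> = norm z0 * (1 - h * \<kappa> / 4)" by (simp add: algebra_simps)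
      also have "\<dots> \<le> norm z0" using hp \<kappa> by (simp add: mult_left_le)
      finally show ?thesis .
    qed
    have down: "norm z0 < norm z" if "s < s0"
    proof -
      have hn: "h < 0" using that by (simp add: h_def)
      have "1 - h * \<kappa> = Re (1 - of_real h / r)" using Rh by simp
      also have "\<dots> \<le> norm (1 - of_real h / r)" by (rule complex_Re_le_cmod)
      \<comment> \<open>For \<open>h < 0\<close> the real part alone bounds the modulus from below,
        so the outward motion is seen without the quadratic term.\<close>
      finally have "norm z0 * (1 - h * \<kappa>) \<le> norm zc" unfolding zc norm_mult by (intro mult_left_mono) auto
      moreover have "norm zc \<le> norm z + norm (z - zc)" using norm_triangle_sub[of zc z] by (simp add: norm_minus_commute)
      moreover have "norm (z - zc) < norm z0 * (- h * \<kappa> / 4)"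
        using less_le_trans[OF dz hxi] unfolding abs_of_neg[OF hn] .
      moreover have "norm z0 * (h * \<kappa>) < 0" using z0(3) hn \<kappa> by (simp add: mult_less_0_iff)
      ultimately show ?thesis by (simp add: algebra_simps)
    qed
    show ?thesis using zin z(2) up down by (intro bexI[of _ z]) (auto simp: H_def F_def)
  qed
  then show ?thesis by (rule that[OF \<epsilon>0])
qed

section \<open>Identification of the multiple series\<close>

text \<open>The coefficient of \<open>z ^ n\<close>, thus the contribution of
  \<open>n\<^sub>1 = n + 1\<close>. The empty index stands for the constant function 1; its partial
  sums are all 1, so an innermost entry gets numerator 1.\<close>

fun series_coeff :: "nat list \<Rightarrow> nat \<Rightarrow> real" where
  "series_coeff [] n = (if n = 0 then 1 else 0)"
| "series_coeff (k # ks) n = (\<Sum>m\<le>n. series_coeff ks m) / real (Suc n) ^ k"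

text \<open>Coefficients are compared in \<open>wt b z * (P z + z * P' z) = f z\<close>: passing
  from \<open>P\<close> to \<open>P + z * P'\<close> multiplies the coefficient of
  \<open>z ^ n\<close> by \<open>n + 1\<close>, and dividing by \<open>1 - z\<close> forms partial
  sums.\<close>

lemma avg_op_power_series:
  assumes f: "f holomorphic_on slit_plane"
    and a: "\<And>z. z \<in> ball 0 1 \<Longrightarrow> (\<lambda>n. a n * z ^ n) sums f z"
    and z: "z \<in> ball 0 1"
  shows "(\<lambda>n. (if b then \<Sum>m\<le>n. a m else a n) / of_nat (Suc n) * z ^ n) sums avg_op b 1 f z"
proof -
  let ?P = "avg_op b 1 f"
  have P: "?P holomorphic_on slit_plane" by (rule avg_op_holo[OF f]) simp
  have ev: "\<forall>\<^sub>F z in nhds 0. z \<in> ball (0 :: complex) 1"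
    by (intro eventually_nhds_in_open) auto
  define F where "F = Abs_fps a"
  define Q where "Q = fps_expansion ?P 0"
  have F: "f has_fps_expansion F"
    by (rule has_fps_expansionI) (use ev a in \<open>auto simp: F_def elim!: eventually_mono\<close>)
  have Q: "?P has_fps_expansion Q"
    unfolding Q_def by (rule has_fps_expansion_fps_expansion[OF open_slit_plane _ P]) simp
  have W: "wt b has_fps_expansion (if b then 1 - fps_X else 1)"
    unfolding wt_def[abs_def] by (cases b) (auto intro!: fps_expansion_intros)
  have "(\<lambda>z. wt b z * (?P z + z * deriv ?P z)) has_fps_expansion
      (if b then 1 - fps_X else 1) * (Q + fps_X * fps_deriv Q)"
    by (intro fps_expansion_intros W Q)
  moreover have evw: "\<forall>\<^sub>F z in nhds 0. wt b z * (?P z + z * deriv ?P z) = f z"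
    using ev by eventually_elim (use avg_op_ode[OF f, of 1 _ b] ball_slit in auto)
  ultimately have "f has_fps_expansion (if b then 1 - fps_X else 1) * (Q + fps_X * fps_deriv Q)"
    using has_fps_expansion_cong[OF evw refl, THEN iffD1] by blast
  then have eq: "F = (if b then 1 - fps_X else 1) * (Q + fps_X * fps_deriv Q)"
    using F fps_expansion_unique_complex by blast
  define R where "R = Q + fps_X * fps_deriv Q"
  have R: "fps_nth R n = of_nat (Suc n) * fps_nth Q n" for n
    by (cases n) (simp_all add: R_def algebra_simps)
  have RF: "fps_nth R n = (if b then \<Sum>m\<le>n. a m else a n)" for n
  proof (cases b)
    case True
    then have "F = R - fps_X * R" using eq by (simp add: R_def algebra_simps)
    then have *: "a n = fps_nth (R - fps_X * R) n" for n by (metis F_def fps_nth_Abs_fps)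
    have "fps_nth R n = (\<Sum>m\<le>n. a m)"
    proof (induction n)
      case 0
      show ?case using *[of 0] by simp
    next
      case (Suc n)
      show ?case using *[of "Suc n"] Suc by simp
    qed
    then show ?thesis using True by simp
  next
    case False
    then have "F = R" using eq by (simp add: R_def)
    then show ?thesis using False by (metis F_def fps_nth_Abs_fps)
  qed
  have "fps_nth Q n = (if b then \<Sum>m\<le>n. a m else a n) / of_nat (Suc n)" for n
    using R[of n] RF[of n] by (simp add: field_simps del: of_nat_Suc)
  moreover have "(\<lambda>n. fps_nth Q n * z ^ n) sums ?P z"
    using holomorphic_power_series[OF holomorphic_on_subset[OF P ball_slit] z]
    by (simp add: Q_def fps_expansion_def)
  ultimately show ?thesis by simp
qed

definition index_word :: "nat list \<Rightarrow> bool list" where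
  "index_word ks = concat (map (\<lambda>k. replicate (k - 1) False @ [True]) ks)"

lemma G_append: "G (v @ w) s = word 1 v (G w s)"
  by (simp add: G_def word_append)

lemma G_power_series:
  assumes "\<And>k. k \<in> set ks \<Longrightarrow> k \<ge> 1" "z \<in> ball 0 1"
  shows "(\<lambda>n. of_real (series_coeff ks n) * z ^ n) sums G (index_word ks) 0 z"
  using assms
proof (induction ks arbitrary: z)
  case Nil
  have "(\<lambda>n. of_real (series_coeff [] n) * z ^ n) sums (\<Sum>n\<in>{0}. of_real (series_coeff [] n) * z ^ n)"
    by (rule sums_finite) auto
  then show ?case by (simp add: index_word_def G_Nil ker_def)
next
  case (Cons k ks)
  let ?g = "G (True # index_word ks) 0"
  have hg: "?g holomorphic_on slit_plane" "G (index_word ks) 0 holomorphic_on slit_plane" by (intro G_holo; simp)+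
  have IH: "\<And>z. z \<in> ball 0 1 \<Longrightarrow> (\<lambda>n. of_real (series_coeff ks n) * z ^ n) sums G (index_word ks) 0 z"
    using Cons by auto
  have base: "(\<lambda>n. of_real (series_coeff (1 # ks) n) * z ^ n) sums ?g z" if "z \<in> ball 0 1" for z
    using avg_op_power_series[OF hg(2) IH that, of True] by (simp add: G_Cons)
  have "(\<lambda>n. of_real (series_coeff (Suc j # ks) n) * z ^ n) sums word 1 (replicate j False) ?g z"
    if "z \<in> ball 0 1" for j z
    using that
  proof (induction j arbitrary: z)
    case 0
    then show ?case using base by simp
  next
    case (Suc j)
    have h: "word 1 (replicate j False) ?g holomorphic_on slit_plane" by (intro word_holo hg) simp
    have "series_coeff (Suc (Suc j) # ks) n = series_coeff (Suc j # ks) n / real (Suc n)" for n by simp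
    then show ?case
      using avg_op_power_series[OF h Suc.IH Suc.prems, of False] by (simp del: series_coeff.simps(2) of_nat_Suc)
  qed
  from this[OF Cons.prems(2), of "k - 1"] show ?case
    using Cons.prems(1)[of k] by (simp add: index_word_def G_append del: series_coeff.simps(2))
qed

section \<open>Multiple sums over decreasing tuples\<close>

definition bounded_tuples :: "nat \<Rightarrow> nat \<Rightarrow> nat list set" where
  "bounded_tuples r N = {ns \<in> decr_tuples r. \<forall>n\<in>set ns. n \<le> N}"

definition tuple_weight :: "nat list \<Rightarrow> nat list \<Rightarrow> real" where
  "tuple_weight ks ns = (\<Prod>i<length ks. 1 / real (ns ! i) ^ (ks ! i))"

lemma tuple_weight_Cons: "tuple_weight (k # ks) (n # ns) = tuple_weight ks ns / real n ^ k"
  by (simp add: tuple_weight_def prod.lessThan_Suc_shift del: prod.lessThan_Suc)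

lemma tuple_weight_nonneg: "tuple_weight ks ns \<ge> 0"
  unfolding tuple_weight_def by (intro prod_nonneg) auto

lemma decr_tuples_Suc: "ns \<in> decr_tuples (Suc r) \<longleftrightarrow> (\<exists>m ms. ns = Suc m # ms \<and> ms \<in> bounded_tuples r (Suc m))"
proof
  assume h: "ns \<in> decr_tuples (Suc r)"
  then obtain n ms where n: "ns = n # ms" "n \<ge> 1" by (cases ns) (auto simp: decr_tuples_def)
  then obtain m where "n = Suc m" by (cases n) auto
  then show "\<exists>m ms. ns = Suc m # ms \<and> ms \<in> bounded_tuples r (Suc m)"
    using h n by (auto simp: decr_tuples_def bounded_tuples_def)
qed (auto simp: decr_tuples_def bounded_tuples_def)

lemma bounded_tuples_Suc: "bounded_tuples (Suc r) (Suc n) = (\<lambda>(m, ms). Suc m # ms) ` (SIGMA m:{..n}. bounded_tuples r (Suc m))"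
proof -
  have "ns \<in> bounded_tuples (Suc r) (Suc n) \<longleftrightarrow> (\<exists>m ms. ns = Suc m # ms \<and> ms \<in> bounded_tuples r (Suc m) \<and> m \<le> n)" for ns
    unfolding bounded_tuples_def[of "Suc r"] mem_Collect_eq decr_tuples_Suc
    by (auto simp: bounded_tuples_def intro: order_trans)
  then show ?thesis by (auto simp: image_iff)
qed

lemma bounded_tuples_finite: "finite (bounded_tuples r (Suc n))"
proof (induction r arbitrary: n)
  case 0
  have "bounded_tuples 0 (Suc n) = {[]}" by (auto simp: bounded_tuples_def decr_tuples_def)
  then show ?case by simp
next
  case (Suc r)
  then show ?case unfolding bounded_tuples_Suc by (intro finite_imageI finite_SigmaI) auto
qed

lemma inj_Suc_Cons: "inj_on (\<lambda>(m, ms). Suc m # ms) A"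
  by (auto simp: inj_on_def)

lemma sum_tuple_weight: "(\<Sum>ns\<in>bounded_tuples (length ks) (Suc n). tuple_weight ks ns) = (\<Sum>m\<le>n. series_coeff ks m)"
proof (induction ks arbitrary: n)
  case Nil
  have "bounded_tuples 0 (Suc n) = {[]}" by (auto simp: bounded_tuples_def decr_tuples_def)
  then show ?case by (simp add: tuple_weight_def)
next
  case (Cons k ks)
  have "(\<Sum>ns\<in>bounded_tuples (length (k # ks)) (Suc n). tuple_weight (k # ks) ns)
      = (\<Sum>(m, ms)\<in>(SIGMA m:{..n}. bounded_tuples (length ks) (Suc m)). tuple_weight ks ms / real (Suc m) ^ k)"
    unfolding list.size(4) add_Suc_right add_0_right bounded_tuples_Suc
    by (subst sum.reindex[OF inj_Suc_Cons]) (auto simp: tuple_weight_Cons intro!: sum.cong)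
  also have "\<dots> = (\<Sum>m\<le>n. \<Sum>ms\<in>bounded_tuples (length ks) (Suc m). tuple_weight ks ms / real (Suc m) ^ k)"
    by (subst sum.Sigma) (auto simp: bounded_tuples_finite)
  also have "\<dots> = (\<Sum>m\<le>n. series_coeff (k # ks) m)"
    by (simp add: sum_divide_distrib[symmetric] Cons.IH del: of_nat_Suc)
  finally show ?case .
qed

text \<open>The sum is fibred over the first entry \<open>m + 1\<close>, each fibre being the finite
  set of tails with entries at most \<open>m + 1\<close>. The weights are nonnegative, so
  convergence of the power series at the real point \<open>norm z\<close> yields the absolute
  summability behind the rearrangement.\<close>

lemma H_series_eq:
  assumes ks: "\<And>k. k \<in> set ks \<Longrightarrow> k \<ge> 1" "ks \<noteq> []" and z: "z \<in> ball 0 1"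
  shows "H_series ks z = G (index_word ks) 0 z"
proof -
  obtain k ls where kl: "ks = k # ls" using ks(2) by (cases ks) auto
  define r where "r = length ls"
  define t where "t = (\<lambda>ns. z ^ (hd ns - 1) * of_real (tuple_weight ks ns))"
  define S where "S = (SIGMA m:(UNIV :: nat set). bounded_tuples r (Suc m))"
  have bij: "bij_betw (\<lambda>(m, ms). Suc m # ms) S (decr_tuples (Suc r))"
    unfolding bij_betw_def S_def using decr_tuples_Suc[of _ r] by (auto simp: inj_Suc_Cons image_iff) 
  have t_eq: "t (Suc m # ms) = z ^ m * of_real (tuple_weight ls ms / real (Suc m) ^ k)" for m ms
    by (simp add: t_def kl tuple_weight_Cons)
  have fib: "(\<Sum>ms\<in>bounded_tuples r (Suc m). tuple_weight ls ms / real (Suc m) ^ k) = series_coeff ks m" for m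
    by (simp add: sum_divide_distrib[symmetric] sum_tuple_weight r_def kl del: of_nat_Suc)
  have cfn: "series_coeff ks m \<ge> 0" for m
    unfolding fib[symmetric] by (intro sum_nonneg) (simp add: tuple_weight_nonneg)
  define x where "x = complex_of_real (norm z)"
  have x: "x \<in> ball 0 1" using z by (simp add: x_def)
  have "summable (\<lambda>n. of_real (series_coeff ks n) * x ^ n)"
    using G_power_series[OF ks(1) x] sums_summable by blast
  then have "summable (\<lambda>n. complex_of_real (series_coeff ks n * norm z ^ n))" by (simp add: x_def)
  then have sm: "summable (\<lambda>n. series_coeff ks n * norm z ^ n)" unfolding summable_of_real_iff by simp
  have sig: "(\<lambda>(m, ms). t (Suc m # ms)) summable_on S"
  proof (rule abs_summable_summable)
    have fin: "(\<Sum>\<^sub>\<infinity>ms\<in>bounded_tuples r (Suc m). norm (t (Suc m # ms))) = series_coeff ks m * norm z ^ m" for m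
    proof -
      have "(\<Sum>\<^sub>\<infinity>ms\<in>bounded_tuples r (Suc m). norm (t (Suc m # ms))) = (\<Sum>ms\<in>bounded_tuples r (Suc m). norm z ^ m * (tuple_weight ls ms / real (Suc m) ^ k))"
        unfolding infsum_finite[OF bounded_tuples_finite] t_eq
        by (intro sum.cong) (auto simp: norm_mult norm_power tuple_weight_nonneg norm_divide simp flip: of_nat_Suc)
      then show ?thesis unfolding sum_distrib_left[symmetric] fib by (simp add: mult.commute)
    qed
    have "(\<lambda>m. series_coeff ks m * norm z ^ m) summable_on UNIV"
      using sm cfn by (simp add: summable_on_UNIV_nonneg_real_iff)
    then have "(\<lambda>m. norm (\<Sum>\<^sub>\<infinity>ms\<in>bounded_tuples r (Suc m). norm (t (Suc m # ms)))) summable_on UNIV"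
      unfolding fin using cfn by simp
    then show "(\<lambda>p. norm (case p of (m, ms) \<Rightarrow> t (Suc m # ms))) summable_on S"
      unfolding S_def Infinite_Sum.abs_summable_on_Sigma_iff
      by (auto intro: summable_on_finite bounded_tuples_finite)
  qed
  have len: "length ks = Suc r" by (simp add: kl r_def)
  have "H_series ks z = infsum t (decr_tuples (Suc r))"
    unfolding H_series_def t_def len[symmetric]
  proof (rule infsum_cong)
    fix ns
    have "complex_of_real (tuple_weight ks ns) = 1 / (\<Prod>i<length ks. of_nat (ns ! i) ^ (ks ! i))"
      unfolding tuple_weight_def by (simp add: prod_dividef)
    then show "z ^ (hd ns - 1) / (\<Prod>i<length ks. of_nat (ns ! i) ^ (ks ! i)) = z ^ (hd ns - 1) * of_real (tuple_weight ks ns)"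
      by simp
  qed
  also have "\<dots> = infsum (\<lambda>(m, ms). t (Suc m # ms)) S"
    using infsum_reindex_bij_betw[OF bij, of t] by (simp add: case_prod_unfold)
  also have "\<dots> = (\<Sum>\<^sub>\<infinity>m\<in>UNIV. \<Sum>\<^sub>\<infinity>ms\<in>bounded_tuples r (Suc m). t (Suc m # ms))"
    using infsum_Sigma'_banach[of "\<lambda>m ms. t (Suc m # ms)"] sig unfolding S_def by simp
  also have "(\<lambda>m. \<Sum>\<^sub>\<infinity>ms\<in>bounded_tuples r (Suc m). t (Suc m # ms)) = (\<lambda>m. of_real (series_coeff ks m) * z ^ m)"
  proof
    fix m
    have "(\<Sum>\<^sub>\<infinity>ms\<in>bounded_tuples r (Suc m). t (Suc m # ms)) = z ^ m * of_real (\<Sum>ms\<in>bounded_tuples r (Suc m). tuple_weight ls ms / real (Suc m) ^ k)"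
      unfolding infsum_finite[OF bounded_tuples_finite] t_eq of_real_sum sum_distrib_left ..
    then show "(\<Sum>\<^sub>\<infinity>ms\<in>bounded_tuples r (Suc m). t (Suc m # ms)) = of_real (series_coeff ks m) * z ^ m"
      unfolding fib by simp
  qed
  also have "infsum (\<lambda>m. of_real (series_coeff ks m) * z ^ m) UNIV = G (index_word ks) 0 z"
  proof (rule infsumI, rule norm_summable_imp_has_sum)
    show "summable (\<lambda>m. norm (of_real (series_coeff ks m) * z ^ m))"
      using sm cfn by (simp add: norm_mult norm_power)
  qed (rule G_power_series[OF ks(1) z])
  finally show ?thesis .
qed

lemma connected_slit_plane: "connected slit_plane"
proof (rule starlike_imp_connected)
  show "starlike slit_plane" unfolding starlike_def using starlike_slit zero_slit by blast
qed

text \<open>\<open>G (index_word ks) 0\<close> is itself an admissible choice of the extension, and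
  the identity theorem on the connected slit plane makes the chosen one agree with it.\<close>

lemma H_fin_eq:
  assumes ks: "\<And>k. k \<in> set ks \<Longrightarrow> k \<ge> 1" "ks \<noteq> []" and z: "z \<in> slit_plane"
  shows "H_fin ks z = G (index_word ks) 0 z"
proof -
  define Q where "Q = (\<lambda>f. f holomorphic_on slit_plane \<and> (\<forall>z\<in>ball 0 1. f z = H_series ks z))"
  have "Q (G (index_word ks) 0)" unfolding Q_def using H_series_eq[OF ks] by (auto intro!: G_holo)
  then have "Q (Eps Q)" by (rule someI[of Q])
  then have "Q (H_fin ks)" unfolding H_fin_def Q_def .
  then have h: "H_fin ks holomorphic_on slit_plane" "\<And>z. z \<in> ball 0 1 \<Longrightarrow> H_fin ks z = G (index_word ks) 0 z"
    unfolding Q_def using H_series_eq[OF ks] by auto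
  have "H_fin ks z - G (index_word ks) 0 z = 0"
  proof (rule analytic_continuation[of "\<lambda>z. H_fin ks z - G (index_word ks) 0 z" slit_plane "ball 0 1" 0])
    show "(\<lambda>z. H_fin ks z - G (index_word ks) 0 z) holomorphic_on slit_plane"
      by (intro holomorphic_intros h G_holo) auto
    show "(0 :: complex) islimpt ball 0 1" by (rule interior_limit_point) simp
  qed (use open_slit_plane connected_slit_plane ball_slit z h in auto)
  then show ?thesis by simp
qed

section \<open>Nesting of images\<close>

text \<open>A form of subordination. The weak inequality between norms lets the relation contain
  equality, compose and pass to limits; strictness on the circle is recovered separately.\<close>

definition subdisc :: "(complex \<Rightarrow> complex) \<Rightarrow> (complex \<Rightarrow> complex) \<Rightarrow> bool" where
  "subdisc F H \<longleftrightarrow> (\<forall>z\<in>ball 0 1. \<exists>y. norm y \<le> norm z \<and> H y = F z)"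

lemma subdisc_trans [trans]: "subdisc F H \<Longrightarrow> subdisc H K \<Longrightarrow> subdisc F K"
  unfolding subdisc_def by (smt (verit) mem_ball_0)

lemma subdisc_eq: "(\<And>z. z \<in> slit_plane \<Longrightarrow> F z = H z) \<Longrightarrow> subdisc F H"
proof -
  assume h: "\<And>z. z \<in> slit_plane \<Longrightarrow> F z = H z"
  have "norm z \<le> norm z \<and> H z = F z" if "z \<in> ball 0 1" for z
    using h[of z] that ball_slit by auto
  then show ?thesis unfolding subdisc_def by blast
qed

lemma dG_bound:
  assumes s: "0 \<le> s" "s \<le> 1" and z: "z \<in> slit_plane" "kbound z m"
  shows "norm (dG w s z) \<le> m ^ 2"
proof -
  have "norm (word 2 w (\<lambda>z. ker s z ^ 2) z) \<le> 1 * norm z ^ 0 * m ^ (2 + 0) / real (2 + 0) ^ length w"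
  proof (rule word_bound[OF _ _ _ z])
    fix z m assume "z \<in> slit_plane" "kbound z m"
    then have "norm (ker s z) \<le> m" using s unfolding kbound_def by auto
    then show "norm (ker s z ^ 2) \<le> 1 * norm z ^ 0 * m ^ (2 + 0)"
      by (simp add: norm_power power_mono)
  qed (auto intro!: holomorphic_intros ker_holo s)
  also have "\<dots> \<le> m ^ 2" by (simp add: divide_le_eq mult_le_cancel_left1)
  finally show ?thesis by (simp add: dG_def)
qed

lemma G_lipschitz:
  assumes s: "0 \<le> s" "s \<le> 1" "0 \<le> s'" "s' \<le> 1" and z: "z \<in> slit_plane" "kbound z m" "norm z \<le> 2"
  shows "norm (G w s z - G w s' z) \<le> \<bar>s - s'\<bar> * (6 * m ^ 3)"
proof -
  have m: "m \<ge> 1" using kbound_ge1[OF z(2)] .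
  let ?D = "of_real (s - s') * z * dG w s' z"
  have "\<bar>s - s'\<bar> \<le> 1" using s by auto
  then have "\<bar>s - s'\<bar> * \<bar>s - s'\<bar> \<le> \<bar>s - s'\<bar>" by (intro mult_left_le) auto
  then have ss: "(s - s')\<^sup>2 \<le> \<bar>s - s'\<bar>" by (simp add: power2_eq_square)
  have m23: "m ^ 2 \<le> m ^ 3" using m by (intro power_increasing) auto
  have "norm (G w s z - G w s' z) \<le> norm (G w s z - G w s' z - ?D) + norm ?D"
    using norm_triangle_sub[of "G w s z - G w s' z" ?D] by (simp add: add.commute)
  also have "norm (G w s z - G w s' z - ?D) \<le> (s - s')\<^sup>2 * norm z ^ 2 * m ^ 3" by (rule G_expand[OF s z(1,2)])
  also have "\<dots> \<le> \<bar>s - s'\<bar> * 2 ^ 2 * m ^ 3"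
    using ss z(3) m by (intro mult_mono mult_nonneg_nonneg power_mono) auto
  also have "norm ?D = \<bar>s - s'\<bar> * (norm z * norm (dG w s' z))" by (simp add: norm_mult flip: of_real_diff)
  also have "\<dots> \<le> \<bar>s - s'\<bar> * (2 * m ^ 3)"
    using dG_bound[OF s(3,4) z(1,2), of w] m23 z(3) m by (intro mult_left_mono mult_mono) auto
  finally show ?thesis by simp
qed

lemma G_jointly_continuous: "continuous_on ({0..1} \<times> ball 0 1) (\<lambda>p. G w (fst p) (snd p))"
  unfolding continuous_on_sequentially
proof (intro allI ballI impI, elim conjE)
  fix x and p :: "real \<times> complex" assume p: "p \<in> {0..1} \<times> ball 0 1"
    and x: "\<forall>n. x n \<in> {0..1} \<times> ball 0 1" "x \<longlonglongrightarrow> p"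
  obtain s z where pz: "p = (s, z)" by (cases p)
  have s: "0 \<le> s" "s \<le> 1" and z: "z \<in> ball 0 1" using p pz by auto
  have lim: "(\<lambda>n. fst (x n)) \<longlonglongrightarrow> s" "(\<lambda>n. snd (x n)) \<longlonglongrightarrow> z"
    using tendsto_fst[OF x(2)] tendsto_snd[OF x(2)] pz by auto
  have xn: "0 \<le> fst (x n)" "fst (x n) \<le> 1" "snd (x n) \<in> ball 0 1" for n
    using x(1)[rule_format, of n] by (auto simp: mem_Times_iff)
  define \<rho> where "\<rho> = (1 + norm z) / 2"
  have \<rho>: "norm z < \<rho>" "\<rho> < 1" using z by (auto simp: \<rho>_def)
  have sub: "cball 0 \<rho> \<subseteq> slit_plane" using \<rho> ball_slit by (force simp: subset_iff)
  obtain m where m: "\<And>y. y \<in> cball 0 \<rho> \<Longrightarrow> kbound y m" by (rule kbound_compact[OF compact_cball sub]) blast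
  have "\<forall>\<^sub>F n in sequentially. snd (x n) \<in> ball 0 \<rho>"
    using topological_tendstoD[OF lim(2), of "ball 0 \<rho>"] \<rho> by simp
  then have "\<forall>\<^sub>F n in sequentially. norm (G w (fst (x n)) (snd (x n)) - G w s (snd (x n))) \<le> \<bar>fst (x n) - s\<bar> * (6 * m ^ 3)"
  proof eventually_elim
    case (elim n)
    then have "snd (x n) \<in> cball 0 \<rho>" by simp
    then show ?case using sub m \<rho> by (intro G_lipschitz xn s) auto
  qed
  moreover have "(\<lambda>n. \<bar>fst (x n) - s\<bar> * (6 * m ^ 3)) \<longlonglongrightarrow> 0"
    by (rule tendsto_mult_left_zero[OF tendsto_rabs_zero[OF LIM_zero[OF lim(1)]]])
  ultimately have "(\<lambda>n. G w (fst (x n)) (snd (x n)) - G w s (snd (x n))) \<longlonglongrightarrow> 0"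
    by (rule Lim_null_comparison)
  moreover have "(\<lambda>n. G w s (snd (x n))) \<longlonglongrightarrow> G w s z"
  proof (rule isCont_tendsto_compose[OF _ lim(2)])
    show "isCont (G w s) z"
      using holomorphic_on_imp_continuous_on[OF G_holo[OF s]] z ball_slit open_slit_plane continuous_on_eq_continuous_at by blast
  qed
  ultimately have "(\<lambda>n. (G w (fst (x n)) (snd (x n)) - G w s (snd (x n))) + G w s (snd (x n))) \<longlonglongrightarrow> 0 + G w s z"
    by (rule tendsto_add)
  then show "((\<lambda>p. G w (fst p) (snd p)) \<circ> x) \<longlonglongrightarrow> G w (fst p) (snd p)"
    by (simp add: comp_def pz)
qed

text \<open>Continuation of a root: by compactness there is a pair \<open>(t, y)\<close> with
  \<open>G w t y = c\<close>, \<open>norm y \<le> \<rho>\<close> and maximal \<open>t\<close>, and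
  below \<open>s'\<close> \<open>root_moves\<close> would continue it to a larger parameter with
  smaller norm. The root 0 persists for another reason, namely \<open>G w t 0 = 1\<close> for all
  \<open>t\<close>.\<close>

lemma subdisc_pos:
  assumes s: "0 < s" "s \<le> s'" "s' \<le> 1"
  shows "subdisc (G w s) (G w s')"
  unfolding subdisc_def
proof
  fix z :: complex assume z: "z \<in> ball 0 1"
  define \<rho> where "\<rho> = norm z"
  define c where "c = G w s z"
  define T where "T = {p \<in> {s..s'} \<times> cball 0 \<rho>. G w (fst p) (snd p) = c}"
  have sub: "{s..s'} \<times> cball 0 \<rho> \<subseteq> {0..1} \<times> ball 0 1" using s z by (auto simp: \<rho>_def)
  have Teq: "T = ({s..s'} \<times> cball 0 \<rho>) \<inter> (\<lambda>p. G w (fst p) (snd p)) -` {c}"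
    by (auto simp: T_def)
  have "closed T" unfolding Teq
    by (intro continuous_closed_preimage continuous_on_subset[OF G_jointly_continuous sub] closed_Times
        closed_atLeastAtMost closed_cball closed_singleton)
  moreover have "T \<subseteq> {s..s'} \<times> cball 0 \<rho>" by (auto simp: T_def)
  ultimately have "compact T"
    using compact_Int_closed[OF compact_Times[OF compact_Icc compact_cball], of T s s' 0 \<rho>]
    by (simp add: Int_absorb1)
  moreover have inT: "(s, z) \<in> T" using s by (simp add: T_def c_def \<rho>_def)
  ultimately obtain p where p: "p \<in> T" "\<And>q. q \<in> T \<Longrightarrow> fst q \<le> fst p"
    using continuous_attains_sup[of T fst] by (force intro: continuous_intros)
  obtain t y where ty: "p = (t, y)" by (cases p)
  have t: "s \<le> t" "t \<le> s'" and y: "norm y \<le> \<rho>" "G w t y = c" using p(1) by (auto simp: T_def ty)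
  show "\<exists>y. norm y \<le> norm z \<and> G w s' y = G w s z"
  proof (cases "t = s' \<or> y = 0")
    case True
    then show ?thesis using y by (auto simp: \<rho>_def c_def G_zero)
  next
    case False
    then have ts: "t < s'" using t by auto
    have y1: "norm y \<le> 1" "y \<noteq> 1" using y z by (auto simp: \<rho>_def)
    obtain \<epsilon> where \<epsilon>: "\<epsilon> > 0" "\<And>s. 0 \<le> s \<Longrightarrow> s \<le> 1 \<Longrightarrow> s \<noteq> t \<Longrightarrow> \<bar>s - t\<bar> < \<epsilon> \<Longrightarrow>
       \<exists>z\<in>ball y 1. Re z < 1 \<and> G w s z = G w t y \<and> (t < s \<longrightarrow> norm z < norm y) \<and> (s < t \<longrightarrow> norm y < norm z)"
      using root_moves[of t y 1 w] t s y1 False by (smt (verit))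
    define u where "u = min s' (t + \<epsilon> / 2)"
    have u: "t < u" "u \<le> s'" "\<bar>u - t\<bar> < \<epsilon>" using ts \<epsilon>(1) by (auto simp: u_def)
    then obtain x where x: "G w u x = c" "norm x < norm y"
      using \<epsilon>(2)[of u] t s y by auto
    then have "(u, x) \<in> T" using u t y by (simp add: T_def)
    then have "u \<le> t" using p(2) ty by fastforce
    then show ?thesis using u by simp
  qed
qed

text \<open>Roots can be moved only from positive parameters, so the parameter 0 is reached as a
  limit; the image of a closed disc is compact and contains the limit of the values
  \<open>G w (a n) z\<close>.\<close>

lemma subdisc_mono:
  assumes s: "0 \<le> s" "s \<le> s'" "s' \<le> 1"
  shows "subdisc (G w s) (G w s')"
proof (cases "s = 0 \<and> s' \<noteq> 0")
  case True
  then have s': "0 < s'" "s = 0" using s by auto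
  show ?thesis unfolding subdisc_def
  proof
    fix z :: complex assume z: "z \<in> ball 0 1"
    have zs: "z \<in> slit_plane" using z ball_slit by blast
    define K where "K = G w s' ` cball 0 (norm z)"
    have "cball 0 (norm z) \<subseteq> slit_plane" using z ball_slit by (force simp: subset_iff)
    then have "compact K" unfolding K_def
      using s' s by (intro compact_continuous_image compact_cball continuous_on_subset[OF holomorphic_on_imp_continuous_on[OF G_holo]]) auto
    then have cl: "closed K" by (rule compact_imp_closed)
    define a where "a n = s' / real (Suc n)" for n
    have a: "0 < a n" "a n \<le> s'" for n using s' by (auto simp: a_def divide_le_eq mult_le_cancel_left1)
    have a01: "0 \<le> a n" "a n \<le> 1" for n using a[of n] s(3) by auto
    have "a \<longlonglongrightarrow> 0" unfolding a_def by (intro tendsto_divide_0[OF tendsto_const] filterlim_real_sequentially filterlim_compose[OF filterlim_real_sequentially filterlim_Suc] filterlim_at_top_imp_at_infinity)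
    have inK: "G w (a n) z \<in> K" for n
    proof -
      obtain y where "norm y \<le> norm z" "G w s' y = G w (a n) z"
        using subdisc_pos[OF a(1)[of n] a(2)[of n] s(3), of w] z unfolding subdisc_def by blast
      then show ?thesis unfolding K_def by (intro image_eqI[of _ _ y]) auto
    qed
    have "(\<lambda>n. (\<lambda>p. G w (fst p) (snd p)) (a n, z)) \<longlonglongrightarrow> (\<lambda>p. G w (fst p) (snd p)) (0, z)"
      by (rule continuous_on_tendsto_compose[OF G_jointly_continuous])
        (use z a01 \<open>a \<longlonglongrightarrow> 0\<close> in \<open>auto intro!: tendsto_Pair\<close>)
    then have "(\<lambda>n. G w (a n) z) \<longlonglongrightarrow> G w 0 z" by simp
    from closed_sequentially[OF cl _ this] have "G w 0 z \<in> K" using inK by simp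
    then show "\<exists>y. norm y \<le> norm z \<and> G w s' y = G w s z" unfolding K_def s'(2) by auto
  qed
next
  case False
  then show ?thesis
  proof (cases "s = 0")
    case True
    then show ?thesis using False subdisc_eq by auto
  next
    case False
    then show ?thesis using s by (intro subdisc_pos) auto
  qed
qed

text \<open>In the lexicographic order \<open>G V 1\<close> is the top of all functions whose word
  extends \<open>V\<close>. Appending B keeps this top, and the top after appending A is the bottom
  after appending B.\<close>

lemma subdisc_upper:
  assumes s: "0 \<le> s" "s \<le> 1"
  shows "subdisc (G (V @ U) s) (G V 1)"
proof (induction U arbitrary: V)
  case Nil
  then show ?case using subdisc_mono[OF s(1,2)] by simp
next
  case (Cons b U)
  have 1: "subdisc (G (V @ b # U) s) (G (V @ [b]) 1)" using Cons[of "V @ [b]"] by simp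
  have 2: "subdisc (G (V @ [True]) 1) (G V 1)" by (intro subdisc_eq G_snoc)
  have 3: "subdisc (G (V @ [False]) 1) (G (V @ [True]) 0)" by (intro subdisc_eq G_snoc[symmetric])
  have 4: "subdisc (G (V @ [True]) 0) (G (V @ [True]) 1)" by (intro subdisc_mono) auto
  show ?case
    using subdisc_trans[OF 1] 2 subdisc_trans[OF 3 subdisc_trans[OF 4 2]] by (cases b) simp_all
qed

lemma subdisc_lower:
  assumes s: "0 \<le> s" "s \<le> 1"
  shows "subdisc (G V 0) (G (V @ U) s)"
proof (induction U arbitrary: V)
  case Nil
  then show ?case using subdisc_mono[OF _ s] by simp
next
  case (Cons b U)
  have 1: "subdisc (G (V @ [b]) 0) (G (V @ b # U) s)" using Cons[of "V @ [b]"] by simp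
  have 2: "subdisc (G V 0) (G (V @ [False]) 0)" by (intro subdisc_eq G_snoc[symmetric])
  have 3: "subdisc (G (V @ [False]) 1) (G (V @ [True]) 0)" by (intro subdisc_eq G_snoc[symmetric])
  have 4: "subdisc (G (V @ [False]) 0) (G (V @ [False]) 1)" by (intro subdisc_mono) auto
  show ?case
    using subdisc_trans[OF _ 1] 2 subdisc_trans[OF 2 subdisc_trans[OF 4 3]] by (cases b) simp_all
qed

text \<open>The difference is the word \<open>w\<close> applied to \<open>G v s - 1\<close>, because
  \<open>ker 0\<close> is the constant 1. This function vanishes at 0, which permits
  \<open>j = 1\<close> in \<open>word_bound\<close> and gives a factor \<open>1 / 2\<close> per
  letter; with \<open>j = 0\<close> the exponent 1 would give no decay.\<close>

lemma G_prefix_bound: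
  assumes s: "0 \<le> s" "s \<le> 1" and z: "z \<in> slit_plane" "kbound z m"
  shows "norm (G (w @ v) s z - G w 0 z) \<le> norm z * m ^ 2 / 2 ^ length w"
proof -
  define f where "f z = G v s z + (-1) * ker 0 z" for z
  have h: "G v s holomorphic_on slit_plane" "(\<lambda>z. (-1) * ker 0 z) holomorphic_on slit_plane"
    by (intro holomorphic_intros ker_holo G_holo s; simp)+
  have f: "f holomorphic_on slit_plane" unfolding f_def[abs_def] by (intro holomorphic_on_add h)
  have "norm (word 1 w f z) \<le> 1 * norm z ^ 1 * m ^ (1 + 1) / real (1 + 1) ^ length w"
  proof (rule word_bound[OF f _ _ z])
    fix z m assume z: "z \<in> slit_plane" "kbound z m"
    have m: "m \<ge> 1" using kbound_ge1[OF z(2)] .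
    define x where "x = G v s z - 1"
    have f: "f z = x" by (simp add: f_def x_def ker_def)
    show "norm (f z) \<le> 1 * norm z ^ 1 * m ^ (1 + 1)"
    proof (cases "x = 0")
      case False
      define c where "c = cnj x / of_real (norm x)"
      have c: "norm c = 1" using False by (simp add: c_def norm_divide)
      have cx: "c * x = of_real (norm x)"
      proof -
        have "c * x = of_real (norm x ^ 2) / of_real (norm x)"
          unfolding c_def complex_norm_square by simp
        then show ?thesis using False by (simp add: power2_eq_square)
      qed
      have "- (norm z * m) + 0 * mean v s \<le> Re (- c * G v s z + c * G v s 0)"
      proof (rule kernel_average_G[OF s, unfolded kernel_average_def, rule_format, OF z(1) zero_slit])
        fix t :: real assume t: "t \<in> {0..1}"
        have "ker t z - 1 = of_real t * z * ker t z"
          using slit_plane_nz[OF z(1), of t] t by (simp add: ker_def field_simps)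
        then have "norm (ker t z - 1) = t * norm z * norm (ker t z)" using t by (simp add: norm_mult)
        also have "\<dots> \<le> 1 * norm z * m"
          using t z(2) unfolding kbound_def by (intro mult_mono) auto
        finally have "norm (c * (ker t z - 1)) \<le> norm z * m" using c by (simp add: norm_mult)
        then have "Re (c * (ker t z - 1)) \<le> norm z * m" using complex_Re_le_cmod order_trans by blast
        then show "- (norm z * m) + 0 * t \<le> Re (- c * ker t z + c * ker t 0)"
          by (simp add: ker_def algebra_simps)
      qed
      also have "- c * G v s z + c * G v s 0 = - (c * x)" by (simp add: x_def G_zero algebra_simps)
      finally have "norm x \<le> norm z * m" unfolding cx by simp
      also have "\<dots> \<le> norm z * m ^ 2" using m by (intro mult_left_mono self_le_power) auto
      finally show ?thesis by (simp add: f power2_eq_square)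
    qed (use m f in simp)
  qed simp
  moreover have "word 1 w f z = G (w @ v) s z - G w 0 z"
  proof -
    have "word 1 w f z = word 1 w (G v s) z + word 1 w (\<lambda>z. (-1) * ker 0 z) z"
      unfolding f_def by (rule word_add[OF h order_refl z(1)])
    also have "word 1 w (\<lambda>z. (-1) * ker 0 z) z = (-1) * word 1 w (ker 0) z" by (rule word_cmul[OF z(1)])
    finally show ?thesis by (simp add: G_def word_append)
  qed
  ultimately show ?thesis by (simp add: power2_eq_square)
qed

section \<open>Infinite indices\<close>

abbreviation blocks :: "(nat \<Rightarrow> nat) \<Rightarrow> nat \<Rightarrow> bool list" where
  "blocks k n \<equiv> index_word (map k [0..<n])"

lemma index_word_append: "index_word (xs @ ys) = index_word xs @ index_word ys"
  by (simp add: index_word_def)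

lemma index_word_Cons: "index_word (x # xs) = replicate (x - 1) False @ True # index_word xs"
  by (simp add: index_word_def)

lemma blocks_split: "n \<le> m \<Longrightarrow> blocks k m = blocks k n @ index_word (map k [n..<m])"
  using upt_add_eq_append[of 0 n "m - n"] by (simp add: index_word_append)

lemma blocks_at:
  assumes "i < n"
  shows "blocks k n = blocks k i @ replicate (k i - 1) False @ True # index_word (map k [Suc i..<n])"
  unfolding blocks_split[OF less_imp_le[OF assms], of k]
  by (simp only: upt_conv_Cons[OF assms] list.map index_word_Cons)

lemma length_blocks: "length (blocks k n) \<ge> n"
  by (induction n) (auto simp: index_word_append index_word_Cons index_word_def)

lemma blocks_convergent:
  assumes z: "z \<in> slit_plane"
  shows "convergent (\<lambda>n. G (blocks k n) 0 z)"
proof -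
  obtain m where m: "kbound z m" using kbound_compact[of "{z}"] z by auto
  define C where "C = norm z * m ^ 2"
  have C: "C \<ge> 0" by (simp add: C_def)
  have est: "norm (G (blocks k q) 0 z - G (blocks k p) 0 z) \<le> C * (1 / 2) ^ p" if "p \<le> q" for p q
  proof -
    have "norm (G (blocks k q) 0 z - G (blocks k p) 0 z) \<le> C / 2 ^ length (blocks k p)"
      unfolding blocks_split[OF that] C_def by (rule G_prefix_bound[OF _ _ z m]) auto
    also have "\<dots> \<le> C / 2 ^ p"
      using C length_blocks[of p k] by (intro divide_left_mono power_increasing) auto
    finally show ?thesis by (simp add: power_divide)
  qed
  have "Cauchy (\<lambda>n. G (blocks k n) 0 z)"
  proof (rule metric_CauchyI)
    fix e :: real assume e: "e > 0"
    have "(\<lambda>p. C * (1 / 2) ^ p) \<longlonglongrightarrow> C * 0" by (intro tendsto_intros LIMSEQ_power_zero) auto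
    then have "\<forall>\<^sub>F p in sequentially. C * (1 / 2) ^ p < e" using e by (intro order_tendstoD(2)) auto
    then obtain N where N: "\<And>p. p \<ge> N \<Longrightarrow> C * (1 / 2) ^ p < e" unfolding eventually_sequentially by blast
    have "dist (G (blocks k p) 0 z) (G (blocks k q) 0 z) < e" if "p \<ge> N" "q \<ge> N" for p q
    proof (cases "p \<le> q")
      case True
      then show ?thesis using est[OF True] N[OF that(1)] by (simp add: dist_norm norm_minus_commute)
    next
      case False
      then show ?thesis using est[of q p] N[OF that(2)] by (simp add: dist_norm)
    qed
    then show "\<exists>M. \<forall>p\<ge>M. \<forall>q\<ge>M. dist (G (blocks k p) 0 z) (G (blocks k q) 0 z) < e" by blast
  qed
  then show ?thesis by (rule Cauchy_convergent)
qed

lemma H_inf_limit: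
  assumes k: "\<And>i. k i \<ge> 1" and z: "z \<in> slit_plane"
  shows "(\<lambda>n. G (blocks k n) 0 z) \<longlonglongrightarrow> H_inf k z"
proof -
  have eq: "H_fin (map k [0..<n]) z = G (blocks k n) 0 z" if "n \<ge> 1" for n
    using that k by (intro H_fin_eq[OF _ _ z]) auto
  have "(\<lambda>n. G (blocks k n) 0 z) \<longlonglongrightarrow> lim (\<lambda>n. G (blocks k n) 0 z)"
    using blocks_convergent[OF z] by (simp add: convergent_LIMSEQ_iff)
  note L = this
  then have M: "(\<lambda>n. H_fin (map k [0..<n]) z) \<longlonglongrightarrow> lim (\<lambda>n. G (blocks k n) 0 z)"
    by (rule Lim_transform_eventually) (use eq in \<open>auto simp: eventually_sequentially intro!: exI[of _ 1]\<close>)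
  show ?thesis unfolding H_inf_def limI[OF M] by (rule L)
qed

text \<open>In every nonempty truncation the outermost letter B is preceded by
  \<open>k 0 - 1\<close> letters A. The resulting univalence bound is uniform in \<open>n\<close>
  and survives the limit.\<close>

lemma mean_blocks: "n \<ge> 1 \<Longrightarrow> mean (blocks k n) 0 \<ge> (1 / 2) ^ Suc (k 0 - 1)"
  using mean_pos[of 0 "replicate (k 0 - 1) False" "index_word (map k [Suc 0..<n])"] blocks_at[of 0 n k]
  by (simp add: index_word_def)

section \<open>Injectivity for one index and separation of distinct indices\<close>

lemma H_inf_inj:
  assumes k: "\<And>i. k i \<ge> 1" and z: "Re z < 1" "norm z \<le> 2" "Re w < 1" and eq: "H_inf k z = H_inf k w"
  shows "z = w"
proof -
  obtain \<kappa> where \<kappa>: "\<kappa> > 0" "\<And>z f e. kernel_average e f \<Longrightarrow> Re z < 1 \<Longrightarrow> norm z \<le> 2 \<Longrightarrow>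
     \<kappa> * e * norm (z - w) \<le> norm (f z - f w)" by (rule univalent_bound[OF z(3)]) blast
  define e where "e = (1 / 2 :: real) ^ Suc (k 0 - 1)"
  have "\<kappa> * e * norm (z - w) \<le> norm (G (blocks k n) 0 z - G (blocks k n) 0 w)" if "n \<ge> 1" for n
  proof -
    have "\<kappa> * e * norm (z - w) \<le> \<kappa> * mean (blocks k n) 0 * norm (z - w)"
      using mean_blocks[OF that, of k] \<kappa>(1) unfolding e_def by (intro mult_right_mono mult_left_mono) auto
    also have "\<dots> \<le> norm (G (blocks k n) 0 z - G (blocks k n) 0 w)"
      by (intro \<kappa>(2) kernel_average_G z) auto
    finally show ?thesis .
  qed
  then have ev: "\<forall>\<^sub>F n in sequentially. \<kappa> * e * norm (z - w) \<le> norm (G (blocks k n) 0 z - G (blocks k n) 0 w)"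
    unfolding eventually_sequentially by blast
  have "(\<lambda>n. norm (G (blocks k n) 0 z - G (blocks k n) 0 w)) \<longlonglongrightarrow> norm (H_inf k z - H_inf k w)"
    by (intro tendsto_intros H_inf_limit k Re_less_slit z)
  from tendsto_lowerbound[OF this ev] have "\<kappa> * e * norm (z - w) \<le> 0" using eq by simp
  moreover have "\<kappa> * e > 0" using \<kappa>(1) by (simp add: e_def)
  ultimately have "norm (z - w) \<le> 0" by (smt (verit) mult_pos_pos)
  then show ?thesis by simp
qed

text \<open>Nesting turns \<open>c\<close> into a limit of values of \<open>G w s\<close> on the open disc, and the explicit
  univalence bound keeps such limits away from the values outside the closed disc. It is this
  bound that makes a study of \<open>G w s\<close> near the singular point \<open>1\<close> unnecessary.\<close>

lemma no_outside_root:
  assumes s: "0 \<le> s" "s \<le> 1" and mean: "mean w s > 0"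
    and \<zeta>: "Re \<zeta> < 1" "norm \<zeta> > 1" "G w s \<zeta> = c"
    and z2: "norm z2 = 1" "z2 \<noteq> 1" and lim: "(\<lambda>n. G (v n) 0 z2) \<longlonglongrightarrow> c"
    and sub: "\<forall>\<^sub>F n in sequentially. subdisc (G (v n) 0) (G w s)"
  shows False
proof -
  obtain \<kappa> where \<kappa>: "\<kappa> > 0" "\<And>z f e. kernel_average e f \<Longrightarrow> Re z < 1 \<Longrightarrow> norm z \<le> 2 \<Longrightarrow>
     \<kappa> * e * norm (z - \<zeta>) \<le> norm (f z - f \<zeta>)" by (rule univalent_bound[OF \<zeta>(1)]) blast
  define \<epsilon> where "\<epsilon> = \<kappa> * mean w s * (norm \<zeta> - 1)"
  have \<epsilon>: "\<epsilon> > 0" using \<kappa>(1) mean \<zeta>(2) by (simp add: \<epsilon>_def)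
  have "\<forall>\<^sub>F n in sequentially. dist (G (v n) 0 z2) c < \<epsilon> / 2"
    using tendstoD[OF lim, of "\<epsilon> / 2"] \<epsilon> by simp
  from eventually_conj[OF this sub] obtain n where
    n: "dist (G (v n) 0 z2) c < \<epsilon> / 2" "subdisc (G (v n) 0) (G w s)"
    using eventually_happens'[OF sequentially_bot] by blast
  have Re2: "Re z2 < 1" by (rule Re_less_1) (use z2 in auto)
  \<comment> \<open>Nesting speaks only of the open disc, so \<open>z2\<close> is replaced by
    \<open>x * z2\<close> with \<open>x\<close> slightly below 1.\<close>
  have "isCont (G (v n) 0) z2"
    using holomorphic_on_imp_continuous_on[OF G_holo[of 0 "v n"]] Re_less_slit[OF Re2] open_slit_plane
      continuous_on_eq_continuous_at by auto
  then have "((\<lambda>x. G (v n) 0 (of_real x * z2)) \<longlongrightarrow> G (v n) 0 (of_real 1 * z2)) (at_left 1)"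
    by (intro isCont_tendsto_compose[of _ "G (v n) 0"] tendsto_intros) simp
  then have "\<forall>\<^sub>F x in at_left 1. dist (G (v n) 0 (of_real x * z2)) (G (v n) 0 z2) < \<epsilon> / 2"
    using tendstoD[of "\<lambda>x. G (v n) 0 (of_real x * z2)" "G (v n) 0 z2" "at_left 1" "\<epsilon> / 2"] \<epsilon> by simp
  moreover have "\<forall>\<^sub>F x in at_left (1 :: real). x \<in> {0<..<1}" by (rule eventually_at_leftI[of 0]) auto
  ultimately have "\<forall>\<^sub>F x in at_left 1. x \<in> {0<..<1} \<and> dist (G (v n) 0 (of_real x * z2)) (G (v n) 0 z2) < \<epsilon> / 2"
    by eventually_elim auto
  then obtain x where x: "0 < x" "x < 1" "dist (G (v n) 0 (of_real x * z2)) (G (v n) 0 z2) < \<epsilon> / 2"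
    using eventually_happens'[of "at_left (1 :: real)"] by auto
  have nx: "norm (of_real x * z2) = x" using x z2 by (simp add: norm_mult)
  then have "of_real x * z2 \<in> ball 0 1" using x by simp
  then obtain y where y: "norm y \<le> norm (of_real x * z2)" "G w s y = G (v n) 0 (of_real x * z2)"
    using n(2) unfolding subdisc_def by blast
  have y1: "norm y < 1" using y(1) nx x by simp
  have "\<kappa> * mean w s * norm (y - \<zeta>) \<le> norm (G w s y - G w s \<zeta>)"
    using y1 complex_Re_le_cmod[of y] by (intro \<kappa>(2) kernel_average_G s) auto
  also have "\<dots> = dist (G (v n) 0 (of_real x * z2)) c" by (simp add: y(2) \<zeta>(3) dist_norm)
  also have "\<dots> < \<epsilon>" using x(3) n(1) dist_triangle[of "G (v n) 0 (of_real x * z2)" c "G (v n) 0 z2"]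
    by linarith
  finally have "\<kappa> * mean w s * norm (y - \<zeta>) < \<kappa> * mean w s * (norm \<zeta> - 1)" by (simp add: \<epsilon>_def)
  then have "norm (y - \<zeta>) < norm \<zeta> - 1" using \<kappa>(1) mean by simp
  then show False using norm_triangle_sub[of \<zeta> y] y1 by (simp add: norm_minus_commute)
qed

text \<open>At the first difference \<open>k\<close> already has the letter B where \<open>l\<close>
  still has A, so the words of \<open>l\<close> are the smaller ones and their images lie inside.
  Equal values would produce a root outside the closed disc for a function above all late
  truncations of \<open>l\<close>, which \<open>no_outside_root\<close> excludes.\<close>

lemma first_difference:
  assumes k: "\<And>i. k i \<ge> 1" and l: "\<And>i. l i \<ge> 1"
    and i: "\<And>j. j < i \<Longrightarrow> k j = l j" "k i < l i"
    and z: "norm z1 = 1" "z1 \<noteq> 1" "norm z2 = 1" "z2 \<noteq> 1"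
  shows "H_inf k z1 \<noteq> H_inf l z2"
proof
  assume eq: "H_inf k z1 = H_inf l z2"
  define c where "c = H_inf k z1"
  have Re1: "Re z1 < 1" and Re2: "Re z2 < 1" using z by (auto intro: Re_less_1)
  have lim1: "(\<lambda>n. G (blocks k n) 0 z1) \<longlonglongrightarrow> c" unfolding c_def by (intro H_inf_limit k Re_less_slit Re1)
  have lim2: "(\<lambda>n. G (blocks l n) 0 z2) \<longlonglongrightarrow> c" unfolding c_def eq by (intro H_inf_limit l Re_less_slit Re2)
  define V where "V = blocks k i @ replicate (k i - 1) False"
  \<comment> \<open>With \<open>n \<ge> i + 2\<close> a further block follows the distinguishing
    letter B, so the word ends in another B, which can be exchanged without touching the prefix
    \<open>V @ [True]\<close>.\<close>
  have kV: "\<exists>X. blocks k n = V @ True # X @ [True]" if n: "n \<ge> i + 2" for n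
  proof -
    obtain m where m: "n = Suc m" "m \<ge> Suc i" using n by (cases n) auto
    have "blocks k n = blocks k m @ replicate (k m - 1) False @ [True]"
      by (simp add: m(1) index_word_append index_word_Cons index_word_def)
    moreover have "blocks k m = V @ True # index_word (map k [Suc i..<m])"
      using blocks_at[of i m k] m by (simp add: V_def)
    ultimately show ?thesis by auto
  qed
  have lV: "\<exists>Y. blocks l n = V @ False # Y" if n: "n \<ge> i + 1" for n
  proof -
    have li: "blocks l i = blocks k i" using i(1) by (intro arg_cong[of _ _ index_word]) simp
    have "l i - 1 = (k i - 1) + Suc (l i - k i - 1)" using i(2) k[of i] by simp
    then have kernel_average: "replicate (l i - 1) False = replicate (k i - 1) False @ False # replicate (l i - k i - 1) False"
      by (simp only: replicate_add replicate_Suc)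
    have "i < n" using n by simp
    from blocks_at[OF this, of l] show ?thesis
      unfolding li kernel_average V_def append_assoc append_Cons by blast
  qed
  have below: "subdisc (G (blocks l n) 0) (G (V @ True # X @ [False]) s)"
    if n: "n \<ge> i + 1" and s: "0 \<le> s" "s \<le> 1" for n X s
  proof -
    obtain Y where Y: "blocks l n = V @ False # Y" using lV[OF n] by blast
    have "subdisc (G (blocks l n) 0) (G (V @ [False]) 1)"
      using subdisc_upper[of 0 "V @ [False]" Y] by (simp add: Y)
    moreover have "subdisc (G (V @ [False]) 1) (G (V @ [True]) 0)" by (intro subdisc_eq G_snoc[symmetric])
    moreover have "subdisc (G (V @ [True]) 0) (G (V @ True # X @ [False]) s)"
      using subdisc_lower[OF s, of "V @ [True]" "X @ [False]"] by simp
    ultimately show ?thesis using subdisc_trans by blast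
  qed
  obtain \<kappa> where \<kappa>: "\<kappa> > 0" "\<And>z f e. kernel_average e f \<Longrightarrow> Re z < 1 \<Longrightarrow> norm z \<le> 2 \<Longrightarrow>
     \<kappa> * e * norm (z - z1) \<le> norm (f z - f z1)" by (rule univalent_bound[OF Re1]) blast
  define \<delta> where "\<delta> = \<kappa> * (1 / 2 :: real) ^ Suc (k 0 - 1)"
  have \<delta>: "\<delta> > 0" using \<kappa>(1) by (simp add: \<delta>_def)
  have uni: "\<delta> * norm (y - z1) \<le> norm (G (blocks k n) 0 y - G (blocks k n) 0 z1)"
    if "n \<ge> 1" "Re y < 1" "norm y \<le> 2" for n y
  proof -
    have "\<delta> * norm (y - z1) \<le> \<kappa> * mean (blocks k n) 0 * norm (y - z1)"
      using mean_blocks[OF that(1), of k] \<kappa>(1) unfolding \<delta>_def by (intro mult_right_mono mult_left_mono) auto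
    also have "\<dots> \<le> norm (G (blocks k n) 0 y - G (blocks k n) 0 z1)"
      using that by (intro \<kappa>(2) kernel_average_G) auto
    finally show ?thesis .
  qed
  obtain r where r: "r > 0" "cball z1 r \<subseteq> {z. Re z < 1}"
    using open_contains_cball[of "{z. Re z < 1}"] open_halfspace_Re_lt[of 1] Re1 by auto
  define \<rho> where "\<rho> = min r 1"
  have \<rho>: "\<rho> > 0" "\<rho> \<le> 1" "cball z1 \<rho> \<subseteq> {z. Re z < 1}" using r by (auto simp: \<rho>_def)
  have "\<forall>\<^sub>F n in sequentially. dist (G (blocks k n) 0 z1) c < \<delta> * \<rho> / 2"
    using tendstoD[OF lim1, of "\<delta> * \<rho> / 2"] \<delta> \<rho> by simp
  then obtain n where n: "n \<ge> i + 2" "dist (G (blocks k n) 0 z1) c < \<delta> * \<rho> / 2"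
    unfolding eventually_sequentially by (meson nat_le_linear order_trans)
  define F where "F = G (blocks k n) 0"
  have Fh: "F holomorphic_on slit_plane" unfolding F_def by (intro G_holo) auto
  have norm2: "norm y \<le> 2" if "y \<in> cball z1 \<rho>" for y
    using that \<rho>(2) z(1) norm_triangle_sub[of y z1] by (simp add: dist_norm norm_minus_commute)
  \<comment> \<open>\<open>F z1\<close> only approximates \<open>c\<close>, but the univalence bound
    makes \<open>F - c\<close> larger on the circle about \<open>z1\<close> than at its centre, so a
    root lies nearby.\<close>
  obtain \<zeta> where \<zeta>: "\<zeta> \<in> ball z1 \<rho>" "F \<zeta> - c = 0"
  proof (rule holomorphic_contract_to_zero[of z1 \<rho> "\<lambda>z. F z - c"])
    have sub: "cball z1 \<rho> \<subseteq> slit_plane" using \<rho>(3) Re_less_slit by blast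
    have h: "(\<lambda>z. F z - c) holomorphic_on slit_plane" by (intro holomorphic_intros Fh)
    show "continuous_on (cball z1 \<rho>) (\<lambda>z. F z - c)"
      using holomorphic_on_imp_continuous_on[OF h] sub continuous_on_subset by blast
    show "(\<lambda>z. F z - c) holomorphic_on ball z1 \<rho>"
      by (rule holomorphic_on_subset[OF h]) (use sub ball_subset_cball in blast)
    show "0 < \<rho>" by (rule \<rho>)
    fix y assume y: "norm (z1 - y) = \<rho>"
    then have "y \<in> cball z1 \<rho>" by (simp add: dist_norm)
    then have "\<delta> * norm (y - z1) \<le> norm (F y - F z1)"
      unfolding F_def using \<rho>(3) norm2 n(1) by (intro uni) auto
    then have "\<delta> * \<rho> \<le> norm (F y - F z1)" using y by (simp add: norm_minus_commute)
    also have "\<dots> \<le> norm (F y - c) + norm (F z1 - c)"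
      using norm_triangle_ineq4[of "F y - c" "F z1 - c"] by simp
    finally show "norm (F z1 - c) < norm (F y - c)" using n(2) by (simp add: F_def dist_norm)
  qed blast
  have Re\<zeta>: "Re \<zeta> < 1" using subsetD[OF \<rho>(3), of \<zeta>] \<zeta>(1) by simp
  have F\<zeta>: "F \<zeta> = c" using \<zeta>(2) by simp
  obtain X where X: "blocks k n = V @ True # X @ [True]" using kV[OF n(1)] by blast
  \<comment> \<open>Exchanging the last letter B for A rewrites \<open>F\<close> with parameter 1
    instead of 0. This leaves room to decrease the parameter, and \<open>W\<close> still extends
    \<open>V @ [True]\<close>, hence stays above the words of \<open>l\<close>.\<close>
  define W where "W = V @ True # X @ [False]"
  have FW: "F y = G W 1 y" if "y \<in> slit_plane" for y
    using G_snoc(3)[OF that, of "V @ True # X"] by (simp add: F_def X W_def)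
  have ev: "\<forall>\<^sub>F n in sequentially. subdisc (G (blocks l n) 0) (G W s)" if "0 \<le> s" "s \<le> 1" for s
    unfolding eventually_sequentially W_def using below[OF _ that] by blast
  have out: False if "0 < s" "s \<le> 1" "Re y < 1" "norm y > 1" "G W s y = c" for s y
    by (rule no_outside_root[OF _ _ mean_pos_s that(3-5) z(3,4) lim2 ev]) (use that in auto)
  have "norm \<zeta> \<le> 1"
    using out[of 1 \<zeta>] Re\<zeta> F\<zeta> FW[OF Re_less_slit[OF Re\<zeta>]] by (cases "norm \<zeta> \<le> 1") auto
  \<comment> \<open>Otherwise all later truncations for \<open>k\<close>, whose images are larger,
    would take the value \<open>c\<close> at points of norm at most \<open>norm \<zeta>\<close>; by
    the uniform univalence bound such points tend to \<open>z1\<close>, which has norm 1.\<close>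
  moreover have "\<not> norm \<zeta> < 1"
  proof
    assume small: "norm \<zeta> < 1"
    have "\<forall>\<^sub>F m in sequentially. dist (G (blocks k m) 0 z1) c < \<delta> * (1 - norm \<zeta>)"
      using tendstoD[OF lim1, of "\<delta> * (1 - norm \<zeta>)"] \<delta> small by simp
    then obtain m where m: "m \<ge> n" "dist (G (blocks k m) 0 z1) c < \<delta> * (1 - norm \<zeta>)"
      unfolding eventually_sequentially by (meson nat_le_linear order_trans)
    have "subdisc F (G (blocks k m) 0)"
      unfolding F_def blocks_split[OF m(1), of k] by (rule subdisc_lower) auto
    then obtain y where y: "norm y \<le> norm \<zeta>" "G (blocks k m) 0 y = c"
      using small F\<zeta> unfolding subdisc_def by (metis mem_ball_0)
    have "\<delta> * norm (y - z1) \<le> norm (G (blocks k m) 0 y - G (blocks k m) 0 z1)"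
      using y small m(1) n(1) complex_Re_le_cmod[of y] by (intro uni) auto
    also have "\<dots> < \<delta> * (1 - norm \<zeta>)" using m(2) by (simp add: y dist_norm norm_minus_commute)
    finally have "norm (y - z1) < 1 - norm \<zeta>" using \<delta> by simp
    then show False using norm_triangle_sub[of z1 y] y z(1) by (simp add: norm_minus_commute)
  qed
  ultimately have n1: "norm \<zeta> = 1" by simp
  have ne: "\<zeta> \<noteq> 1" "\<zeta> \<noteq> 0" using Re\<zeta> n1 by auto
  obtain \<epsilon> where \<epsilon>: "\<epsilon> > 0" "\<And>s. 0 \<le> s \<Longrightarrow> s \<le> 1 \<Longrightarrow> s \<noteq> 1 \<Longrightarrow> \<bar>s - 1\<bar> < \<epsilon> \<Longrightarrow>
       \<exists>z\<in>ball \<zeta> 1. Re z < 1 \<and> G W s z = G W 1 \<zeta> \<and> (1 < s \<longrightarrow> norm z < norm \<zeta>) \<and> (s < 1 \<longrightarrow> norm \<zeta> < norm z)"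
    by (rule root_moves[OF zero_less_one order_refl eq_refl[OF n1] ne zero_less_one, of W]) blast
  define s where "s = max (1 / 2) (1 - \<epsilon> / 2)"
  have s: "0 < s" "s < 1" "\<bar>s - 1\<bar> < \<epsilon>" using \<epsilon>(1) by (auto simp: s_def max_def)
  then obtain y where "Re y < 1" "G W s y = c" "norm y > 1"
    using \<epsilon>(2)[of s] n1 F\<zeta> FW[OF Re_less_slit[OF Re\<zeta>]] by auto
  then show False using out[of s y] s by simp
qed

theorem theorem4p14:
  shows "(\<forall>k l :: nat \<Rightarrow> nat. (\<forall>i. k i \<ge> 1) \<longrightarrow> (\<forall>i. l i \<ge> 1) \<longrightarrow> k \<noteq> l \<longrightarrow>
            (\<forall>z1 z2 :: complex. norm z1 = 1 \<longrightarrow> norm z2 = 1 \<longrightarrow> z1 \<noteq> 1 \<longrightarrow> z2 \<noteq> 1 \<longrightarrow>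
               H_inf k z1 \<noteq> H_inf l z2))
       \<and> (\<forall>k :: nat \<Rightarrow> nat. (\<forall>i. k i \<ge> 1) \<longrightarrow> inj_on (H_inf k) (sphere 0 1 - {1}))"
proof (intro conjI allI impI)
  fix k l :: "nat \<Rightarrow> nat" and z1 z2 :: complex
  assume k: "\<forall>i. k i \<ge> 1" and l: "\<forall>i. l i \<ge> 1" and ne: "k \<noteq> l"
    and z: "norm z1 = 1" "norm z2 = 1" "z1 \<noteq> 1" "z2 \<noteq> 1"
  define i where "i = (LEAST i. k i \<noteq> l i)"
  have ex: "\<exists>i. k i \<noteq> l i" using ne by auto
  have i: "k i \<noteq> l i" "\<And>j. j < i \<Longrightarrow> k j = l j"
    using LeastI_ex[OF ex] not_less_Least[of _ "\<lambda>i. k i \<noteq> l i"] unfolding i_def by blast+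
  show "H_inf k z1 \<noteq> H_inf l z2"
  proof (cases "k i < l i")
    case True
    then show ?thesis using first_difference[of k l i z1 z2] k l i z by blast
  next
    case False
    then have "l i < k i" using i(1) by simp
    then show ?thesis using first_difference[of l k i z2 z1] k l i(2) z by metis
  qed
next
  fix k :: "nat \<Rightarrow> nat" assume k: "\<forall>i. k i \<ge> 1"
  show "inj_on (H_inf k) (sphere 0 1 - {1})"
  proof (rule inj_onI)
    fix z w :: complex
    assume z: "z \<in> sphere 0 1 - {1}" "w \<in> sphere 0 1 - {1}" and eq: "H_inf k z = H_inf k w"
    show "z = w" by (rule H_inf_inj[OF _ _ _ _ eq]) (use k z in \<open>auto intro!: Re_less_1\<close>)
  qed
qed

end
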